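(* The pseudo-arc $\mathbb{P}$ is generic over every dominating subcategory $\mathcal{K}\subseteq\mathsf{Peano}_{\mathsf{s}}$ (in particular, over every full subcategory $\mathcal{K}\subseteq\mathsf{Peano}_{\mathsf{s}}$ containing a non-degenerate space). That is, when playing the Banach–Mazur game $\mathrm{BM}(\mathcal{K})$, the second player has a strategy forcing the inverse limit of the resulting sequence to be homeomorphic to $\mathbb{P}$.
   Context: A Peano continuum is a non-empty, locally connected metrizable continuum (equivalently, a continuous Hausdorff image of $[0,1]$). $\mathsf{Peano}_{\mathsf{s}}$ is the category of all Peano continua and all continuous surjections. The pseudo-arc $\mathbb{P}$ is the unique (up to homeomorphism; Bing) hereditarily indecomposable arc-like continuum; here a continuum is arc-like if it is the limit of an inverse sequence of continuous surjections between copies of $[0,1]$, and hereditarily indecomposable if any two of its subcontinua are disjoint or comparable by inclusion. A space is non-degenerate if it has more than one point. A subcategory $\mathcal{D}$ of a category $\mathcal{C}$ is dominating if it is both cofinal (for every $\mathcal{C}$-object $X$ there is a $\mathcal{C}$-map $f\colon Y\to X$ from a $\mathcal{D}$-object $Y$) and absorbing (for every $\mathcal{D}$-object $X$ and every $\mathcal{C}$-map $f\colon Y\to X$ there is a $\mathcal{C}$-map $g\colon Z\to Y$ such that $f\circ g\in\mathcal{D}$). The Banach–Mazur game $\mathrm{BM}(\mathcal{K})$: two players, Eve (first) and Odd (second), alternate. Eve picks a $\mathcal{K}$-map $f_0\colon X_1\to X_0$, Odd picks a $\mathcal{K}$-map $f_1\colon X_2\to X_1$, Eve picks a $\mathcal{K}$-map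 $f_2\colon X_3\to X_2$, and so on. The outcome is the inverse sequence $f_*=\langle f_n\rangle_{n\in\omega}$ in $\mathcal{K}$. A space $X$ is generic over $\mathcal{K}$ if Odd has a strategy guaranteeing that the topological inverse limit of $f_*$ is homeomorphic to $X$. *)

theory Defs
  imports "HOL-Analysis.Analysis"
begin

section \<open>Continua\<close>

definition continuum_space :: "'a topology \<Rightarrow> bool" where
  "continuum_space X \<longleftrightarrow> compact_space X \<and> connected_space X \<and> Hausdorff_space X"

definition Peano_continuum :: "'a topology \<Rightarrow> bool" where
  "Peano_continuum X \<longleftrightarrow>
     continuum_space X \<and> topspace X \<noteq> {} \<and> metrizable_space X \<and> locally_connected_space X"

definition nondegenerate :: "'a topology \<Rightarrow> bool" where
  "nondegenerate X \<longleftrightarrow> (\<exists>x\<in>topspace X. \<exists>y\<in>topspace X. x \<noteq> y)"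

definition hereditarily_indecomposable :: "'a topology \<Rightarrow> bool" where
  "hereditarily_indecomposable X \<longleftrightarrow>
     (\<forall>A B. A \<subseteq> topspace X \<and> continuum_space (subtopology X A) \<and>
            B \<subseteq> topspace X \<and> continuum_space (subtopology X B) \<longrightarrow>
            A \<inter> B = {} \<or> A \<subseteq> B \<or> B \<subseteq> A)"

text \<open>The limit of \<open>X 0 \<leftarrow> X 1 \<leftarrow> X 2 \<leftarrow> \<dots>\<close>, where \<open>f n\<close> is the bonding map
  from \<open>X (Suc n)\<close> to \<open>X n\<close>.\<close>

definition inverse_limit :: "(nat \<Rightarrow> 'a topology) \<Rightarrow> (nat \<Rightarrow> 'a \<Rightarrow> 'a) \<Rightarrow> (nat \<Rightarrow> 'a) topology" where
  "inverse_limit X f = subtopology (product_topology X UNIV) {x. \<forall>n. f n (x (Suc n)) = x n}"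

definition arc_like :: "'a topology \<Rightarrow> bool" where
  "arc_like P \<longleftrightarrow>
     (\<exists>f :: nat \<Rightarrow> real \<Rightarrow> real.
        (\<forall>n. continuous_map (top_of_set {0..1}) (top_of_set {0..1}) (f n) \<and> f n ` {0..1} = {0..1}) \<and>
        P homeomorphic_space inverse_limit (\<lambda>n. top_of_set {0..1}) f)"

text \<open>By Bing's theorem this determines \<open>P\<close> up to homeomorphism.\<close>

definition pseudo_arc :: "'a topology \<Rightarrow> bool" where
  "pseudo_arc P \<longleftrightarrow> continuum_space P \<and> arc_like P \<and> hereditarily_indecomposable P"

section \<open>Categories of topological spaces\<close>

text \<open>The underlying function of an arrow is meant to be extensional (constantly
  \<^const>\<open>undefined\<close> outside the domain), so that equality of arrows is equality of maps.\<close>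

record 'a arrow =
  Dom :: "'a topology"
  Cod :: "'a topology"
  Fun :: "'a \<Rightarrow> 'a"

record 'a top_cat =
  Obj :: "'a topology set"
  Arr :: "'a arrow set"

definition id_arrow :: "'a topology \<Rightarrow> 'a arrow" where
  "id_arrow X = \<lparr>Dom = X, Cod = X, Fun = restrict (\<lambda>x. x) (topspace X)\<rparr>"

definition comp_arrow :: "'a arrow \<Rightarrow> 'a arrow \<Rightarrow> 'a arrow" where
  "comp_arrow f g = \<lparr>Dom = Dom g, Cod = Cod f, Fun = compose (topspace (Dom g)) (Fun f) (Fun g)\<rparr>"

definition Peano_s :: "'a top_cat" where
  "Peano_s =
     \<lparr>Obj = {X. Peano_continuum X},
      Arr = {f. Peano_continuum (Dom f) \<and> Peano_continuum (Cod f) \<and>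
                continuous_map (Dom f) (Cod f) (Fun f) \<and>
                Fun f ` topspace (Dom f) = topspace (Cod f) \<and>
                Fun f \<in> extensional (topspace (Dom f))}\<rparr>"

definition subcategory :: "'a top_cat \<Rightarrow> 'a top_cat \<Rightarrow> bool" where
  "subcategory D C \<longleftrightarrow>
     Obj D \<subseteq> Obj C \<and> Arr D \<subseteq> Arr C \<and>
     (\<forall>f\<in>Arr D. Dom f \<in> Obj D \<and> Cod f \<in> Obj D) \<and>
     (\<forall>X\<in>Obj D. id_arrow X \<in> Arr D) \<and>
     (\<forall>f\<in>Arr D. \<forall>g\<in>Arr D. Cod g = Dom f \<longrightarrow> comp_arrow f g \<in> Arr D)"

definition full_subcategory :: "'a top_cat \<Rightarrow> 'a top_cat \<Rightarrow> bool" where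
  "full_subcategory D C \<longleftrightarrow>
     subcategory D C \<and> (\<forall>f\<in>Arr C. Dom f \<in> Obj D \<and> Cod f \<in> Obj D \<longrightarrow> f \<in> Arr D)"

definition cofinal :: "'a top_cat \<Rightarrow> 'a top_cat \<Rightarrow> bool" where
  "cofinal D C \<longleftrightarrow> (\<forall>X\<in>Obj C. \<exists>f\<in>Arr C. Dom f \<in> Obj D \<and> Cod f = X)"

definition absorbing :: "'a top_cat \<Rightarrow> 'a top_cat \<Rightarrow> bool" where
  "absorbing D C \<longleftrightarrow>
     (\<forall>f\<in>Arr C. Cod f \<in> Obj D \<longrightarrow> (\<exists>g\<in>Arr C. Cod g = Dom f \<and> comp_arrow f g \<in> Arr D))"

definition dominating :: "'a top_cat \<Rightarrow> 'a top_cat \<Rightarrow> bool" where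
  "dominating D C \<longleftrightarrow> subcategory D C \<and> cofinal D C \<and> absorbing D C"

section \<open>The Banach--Mazur game\<close>

text \<open>Positions list the moves \<open>f\<^sub>0, f\<^sub>1, \<dots>\<close> made so far. Eve makes the even-numbered moves,
  so Odd is to move exactly at the positions of odd length.\<close>

definition position :: "'a top_cat \<Rightarrow> 'a arrow list \<Rightarrow> bool" where
  "position K h \<longleftrightarrow> set h \<subseteq> Arr K \<and> (\<forall>i. Suc i < length h \<longrightarrow> Cod (h ! Suc i) = Dom (h ! i))"

definition run :: "'a top_cat \<Rightarrow> (nat \<Rightarrow> 'a arrow) \<Rightarrow> bool" where
  "run K f \<longleftrightarrow> (\<forall>n. f n \<in> Arr K \<and> Cod (f (Suc n)) = Dom (f n))"

text \<open>A strategy must always answer with a legal move; the clause on runs alone would be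
  satisfied vacuously by illegal answers.\<close>

definition Odd_strategy :: "'a top_cat \<Rightarrow> ('a arrow list \<Rightarrow> 'a arrow) \<Rightarrow> bool" where
  "Odd_strategy K \<sigma> \<longleftrightarrow> (\<forall>h. position K h \<and> odd (length h) \<longrightarrow> position K (h @ [\<sigma> h]))"

definition follows :: "('a arrow list \<Rightarrow> 'a arrow) \<Rightarrow> (nat \<Rightarrow> 'a arrow) \<Rightarrow> bool" where
  "follows \<sigma> f \<longleftrightarrow> (\<forall>n. odd n \<longrightarrow> f n = \<sigma> (map f [0..<n]))"

definition generic_over :: "'p topology \<Rightarrow> 'a top_cat \<Rightarrow> bool" where
  "generic_over P K \<longleftrightarrow>
     (\<exists>\<sigma>. Odd_strategy K \<sigma> \<and>
        (\<forall>f. run K f \<and> follows \<sigma> f \<longrightarrow>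
             inverse_limit (\<lambda>n. Cod (f n)) (\<lambda>n. Fun (f n)) homeomorphic_space P))"

end

theory Submission
  imports Defs
begin

text \<open>Indecomposability enters through folds. On an arc the lifting fails: the identity does
  not lift approximately through an N-shaped fold by a map onto the whole domain of the fold,
  because such a lift has to run through the decreasing branch. In a hereditarily indecomposable
  space the map can be cut into three closed pieces, one for each branch, that meet only where
  adjacent branches agree.

  In the game two errors must be controlled. A link between consecutive intervals of Odd only
  approximates a bonding map of \<open>f\<close>, and the discrepancy is carried down to all lower
  levels; \<open>err\<close> bounds it and is fixed before Eve answers, which the Fraisse property
  permits because it holds for every tolerance and every surjection. On the other side, points with
  the same image in the limit of \<open>f\<close> must be equal; this needs tolerances
  \<open>tol\<close> below the moduli of continuity of the composed links, so each
  \<open>tol\<close> is chosen only after the link it has to respect.\<close>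

text \<open>Write \<open>P\<close> as the limit of surjections \<open>f\<^sub>n\<close> of the interval. Hereditary indecomposability
  yields the Fraisse property: for every continuous surjection \<open>g\<close> of the interval and every \<open>n\<close>,
  some bonding map from level \<open>m\<close> to level \<open>n\<close> is uniformly close to \<open>g \<circ> h\<close> for a continuous surjection
  \<open>h\<close>. Indeed the projection of \<open>P\<close> to level \<open>n\<close> lifts approximately through an N-shaped fold, every
  piecewise linear \<open>g\<close> becomes a composite of such folds after precomposition, and a map from \<open>P\<close> to the
  interval is close to one that depends on a single coordinate.

  Odd always factors his move through the interval, using a Peano curve onto the last space and
  absorption. The composite of Eve's answer with the next Peano curve and Odd's previous factor is
  then a surjection \<open>g\<close> of the interval, and Odd inserts the \<open>h\<close> given by the Fraisse property, so that
  his intervals form an inverse sequence close to a subsequence of \<open>f\<close>. Two inverse sequences that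
  are close enough have homeomorphic limits, so Bing's uniqueness theorem is not needed.\<close>

section \<open>The Hahn--Mazurkiewicz theorem\<close>

text \<open>A Peano curve is the uniform limit of step functions: every member of a chain of connected sets
  is replaced by a walk through the members of a finer cover that meet it, which exists because the
  nerve of these members is connected.\<close>

definition chain_walk :: "'a set \<Rightarrow> 'a set set \<Rightarrow> 'a set list \<Rightarrow> bool" where
  "chain_walk U \<V> L \<longleftrightarrow> L \<noteq> [] \<and> set L \<subseteq> {V\<in>\<V>. V \<inter> U \<noteq> {}} \<and> successively (\<lambda>V W. V \<inter> W \<noteq> {}) L"

lemma chain_walk_append:
  assumes "chain_walk U \<V> L" "chain_walk U \<V> L'" "last L \<inter> hd L' \<noteq> {}"
  shows "chain_walk U \<V> (L @ L')"
  using assms by (auto simp: chain_walk_def successively_append_iff)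

text \<open>If the nerve of the members that meet \<open>U\<close> were disconnected, the union of
  the members reachable from one of them and the union of the others would separate
  \<open>U\<close>. The prescribed ends \<open>p\<close> and \<open>q\<close> allow walks in
  neighbouring sets to be joined, and visiting every member keeps \<open>U\<close> covered.\<close>

lemma chain_walk_exists:
  assumes U: "connectedin X U" and \<V>: "finite \<V>" "\<And>V. V \<in> \<V> \<Longrightarrow> openin X V" "U \<subseteq> \<Union>\<V>"
    and pq: "p \<in> U" "q \<in> U"
  obtains L where "chain_walk U \<V> L" "p \<in> hd L" "q \<in> last L" "U \<subseteq> \<Union>(set L)"
proof -
  define \<W> where "\<W> = {V\<in>\<V>. V \<inter> U \<noteq> {}}"
  define E where "E = {(V, W). V \<in> \<W> \<and> W \<in> \<W> \<and> V \<inter> W \<noteq> {}}"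
  have UW: "U \<subseteq> \<Union>\<W>" using \<V>(3) by (auto simp: \<W>_def)
  have reach: "(V, W) \<in> E\<^sup>*" if V: "V \<in> \<W>" and W: "W \<in> \<W>" for V W
  proof (rule ccontr)
    assume nr: "(V, W) \<notin> E\<^sup>*"
    define A where "A = {Z\<in>\<W>. (V, Z) \<in> E\<^sup>*}"
    have VA: "V \<in> A" "W \<in> \<W> - A" using V W nr by (auto simp: A_def)
    have "openin X (\<Union>A)" "openin X (\<Union>(\<W> - A))"
      using \<V>(2) by (auto simp: A_def \<W>_def intro!: openin_Union)
    moreover have "U \<subseteq> \<Union>A \<union> \<Union>(\<W> - A)" using UW by blast
    moreover have "\<Union>A \<inter> \<Union>(\<W> - A) \<inter> U = {}"
    proof (rule ccontr)
      assume "\<Union>A \<inter> \<Union>(\<W> - A) \<inter> U \<noteq> {}"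
      then obtain x Z Z' where x: "Z \<in> A" "Z' \<in> \<W>" "Z' \<notin> A" "x \<in> Z" "x \<in> Z'" by blast
      then have "(V, Z) \<in> E\<^sup>*" "(Z, Z') \<in> E" by (auto simp: A_def E_def)
      then have "(V, Z') \<in> E\<^sup>*" by (rule rtrancl_into_rtrancl)
      then show False using x by (simp add: A_def)
    qed
    moreover have "V \<inter> U \<noteq> {}" "W \<inter> U \<noteq> {}" using V W by (auto simp: \<W>_def)
    then have "\<Union>A \<inter> U \<noteq> {}" "\<Union>(\<W> - A) \<inter> U \<noteq> {}" using VA by blast+
    ultimately show False using U unfolding connectedin by metis
  qed
  have walk: "\<exists>L. chain_walk U \<V> L \<and> hd L = V \<and> last L = W" if "(V, W) \<in> E\<^sup>*" "V \<in> \<W>" for V W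
    using that
  proof (induction rule: rtrancl_induct)
    case base
    then show ?case by (intro exI[of _ "[V]"]) (auto simp: chain_walk_def \<W>_def)
  next
    case (step Y Z)
    then obtain L where L: "chain_walk U \<V> L" "hd L = V" "last L = Y" by blast
    have "chain_walk U \<V> [Z]" "Y \<inter> Z \<noteq> {}" using step by (auto simp: chain_walk_def E_def \<W>_def)
    then have "chain_walk U \<V> (L @ [Z])" using L by (intro chain_walk_append) auto
    moreover have "L \<noteq> []" using L by (simp add: chain_walk_def)
    ultimately show ?case using L by (intro exI[of _ "L @ [Z]"]) auto
  qed
  have visit: "\<exists>L. chain_walk U \<V> L \<and> hd L = V \<and> last L \<in> \<W> \<and> S \<subseteq> set L"
    if "finite S" "S \<subseteq> \<W>" "V \<in> \<W>" for V S
    using that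
  proof (induction S rule: finite_induct)
    case empty
    then show ?case by (intro exI[of _ "[V]"]) (auto simp: chain_walk_def \<W>_def)
  next
    case (insert W S)
    then obtain L where L: "chain_walk U \<V> L" "hd L = V" "last L \<in> \<W>" "S \<subseteq> set L" by blast
    obtain L' where L': "chain_walk U \<V> L'" "hd L' = last L" "last L' = W"
      using walk[OF reach[OF L(3)] L(3)] insert.prems by blast
    have "last L \<noteq> {}" using L(3) by (auto simp: \<W>_def)
    then have "chain_walk U \<V> (L @ L')" using L L' by (intro chain_walk_append) auto
    moreover have "L \<noteq> []" "L' \<noteq> []" using L L' by (simp_all add: chain_walk_def)
    moreover from this have "W \<in> set L'" using L'(3) last_in_set by blast
    ultimately show ?case using L L' insert.prems by (intro exI[of _ "L @ L'"]) auto
  qed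
  obtain V W where V: "V \<in> \<W>" "p \<in> V" and W: "W \<in> \<W>" "q \<in> W" using UW pq by blast
  obtain L where L: "chain_walk U \<V> L" "hd L = V" "last L \<in> \<W>" "\<W> \<subseteq> set L"
    using visit[of \<W> V] V \<V>(1) by (auto simp: \<W>_def)
  obtain L' where L': "chain_walk U \<V> L'" "hd L' = last L" "last L' = W"
    using walk[OF reach[OF L(3) W(1)] L(3)] by blast
  have "last L \<noteq> {}" using L(3) by (auto simp: \<W>_def)
  then have "chain_walk U \<V> (L @ L')" using L L' by (intro chain_walk_append) auto
  moreover have "L \<noteq> []" "L' \<noteq> []" using L L' by (simp_all add: chain_walk_def)
  moreover have "U \<subseteq> \<Union>(set (L @ L'))" using UW Union_mono[OF L(4)] by auto
  ultimately show thesis using that[of "L @ L'"] V W L L' by auto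
qed

text \<open>The sets are indexed, and may repeat, because the i-th set will receive the i-th of
  \<open>k\<close> equal subintervals of the unit interval.\<close>

definition linked_cover :: "'a topology \<Rightarrow> nat \<Rightarrow> (nat \<Rightarrow> 'a set) \<Rightarrow> bool" where
  "linked_cover X k C \<longleftrightarrow> 0 < k \<and> (\<forall>i<k. connectedin X (C i) \<and> C i \<noteq> {}) \<and>
     (\<forall>i. Suc i < k \<longrightarrow> C i \<inter> C (Suc i) \<noteq> {}) \<and> topspace X = (\<Union>i<k. C i)"

lemma linked_cover_refine:
  assumes C: "linked_cover X k C" and \<V>: "finite \<V>" "topspace X \<subseteq> \<Union>\<V>"
    and V: "\<And>V. V \<in> \<V> \<Longrightarrow> openin X V \<and> connectedin X V"
  shows "\<exists>N C'. 0 < N \<and> linked_cover X (k * N) C' \<and> (\<forall>j<k * N. C' j \<in> \<V> \<and> C' j \<inter> C (j div N) \<noteq> {})"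
proof -
  have C: "0 < k" "\<And>i. i < k \<Longrightarrow> connectedin X (C i)" "\<And>i. i < k \<Longrightarrow> C i \<noteq> {}"
    "\<And>i. Suc i < k \<Longrightarrow> C i \<inter> C (Suc i) \<noteq> {}" "topspace X = (\<Union>i<k. C i)"
    using C unfolding linked_cover_def by auto
  have "\<exists>p. \<forall>i<k. p i \<in> C i \<and> (0 < i \<longrightarrow> p i \<in> C (i - 1))"
  proof -
    have "\<exists>x. x \<in> C i \<and> (0 < i \<longrightarrow> x \<in> C (i - 1))" if "i < k" for i
      using C(3)[OF that] C(4)[of "i - 1"] that by (cases i) auto
    then show ?thesis by metis
  qed
  then obtain p where p: "\<And>i. i < k \<Longrightarrow> p i \<in> C i" "\<And>i. Suc i < k \<Longrightarrow> p (Suc i) \<in> C i" by fastforce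
  \<comment> \<open>The walk in \<open>C i\<close> ends at the point where the walk in
    \<open>C (Suc i)\<close> begins, so the last set of the one meets the first set of the
    other.\<close>
  define q where "q i = (if Suc i < k then p (Suc i) else p i)" for i
  have q: "q i \<in> C i" if "i < k" for i using p that by (simp add: q_def)
  have "\<exists>L. chain_walk (C i) \<V> L \<and> p i \<in> hd L \<and> q i \<in> last L \<and> C i \<subseteq> \<Union>(set L)" if i: "i < k" for i
  proof -
    have "C i \<subseteq> \<Union>\<V>" using C(5) \<V>(2) i by blast
    then show ?thesis
      using chain_walk_exists[OF C(2)[OF i] \<V>(1) _ _ p(1)[OF i] q[OF i]] V by metis
  qed
  then obtain L where L: "\<And>i. i < k \<Longrightarrow> chain_walk (C i) \<V> (L i)" "\<And>i. i < k \<Longrightarrow> p i \<in> hd (L i)"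
    "\<And>i. i < k \<Longrightarrow> q i \<in> last (L i)" "\<And>i. i < k \<Longrightarrow> C i \<subseteq> \<Union>(set (L i))" by metis
  \<comment> \<open>The walks are padded to a common length by repeating their last set. Every set
    is then split into equally many, and \<open>j div N\<close> is the parent of
    \<open>j\<close>.\<close>
  define N where "N = Suc (Max ((\<lambda>i. length (L i)) ` {..<k}))"
  have N: "length (L i) < N" if "i < k" for i using that by (auto simp: N_def less_Suc_eq_le)
  define D where "D i r = (if r < length (L i) then L i ! r else last (L i))" for i r
  have ne: "L i \<noteq> []" if "i < k" for i using L(1)[OF that] by (simp add: chain_walk_def)
  have D0: "D i 0 = hd (L i)" "D i (N - 1) = last (L i)" if "i < k" for i
    using ne[OF that] N[OF that] by (auto simp: D_def hd_conv_nth last_conv_nth)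
  have Dset: "D i r \<in> set (L i)" if "i < k" for i r using ne[OF that] by (auto simp: D_def)
  have Dmem: "D i r \<in> \<V> \<and> D i r \<inter> C i \<noteq> {}" if "i < k" for i r
    using Dset[OF that, of r] L(1)[OF that] by (auto simp: chain_walk_def)
  have Dsucc: "D i r \<inter> D i (Suc r) \<noteq> {}" if "i < k" for i r
  proof (cases "Suc r < length (L i)")
    case True
    then show ?thesis using L(1)[OF that] by (simp add: chain_walk_def successively_conv_nth D_def)
  next
    case False
    then have "D i r = D i (Suc r)" using ne[OF that] by (auto simp: D_def last_conv_nth not_less le_Suc_eq)
    then show ?thesis using Dmem[OF that, of r] by auto
  qed
  define C' where "C' j = D (j div N) (j mod N)" for j
  have N0: "0 < N" by (simp add: N_def)
  have jk: "j div N < k" if "j < k * N" for j using that by (simp add: less_mult_imp_div_less)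
  have mem: "C' j \<in> \<V> \<and> C' j \<inter> C (j div N) \<noteq> {}" if "j < k * N" for j
    unfolding C'_def by (rule Dmem[OF jk[OF that]])
  have "linked_cover X (k * N) C'"
    unfolding linked_cover_def
  proof (intro conjI allI impI)
    show "0 < k * N" using N0 C(1) by simp
    show "connectedin X (C' j)" "C' j \<noteq> {}" if "j < k * N" for j using mem[OF that] V by auto
    show "C' j \<inter> C' (Suc j) \<noteq> {}" if j: "Suc j < k * N" for j
    proof (cases "Suc j mod N = 0")
      case False
      then have "Suc j div N = j div N" "Suc j mod N = Suc (j mod N)" by (auto simp: div_Suc mod_Suc)
      then show ?thesis using Dsucc[of "j div N"] jk[of j] j by (simp add: C'_def)
    next
      case True
      then have "Suc j div N = Suc (j div N)" "j mod N = N - 1" using N0 by (auto simp: div_Suc mod_Suc split: if_splits)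
      moreover have "Suc (j div N) < k" using jk[OF j] calculation by simp
      moreover from this have "q (j div N) = p (Suc (j div N))" by (simp add: q_def)
      moreover have "j div N < k" using jk j by simp
      ultimately have "p (Suc (j div N)) \<in> C' j \<inter> C' (Suc j)" using L(2,3) D0 True
        by (metis C'_def IntI)
      then show ?thesis by blast
    qed
    have "x \<in> (\<Union>j<k * N. C' j)" if x: "x \<in> topspace X" for x
    proof -
      obtain i where i: "i < k" "x \<in> C i" using x C(5) by auto
      then obtain r where r: "r < length (L i)" "x \<in> L i ! r" using L(4)[OF i(1)] by (metis UnionE in_set_conv_nth subsetD)
      have rN: "r < N" using r N[OF i(1)] by simp
      then have "x \<in> C' (i * N + r)" using r by (simp add: C'_def D_def)
      moreover have "i * N + r < k * N"
      proof -
        have "i * N + r < Suc i * N" using rN by simp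
        also have "\<dots> \<le> k * N" using i(1) by (intro mult_le_mono1) simp
        finally show ?thesis .
      qed
      ultimately show ?thesis by blast
    qed
    moreover have "C' j \<subseteq> topspace X" if "j < k * N" for j using mem[OF that] V openin_subset by blast
    ultimately show "topspace X = (\<Union>j<k * N. C' j)" by blast
  qed
  with N0 mem show ?thesis by (intro exI[of _ N] exI[of _ C']) simp
qed

context Metric_space begin

lemma small_connected_cover:
  assumes "compact_space mtopology" "locally_connected_space mtopology" "0 < r"
  obtains \<V> where "finite \<V>" "M \<subseteq> \<Union>\<V>" "\<And>V. V \<in> \<V> \<Longrightarrow> openin mtopology V \<and> connectedin mtopology V"
    "\<And>V x y. V \<in> \<V> \<Longrightarrow> x \<in> V \<Longrightarrow> y \<in> V \<Longrightarrow> d x y < r"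
proof -
  define \<U> where "\<U> = {V. openin mtopology V \<and> connectedin mtopology V \<and> (\<forall>x\<in>V. \<forall>y\<in>V. d x y < r)}"
  have "\<exists>V\<in>\<U>. x \<in> V" if x: "x \<in> M" for x
  proof -
    have nb: "neighbourhood_base_of (\<lambda>U. openin mtopology U \<and> connectedin mtopology U) mtopology"
      using assms(2) locally_connected_space_alt by blast
    have "openin mtopology (mball x (r/2))" "x \<in> mball x (r/2)" using x assms(3) by auto
    then obtain V where V: "openin mtopology V" "connectedin mtopology V" "x \<in> V" "V \<subseteq> mball x (r/2)"
      using nb unfolding neighbourhood_base_of by (metis subsetD)
    have "d y z < r" if "y \<in> V" "z \<in> V" for y z
    proof -
      have yz: "y \<in> M" "z \<in> M" "d x y < r/2" "d x z < r/2" using that V(4) by auto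
      then show ?thesis using triangle[of y x z] commute[of y x] x by auto
    qed
    with V show ?thesis unfolding \<U>_def by blast
  qed
  then have "M \<subseteq> \<Union>\<U>" by blast
  moreover have "\<forall>V\<in>\<U>. openin mtopology V" by (simp add: \<U>_def)
  ultimately obtain \<V> where "finite \<V>" "\<V> \<subseteq> \<U>" "M \<subseteq> \<Union>\<V>"
    using assms(1) unfolding compact_space_alt by auto
  then show thesis using that unfolding \<U>_def by blast
qed

end

section \<open>Uniform subdivisions of the unit interval and the Peano curve\<close>

definition cell :: "nat \<Rightarrow> real \<Rightarrow> nat" where
  "cell k t = min (k - 1) (nat \<lfloor>t * k\<rfloor>)"

lemma cell_less: "0 < k \<Longrightarrow> cell k t < k"
  by (auto simp: cell_def)

text \<open>Subdivisions are nested: the cell of a point at the finer level has its coarser cell as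
  parent, in the sense of \<open>linked_cover_refine\<close>. The cap \<open>k - 1\<close> in
  \<open>cell\<close> puts the point 1 into the last cell at both levels.\<close>

lemma cell_div:
  assumes "0 < k" "0 < N" "t \<in> {0..1}"
  shows "cell (k * N) t div N = cell k t"
proof -
  have "\<lfloor>t * real (k * N)\<rfloor> div int N = \<lfloor>t * real k\<rfloor>"
    using floor_divide_real_eq_div[of "int N" "t * real (k * N)"] assms(2) by simp
  then have fl: "nat \<lfloor>t * real (k * N)\<rfloor> div N = nat \<lfloor>t * real k\<rfloor>"
    using assms by (metis nat_div_distrib' nat_int of_nat_0_le_iff)
  have km: "(k * N - 1) div N = k - 1"
  proof -
    obtain k' N' where "k = Suc k'" "N = Suc N'" using assms by (metis gr0_implies_Suc)
    moreover have "(N' + k' * Suc N') div Suc N' = k'" by (simp only: div_mult_self1) simp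
    moreover have "Suc k' * Suc N' - 1 = N' + k' * Suc N'" by simp
    ultimately show ?thesis by (metis diff_Suc_1)
  qed
  have mn: "min a b div N = min (a div N) (b div N)" for a b :: nat
    using div_le_mono[of a b N] div_le_mono[of b a N] by (cases "a \<le> b") (simp_all add: min_absorb1 min_absorb2)
  have "cell (k * N) t div N = min ((k * N - 1) div N) (nat \<lfloor>t * real (k * N)\<rfloor> div N)"
    unfolding cell_def by (rule mn)
  also have "\<dots> = cell k t" unfolding fl km cell_def by (rule refl)
  finally show ?thesis .
qed

lemma cell_adjacent:
  assumes "0 < k" "s \<in> {0..1}" "t \<in> {0..1}" "\<bar>s - t\<bar> < 1 / k"
  shows "cell k s = cell k t \<or> cell k s = Suc (cell k t) \<or> cell k t = Suc (cell k s)"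
proof -
  have "\<bar>s * k - t * k\<bar> < 1"
  proof -
    have "\<bar>s - t\<bar> * k < 1 / k * k" using assms by (intro mult_strict_right_mono) auto
    moreover have "\<bar>s * k - t * k\<bar> = \<bar>s - t\<bar> * k" by (simp add: left_diff_distrib[symmetric] abs_mult)
    ultimately show ?thesis using assms(1) by simp
  qed
  then have "\<lfloor>s * k\<rfloor> \<le> \<lfloor>t * k\<rfloor> + 1" "\<lfloor>t * k\<rfloor> \<le> \<lfloor>s * k\<rfloor> + 1" by linarith+
  then have "nat \<lfloor>s * k\<rfloor> \<le> Suc (nat \<lfloor>t * k\<rfloor>)" "nat \<lfloor>t * k\<rfloor> \<le> Suc (nat \<lfloor>s * k\<rfloor>)" by linarith+
  moreover have "min c a = min c b \<or> min c a = Suc (min c b) \<or> min c b = Suc (min c a)"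
    if "a \<le> Suc b" "b \<le> Suc a" for a b c :: nat using that by linarith
  ultimately show ?thesis unfolding cell_def by blast
qed

lemma cell_point: "i < k \<Longrightarrow> cell k (real i / real k) = i"
  by (simp add: cell_def)

context Metric_space begin

text \<open>The step functions \<open>g n\<close> need not be continuous. Their limit is, since
  parameters closer than \<open>1 / k n\<close> lie in equal or adjacent cells, whose sets share a
  point and have all distances below \<open>r n\<close>.\<close>

lemma peano_curve_exists:
  assumes comp: "compact_space mtopology" and conn: "connected_space mtopology"
    and lc: "locally_connected_space mtopology" and ne: "M \<noteq> {}"
  shows "\<exists>\<gamma>. continuous_map (top_of_set {0..1::real}) mtopology \<gamma> \<and> \<gamma> ` {0..1} = M"
proof -
  define r :: "nat \<Rightarrow> real" where "r n = (1/2) ^ n" for n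
  have r: "0 < r n" "r (Suc n) = r n / 2" for n by (simp_all add: r_def)
  have r0: "\<exists>n. r n < e" if "0 < e" for e using real_arch_pow_inv[OF that, of "1/2"] by (auto simp: r_def)
  define mesh where "mesh n k C \<longleftrightarrow> (\<forall>i<k. \<forall>x\<in>C i. \<forall>y\<in>C i. d x y < r n)" for n k and C :: "nat \<Rightarrow> 'a set"
  have refine: "\<exists>N C'. 0 < N \<and> linked_cover mtopology (k * N) C' \<and> mesh n (k * N) C' \<and>
      (\<forall>j<k * N. C' j \<inter> C (j div N) \<noteq> {})" if C: "linked_cover mtopology k C" for n k C
  proof -
    obtain \<V> where V: "finite \<V>" "M \<subseteq> \<Union>\<V>" "\<And>V. V \<in> \<V> \<Longrightarrow> openin mtopology V \<and> connectedin mtopology V"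
      "\<And>V x y. V \<in> \<V> \<Longrightarrow> x \<in> V \<Longrightarrow> y \<in> V \<Longrightarrow> d x y < r n"
      by (rule small_connected_cover[OF comp lc r(1)]) blast
    have V2: "topspace mtopology \<subseteq> \<Union>\<V>" using V(2) by simp
    obtain N C' where N: "0 < N" "linked_cover mtopology (k * N) C'" "\<forall>j<k * N. C' j \<in> \<V> \<and> C' j \<inter> C (j div N) \<noteq> {}"
      using linked_cover_refine[OF C V(1) V2 V(3)] by blast
    then have "mesh n (k * N) C'" using V(4) unfolding mesh_def by blast
    with N show ?thesis by (intro exI[of _ N] exI[of _ C']) simp
  qed
  have "linked_cover mtopology 1 (\<lambda>_. M)"
    using conn ne connectedin_topspace[of mtopology] by (auto simp: linked_cover_def)
  from refine[OF this, of 0] obtain k0 C0 where kC0: "linked_cover mtopology k0 C0" "mesh 0 k0 C0" by auto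
  have "\<exists>S. \<forall>n. (linked_cover mtopology (fst (S n)) (snd (S n)) \<and> mesh n (fst (S n)) (snd (S n))) \<and>
    (\<exists>N>0. fst (S (Suc n)) = fst (S n) * N \<and> (\<forall>j<fst (S n) * N. snd (S (Suc n)) j \<inter> snd (S n) (j div N) \<noteq> {}))"
  proof (rule dependent_nat_choice)
    show "\<exists>S. linked_cover mtopology (fst S) (snd S) \<and> mesh 0 (fst S) (snd S)"
      using kC0 by (intro exI[of _ "(k0, C0)"]) simp
    fix S n assume "linked_cover mtopology (fst S) (snd S) \<and> mesh n (fst S) (snd S)"
    then obtain N C' where "0 < N" "linked_cover mtopology (fst S * N) C'" "mesh (Suc n) (fst S * N) C'"
      "\<forall>j<fst S * N. C' j \<inter> snd S (j div N) \<noteq> {}"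
      using refine[of "fst S" "snd S" "Suc n"] by blast
    then show "\<exists>S'. (linked_cover mtopology (fst S') (snd S') \<and> mesh (Suc n) (fst S') (snd S')) \<and>
      (\<exists>N>0. fst S' = fst S * N \<and> (\<forall>j<fst S * N. snd S' j \<inter> snd S (j div N) \<noteq> {}))"
      by (intro exI[of _ "(fst S * N, C')"]) auto
  qed
  then obtain S where S: "\<And>n. linked_cover mtopology (fst (S n)) (snd (S n))" "\<And>n. mesh n (fst (S n)) (snd (S n))"
    "\<And>n. \<exists>N>0. fst (S (Suc n)) = fst (S n) * N \<and> (\<forall>j<fst (S n) * N. snd (S (Suc n)) j \<inter> snd (S n) (j div N) \<noteq> {})"
    by blast
  define k where "k n = fst (S n)" for n
  define C where "C n = snd (S n)" for n
  have C: "0 < k n" "\<And>i. i < k n \<Longrightarrow> C n i \<noteq> {}" "\<And>i. Suc i < k n \<Longrightarrow> C n i \<inter> C n (Suc i) \<noteq> {}" "M = (\<Union>i<k n. C n i)" for n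
    using S(1)[of n] unfolding linked_cover_def k_def C_def by auto
  have small: "d x y < r n" if "i < k n" "x \<in> C n i" "y \<in> C n i" for n i x y
    using S(2)[of n] that unfolding mesh_def k_def C_def by blast
  have CM: "x \<in> M" if "i < k n" "x \<in> C n i" for n i x using C(4) that by blast
  define c where "c n i = (SOME x. x \<in> C n i)" for n i
  have c: "c n i \<in> C n i" if "i < k n" for n i unfolding c_def by (rule someI_ex) (use C(2)[OF that] in blast)
  define g where "g n t = c n (cell (k n) t)" for n t
  have gC: "g n t \<in> C n (cell (k n) t)" for n t unfolding g_def by (rule c[OF cell_less[OF C(1)]])
  have gM: "g n t \<in> M" for n t using CM[OF cell_less[OF C(1)] gC] .
  have meet: "d x y < r m + r n" if h: "i < k m" "j < k n" "x \<in> C m i" "y \<in> C n j" "C m i \<inter> C n j \<noteq> {}" for m n i j x y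
  proof -
    obtain z where z: "z \<in> C m i" "z \<in> C n j" using h(5) by blast
    then have "d x z < r m" "d z y < r n" using small h by blast+
    moreover have "d x y \<le> d x z + d z y" using h z CM by (intro triangle) blast+
    ultimately show ?thesis by linarith
  qed
  have step: "d (g n t) (g (Suc n) t) < 2 * r n" if t: "t \<in> {0..1}" for n t
  proof -
    obtain N where N: "0 < N" "k (Suc n) = k n * N" "\<And>j. j < k n * N \<Longrightarrow> C (Suc n) j \<inter> C n (j div N) \<noteq> {}"
      using S(3)[of n] unfolding k_def C_def by blast
    have "cell (k (Suc n)) t div N = cell (k n) t" using cell_div[OF C(1) N(1) t] N(2) by simp
    then have "C n (cell (k n) t) \<inter> C (Suc n) (cell (k (Suc n)) t) \<noteq> {}"
      using N(3)[of "cell (k (Suc n)) t"] cell_less[OF C(1), of "Suc n" t] N(2) by (simp add: Int_commute)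
    then have "d (g n t) (g (Suc n) t) < r n + r (Suc n)"
      using meet[OF cell_less[OF C(1)] cell_less[OF C(1)] gC gC] by blast
    then show ?thesis using r[of n] by simp
  qed
  have "\<exists>x\<in>M. \<forall>n. d (g n t) x \<le> 4 * r n" if t: "t \<in> {0..1}" for t
  proof -
    \<comment> \<open>One step moves a point by less than \<open>2 * r n\<close>, and
      \<open>2 * r n + 4 * r (Suc n) = 4 * r n\<close>, so these balls are nested and compactness
      supplies the limit.\<close>
    define B where "B n = mcball (g n t) (4 * r n)" for n
    have "decseq B"
    proof (rule decseq_SucI)
      fix n
      show "B (Suc n) \<subseteq> B n"
      proof
        fix x assume "x \<in> B (Suc n)"
        then have x: "x \<in> M" "d (g (Suc n) t) x \<le> 4 * r (Suc n)" by (auto simp: B_def)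
        have "d (g n t) x \<le> d (g n t) (g (Suc n) t) + d (g (Suc n) t) x" using gM x by (intro triangle)
        then have "d (g n t) x \<le> 4 * r n" using step[OF t, of n] x r(2)[of n] by linarith
        then show "x \<in> B n" using x gM by (simp add: B_def)
      qed
    qed
    moreover have "closedin mtopology (B n)" "B n \<noteq> {}" for n
      using gM r(1)[of n] by (auto simp: B_def intro: less_imp_le)
         (metis centre_in_mcball_iff empty_iff less_eq_real_def mult_pos_pos zero_less_numeral)?
    ultimately have "(\<Inter>n. B n) \<noteq> {}" using compact_space_imp_nest[OF comp] by blast
    then obtain x where "\<And>n. x \<in> B n" by blast
    then have "x \<in> M" "\<forall>n. d (g n t) x \<le> 4 * r n" by (auto simp: B_def)
    then show ?thesis by blast
  qed
  then obtain \<gamma> where \<gamma>: "\<And>t. t \<in> {0..1} \<Longrightarrow> \<gamma> t \<in> M" "\<And>t n. t \<in> {0..1} \<Longrightarrow> d (g n t) (\<gamma> t) \<le> 4 * r n" by metis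
  have cont: "continuous_map (top_of_set {0..1}) mtopology \<gamma>"
    unfolding continuous_map_to_metric
  proof (intro ballI allI impI)
    fix t e :: real assume t: "t \<in> topspace (top_of_set {0..1})" and e: "0 < e"
    then have t: "t \<in> {0..1}" by simp
    \<comment> \<open>Two intersecting sets contribute \<open>2 * r n\<close>, and the passage
      between step function and limit contributes \<open>4 * r n\<close> at either
      parameter.\<close>
    obtain n where n: "r n < e / 10" using r0[of "e / 10"] e by auto
    define U where "U = {0..1} \<inter> ball t (1 / k n)"
    have "\<gamma> s \<in> mball (\<gamma> t) e" if "s \<in> U" for s
    proof -
      have s: "s \<in> {0..1}" "\<bar>s - t\<bar> < 1 / k n" using that by (auto simp: U_def dist_real_def)
      let ?i = "cell (k n) s" and ?j = "cell (k n) t"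
      have lt: "?i < k n" "?j < k n" by (rule cell_less[OF C(1)])+
      have "C n ?j \<inter> C n ?i \<noteq> {}"
        using cell_adjacent[OF C(1) s(1) t s(2)] C(2)[of ?i n] C(3)[of ?i n] C(3)[of ?j n] lt by (auto simp: Int_commute)
      then have "d (g n t) (g n s) < r n + r n" using meet[OF lt(2,1) gC gC] by blast
      moreover have "d (\<gamma> t) (\<gamma> s) \<le> d (\<gamma> t) (g n t) + d (g n t) (\<gamma> s)" "d (g n t) (\<gamma> s) \<le> d (g n t) (g n s) + d (g n s) (\<gamma> s)"
        using gM \<gamma>(1) s t by (auto intro: triangle)
      moreover have "d (\<gamma> t) (g n t) \<le> 4 * r n" "d (g n s) (\<gamma> s) \<le> 4 * r n" using \<gamma>(2)[OF t, of n] \<gamma>(2)[OF s(1), of n] by (simp_all add: commute)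
      ultimately have "d (\<gamma> t) (\<gamma> s) < e" using n by linarith
      then show ?thesis using \<gamma>(1) s t by simp
    qed
    moreover have "openin (top_of_set {0..1}) U" "t \<in> U" using t C(1)[of n] by (auto simp: U_def openin_open)
    ultimately show "\<exists>U. openin (top_of_set {0..1}) U \<and> t \<in> U \<and> (\<forall>y\<in>U. \<gamma> y \<in> mball (\<gamma> t) e)" by blast
  qed
  \<comment> \<open>The compact image is closed, so density suffices: every point shares a set
    \<open>C n i\<close> with a value of \<open>g n\<close>, which is within \<open>4 * r n\<close>
    of a value of the limit.\<close>
  have "compactin mtopology (\<gamma> ` {0..1})"
    using image_compactin[OF _ cont, of "{0..1}"] by (simp add: compactin_subtopology)
  then have "closedin mtopology (\<gamma> ` {0..1})"
    using compactin_imp_closedin Hausdorff_space_mtopology by blast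
  then have op: "openin mtopology (M - \<gamma> ` {0..1})" by (metis closedin_def topspace_mtopology)
  have "M \<subseteq> \<gamma> ` {0..1}"
  proof (rule ccontr)
    assume "\<not> M \<subseteq> \<gamma> ` {0..1}"
    then obtain x where x: "x \<in> M" "x \<notin> \<gamma> ` {0..1}" by blast
    with op obtain e where e: "0 < e" "mball x e \<subseteq> M - \<gamma> ` {0..1}" unfolding openin_mtopology by blast
    obtain n where n: "r n < e / 5" using r0[of "e / 5"] e by auto
    obtain i where i: "i < k n" "x \<in> C n i" using C(4)[of n] x(1) by blast
    define t where "t = real i / real (k n)"
    have t: "t \<in> {0..1}" using i(1) by (simp add: t_def field_simps)
    have "g n t \<in> C n i" using gC[of n t] cell_point[OF i(1)] by (simp add: t_def)
    then have "d x (g n t) < r n" using small i by blast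
    moreover have "d x (\<gamma> t) \<le> d x (g n t) + d (g n t) (\<gamma> t)" using x gM \<gamma>(1)[OF t] by (intro triangle)
    ultimately have "d x (\<gamma> t) < e" using \<gamma>(2)[OF t, of n] n by linarith
    then have "\<gamma> t \<in> mball x e" using x \<gamma>(1)[OF t] by simp
    then show False using e(2) t by blast
  qed
  moreover have "\<gamma> ` {0..1} \<subseteq> M" using \<gamma>(1) by blast
  ultimately show ?thesis using cont by blast
qed

end

theorem Hahn_Mazurkiewicz:
  assumes "Peano_continuum X"
  shows "\<exists>\<gamma>. continuous_map (top_of_set {0..1::real}) X \<gamma> \<and> \<gamma> ` {0..1} = topspace X"
proof -
  have "metrizable_space X" using assms by (simp add: Peano_continuum_def)
  then obtain M d where Md: "Metric_space M d" "X = Metric_space.mtopology M d"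
    unfolding metrizable_space_def by blast
  interpret Metric_space M d by (rule Md(1))
  have "\<exists>\<gamma>. continuous_map (top_of_set {0..1::real}) mtopology \<gamma> \<and> \<gamma> ` {0..1} = M"
    using assms Md(2) by (intro peano_curve_exists) (auto simp: Peano_continuum_def continuum_space_def)
  then show ?thesis using Md(2) by simp
qed

section \<open>Hereditary indecomposability and approximate lifting\<close>

lemma compact_subset_of_directed_open:
  assumes A: "compact A" "A \<subseteq> K" and Q0: "Q {}"
    and QU: "\<And>U V. Q U \<Longrightarrow> Q V \<Longrightarrow> Q (U \<union> V)"
    and op: "\<And>U. Q U \<Longrightarrow> openin (top_of_set K) U"
    and cover: "\<And>a. a \<in> A \<Longrightarrow> \<exists>U. Q U \<and> a \<in> U"
  shows "\<exists>U. Q U \<and> A \<subseteq> U"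
proof -
  have "compactin (top_of_set K) A"
    using A by (simp add: compactin_subtopology)
  moreover have "\<forall>U\<in>Collect Q. openin (top_of_set K) U" "A \<subseteq> \<Union>(Collect Q)"
    using op cover by blast+
  ultimately obtain F where F: "finite F" "F \<subseteq> Collect Q" "A \<subseteq> \<Union>F"
    unfolding compactin_def by metis
  have "Q (\<Union>F)"
    using F(1,2) by (induction F rule: finite_induct) (auto simp: Q0 intro: QU)
  with F show ?thesis by blast
qed

text \<open>The cut-wire theorem. In a compact Hausdorff space components and quasi-components
  coincide, so any point of \<open>A\<close> and any point of \<open>D\<close> are split by a clopen
  set; compactness of \<open>D\<close> and then of \<open>A\<close> yields one clopen set for all
  pairs.\<close>

lemma clopen_separation:
  fixes K :: "'b::metric_space set"
  assumes K: "compact K" and A: "compact A" "A \<subseteq> K" and D: "compact D" "D \<subseteq> K"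
    and sep: "\<And>C. connected C \<Longrightarrow> compact C \<Longrightarrow> C \<subseteq> K \<Longrightarrow> C \<inter> A = {} \<or> C \<inter> D = {}"
  obtains U V where "closed U" "closed V" "U \<union> V = K" "U \<inter> V = {}" "A \<subseteq> U" "D \<subseteq> V"
proof -
  let ?T = "top_of_set K"
  have haus: "compact_space ?T" "Hausdorff_space ?T"
    using K by (simp_all add: compact_space_subtopology Hausdorff_space_subtopology)
  have pair: "\<exists>U. openin ?T U \<and> closedin ?T U \<and> d \<in> U \<and> a \<notin> U" if "a \<in> A" "d \<in> D" for a d
  proof (rule ccontr)
    assume neg: "\<not> ?thesis"
    have "quasi_component_of ?T d a"
      unfolding quasi_component_of_def
    proof (intro conjI allI impI)
      fix T assume T: "closedin ?T T \<and> openin ?T T"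
      then have "openin ?T (K - T)" "closedin ?T (K - T)"
        by (metis closedin_diff openin_diff closedin_topspace openin_topspace topspace_euclidean_subtopology)+
      then show "(d \<in> T) = (a \<in> T)" using neg T that D A by blast
    qed (use that A D in auto)
    then have c: "connected_component_of ?T d a"
      using haus quasi_eq_connected_component_of by metis
    let ?C = "connected_component_of_set ?T d"
    have "closedin ?T ?C" by (rule closedin_connected_component_of)
    then have "compact ?C" using K closedin_compact by blast
    moreover have "connected ?C"
      using connectedin_connected_component_of[of ?T d] by (simp add: connectedin_subtopology)
    moreover have "?C \<subseteq> K"
      using connected_component_of_subset_topspace[of ?T d] by simp
    moreover have "d \<in> ?C" using that D by (simp add: connected_component_of_refl subset_iff)
    ultimately show False using sep c that by blast
  qed
  have fixa: "\<exists>U. openin ?T U \<and> closedin ?T U \<and> a \<in> U \<and> U \<inter> D = {}" if a: "a \<in> A" for a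
  proof -
    have "\<exists>U. (openin ?T U \<and> closedin ?T U \<and> a \<notin> U) \<and> D \<subseteq> U"
      by (rule compact_subset_of_directed_open[where K=K]) (use D pair[OF a] in auto)
    then obtain U where "openin ?T U" "closedin ?T U" "a \<notin> U" "D \<subseteq> U" by blast
    then show ?thesis
      using a A by (intro exI[of _ "K - U"]) (auto intro: openin_diff closedin_diff)
  qed
  have "\<exists>U. (openin ?T U \<and> closedin ?T U \<and> U \<inter> D = {}) \<and> A \<subseteq> U"
    by (rule compact_subset_of_directed_open[where K=K]) (use A fixa in \<open>auto simp: conj_ac\<close>)
  then obtain U where U: "openin ?T U" "closedin ?T U" "U \<inter> D = {}" "A \<subseteq> U" by blast
  have "closedin ?T (K - U)" using U by (auto intro: closedin_diff)
  then have "compact U" "compact (K - U)" using U K closedin_compact by blast+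
  moreover have "U \<subseteq> K" using U closedin_subset by fastforce
  ultimately show thesis
    using that[of U "K - U"] U D by (auto intro: compact_imp_closed)
qed

text \<open>A point of \<open>K\<close> that no subcontinuum joins to \<open>B\<close> is cut off
  from \<open>B\<close> by a clopen set, and no point of that set can be joined to \<open>B\<close>
  either. Hence the complement of the hull is open.\<close>

lemma compact_connected_hull:
  fixes K :: "'b::metric_space set"
  assumes K: "compact K" and B: "compact B" "B \<subseteq> K"
  shows "compact {x\<in>K. \<exists>C. connected C \<and> compact C \<and> C \<subseteq> K \<and> x \<in> C \<and> C \<inter> B \<noteq> {}}" (is "compact ?D")
proof -
  have "openin (top_of_set K) (K - ?D)"
  proof (subst openin_subopen, intro ballI)
    fix x assume x: "x \<in> K - ?D"
    then have s: "C \<inter> {x} = {} \<or> C \<inter> B = {}" if "connected C" "compact C" "C \<subseteq> K" for C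
      using that by blast
    obtain U V where UV: "closed U" "closed V" "U \<union> V = K" "U \<inter> V = {}" "{x} \<subseteq> U" "B \<subseteq> V"
      by (rule clopen_separation[OF K, of "{x}" B]) (use x B s in auto)
    have "U = K - V" using UV by auto
    then have "openin (top_of_set K) U"
      using UV(2) by (auto simp: openin_open intro!: exI[of _ "- V"])
    moreover have "U \<subseteq> K - ?D"
    proof (rule, rule ccontr)
      fix y assume y: "y \<in> U" "y \<notin> K - ?D"
      then obtain C where C: "connected C" "C \<subseteq> K" "y \<in> C" "C \<inter> B \<noteq> {}"
        using UV(3) by blast
      moreover have "C \<subseteq> U \<union> V" "U \<inter> V \<inter> C = {}" "U \<inter> C \<noteq> {}" "V \<inter> C \<noteq> {}"
        using C UV y by auto
      ultimately show False
        using connected_closedD[OF C(1), of U V] UV(1,2) by simp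
    qed
    ultimately show "\<exists>T. openin (top_of_set K) T \<and> x \<in> T \<and> T \<subseteq> K - ?D"
      using UV(5) by blast
  qed
  then have "closedin (top_of_set K) ?D"
    by (auto simp: closedin_def)
  then show ?thesis using K closedin_compact by blast
qed

definition hered_indec :: "'b::metric_space set \<Rightarrow> bool" where
  "hered_indec S \<longleftrightarrow>
     (\<forall>A B. A \<subseteq> S \<and> compact A \<and> connected A \<and> B \<subseteq> S \<and> compact B \<and> connected B \<longrightarrow>
            A \<inter> B = {} \<or> A \<subseteq> B \<or> B \<subseteq> A)"

text \<open>One direction of the Krasinkiewicz--Minc characterisation of hereditary indecomposability:
  the union of the components of \<open>{\<pi> \<le> b'}\<close> meeting \<open>{\<pi> \<le> a}\<close> is disjoint from the union of the
  components of \<open>{\<pi> \<ge> a'}\<close> meeting \<open>{\<pi> \<ge> b}\<close>.\<close>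

lemma hered_indec_fold_decomposition:
  fixes X :: "'b::metric_space set" and \<pi> :: "'b \<Rightarrow> real"
  assumes X: "compact X" "hered_indec X" and \<pi>: "continuous_on X \<pi>"
    and ab: "a < a'" "a' < b'" "b' < b"
  obtains X0 X1 X2 where "closed X0" "closed X1" "closed X2" "X = X0 \<union> X1 \<union> X2" "X0 \<inter> X2 = {}"
    "{x\<in>X. \<pi> x \<le> a} \<subseteq> X0" "X0 \<subseteq> {x. \<pi> x \<le> b'}" "{x\<in>X. b \<le> \<pi> x} \<subseteq> X2" "X2 \<subseteq> {x. a' \<le> \<pi> x}"
    "X1 \<subseteq> {x. a \<le> \<pi> x \<and> \<pi> x \<le> b}" "X0 \<inter> X1 \<subseteq> {x. \<pi> x = b'}" "X1 \<inter> X2 \<subseteq> {x. \<pi> x = a'}"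
proof -
  have cl: "closed {x\<in>X. \<pi> x \<le> c}" "closed {x\<in>X. c \<le> \<pi> x}" for c
  proof -
    have "closed (X \<inter> \<pi> -` {..c})" "closed (X \<inter> \<pi> -` {c..})"
      by (intro continuous_closed_preimage[OF \<pi> compact_imp_closed[OF X(1)]] closed_atMost closed_atLeast)+
    moreover have "X \<inter> \<pi> -` {..c} = {x\<in>X. \<pi> x \<le> c}" "X \<inter> \<pi> -` {c..} = {x\<in>X. c \<le> \<pi> x}" by auto
    ultimately show "closed {x\<in>X. \<pi> x \<le> c}" "closed {x\<in>X. c \<le> \<pi> x}"
      by simp_all
  qed
  have cpt: "compact S" if "closed S" "S \<subseteq> X" for S
    using X(1) that compact_Int_closed[of X S] by (simp add: inf.absorb2)
  define A where "A = {x\<in>X. \<pi> x \<le> a}"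
  define B where "B = {x\<in>X. b \<le> \<pi> x}"
  define K where "K = {x\<in>X. \<pi> x \<le> b'}"
  define L where "L = {x\<in>X. a' \<le> \<pi> x}"
  have cmp: "compact A" "compact B" "compact K" "compact L"
    unfolding A_def B_def K_def L_def by (auto intro!: cpt cl)
  have HI: "A1 \<inter> B1 = {} \<or> A1 \<subseteq> B1 \<or> B1 \<subseteq> A1"
    if "A1 \<subseteq> X" "compact A1" "connected A1" "B1 \<subseteq> X" "compact B1" "connected B1" for A1 B1
    using X(2) that unfolding hered_indec_def by blast
  \<comment> \<open>The only use of hereditary indecomposability. \<open>C\<close> has a point with
    \<open>\<pi> \<le> a < a'\<close> and so is not contained in \<open>L\<close>; \<open>D\<close>
    has a point with \<open>b' < b \<le> \<pi>\<close> and so is not contained in \<open>K\<close>.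
    Neither can contain the other.\<close>
  have key: "C \<inter> D = {}" if C: "connected C" "compact C" "C \<subseteq> K" "C \<inter> A \<noteq> {}"
    and D: "connected D" "compact D" "D \<subseteq> L" "D \<inter> B \<noteq> {}" for C D
  proof -
    have "C \<subseteq> X" "D \<subseteq> X" using C D unfolding K_def L_def by auto
    then have "C \<inter> D = {} \<or> C \<subseteq> D \<or> D \<subseteq> C" using HI C D by blast
    moreover have "\<not> C \<subseteq> D" using C D ab unfolding A_def L_def by fastforce
    moreover have "\<not> D \<subseteq> C" using C D ab unfolding B_def K_def by fastforce
    ultimately show ?thesis by blast
  qed
  \<comment> \<open>The hull collects all continua in \<open>L\<close> that meet \<open>B\<close>,
    so that a single clopen subset of \<open>K\<close> around \<open>A\<close> can avoid all of
    them.\<close>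
  define D where "D = {x\<in>L. \<exists>C. connected C \<and> compact C \<and> C \<subseteq> L \<and> x \<in> C \<and> C \<inter> B \<noteq> {}}"
  have D: "compact D" "D \<subseteq> L"
  proof -
    have "B \<subseteq> L" using ab by (auto simp: B_def L_def)
    then show "compact D" unfolding D_def using compact_connected_hull cmp by blast
  qed (auto simp: D_def)
  have BD: "B \<subseteq> D"
  proof
    fix x assume x: "x \<in> B"
    then have "connected {x} \<and> compact {x} \<and> {x} \<subseteq> L \<and> x \<in> {x} \<and> {x} \<inter> B \<noteq> {}"
      using ab by (auto simp: B_def L_def)
    then show "x \<in> D" unfolding D_def by blast
  qed
  have s1: "C \<inter> A = {} \<or> C \<inter> (D \<inter> K) = {}" if C: "connected C" "compact C" "C \<subseteq> K" for C
  proof (rule ccontr)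
    assume n: "\<not> ?thesis"
    then obtain x where x: "x \<in> C" "x \<in> D" by blast
    then obtain Z where "connected Z" "compact Z" "Z \<subseteq> L" "x \<in> Z" "Z \<inter> B \<noteq> {}"
      unfolding D_def by blast
    then have "C \<inter> Z = {}" using key[OF C] n by blast
    with x \<open>x \<in> Z\<close> show False by blast
  qed
  have sub: "A \<subseteq> K" "B \<subseteq> L" "D \<inter> K \<subseteq> K" "X0 \<inter> L \<subseteq> L" for X0
    using ab by (auto simp: A_def B_def K_def L_def)
  have DK: "compact (D \<inter> K)" using D cmp by (simp add: compact_Int)
  obtain X0 K' where X0: "closed X0" "closed K'" "X0 \<union> K' = K" "X0 \<inter> K' = {}" "A \<subseteq> X0" "D \<inter> K \<subseteq> K'"
    by (rule clopen_separation[OF cmp(3) cmp(1) sub(1) DK sub(3) s1])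
  \<comment> \<open>A continuum in \<open>L\<close> that meets \<open>B\<close> lies in the hull
    \<open>D\<close>, which is disjoint from \<open>X0\<close>; so a second separation is possible,
    now inside \<open>L\<close>.\<close>
  have s2: "C \<inter> B = {} \<or> C \<inter> (X0 \<inter> L) = {}" if "connected C" "compact C" "C \<subseteq> L" for C
  proof (rule ccontr)
    assume n: "\<not> ?thesis"
    then have "C \<subseteq> D" using that unfolding D_def by blast
    with n X0 show False by blast
  qed
  have X0L: "compact (X0 \<inter> L)" using X0(1) cmp by (simp add: closed_Int_compact)
  obtain X2 L' where X2: "closed X2" "closed L'" "X2 \<union> L' = L" "X2 \<inter> L' = {}" "B \<subseteq> X2" "X0 \<inter> L \<subseteq> L'"
    by (rule clopen_separation[OF cmp(4) cmp(2) sub(2) X0L sub(4) s2])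
  have KL: "x \<in> K \<longleftrightarrow> x \<in> X \<and> \<pi> x \<le> b'" "x \<in> L \<longleftrightarrow> x \<in> X \<and> a' \<le> \<pi> x"
      "x \<in> A \<longleftrightarrow> x \<in> X \<and> \<pi> x \<le> a" "x \<in> B \<longleftrightarrow> x \<in> X \<and> b \<le> \<pi> x" for x
    by (simp_all add: A_def B_def K_def L_def)
  have mem: "x \<in> X0 \<or> x \<in> K' \<longleftrightarrow> x \<in> X \<and> \<pi> x \<le> b'" "\<not> (x \<in> X0 \<and> x \<in> K')"
    "x \<in> X2 \<or> x \<in> L' \<longleftrightarrow> x \<in> X \<and> a' \<le> \<pi> x" "\<not> (x \<in> X2 \<and> x \<in> L')"
    "x \<in> X0 \<Longrightarrow> a' \<le> \<pi> x \<Longrightarrow> x \<in> L'"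
    "x \<in> X \<Longrightarrow> \<pi> x \<le> a \<Longrightarrow> x \<in> X0" "x \<in> X \<Longrightarrow> b \<le> \<pi> x \<Longrightarrow> x \<in> X2" for x
  proof -
    show m1: "x \<in> X0 \<or> x \<in> K' \<longleftrightarrow> x \<in> X \<and> \<pi> x \<le> b'" unfolding KL(1)[symmetric] X0(3)[symmetric] by simp
    show m2: "\<not> (x \<in> X0 \<and> x \<in> K')" using X0(4) by (metis IntI empty_iff)
    show m3: "x \<in> X2 \<or> x \<in> L' \<longleftrightarrow> x \<in> X \<and> a' \<le> \<pi> x" unfolding KL(2)[symmetric] X2(3)[symmetric] by simp
    show m4: "\<not> (x \<in> X2 \<and> x \<in> L')" using X2(4) by (metis IntI empty_iff)
    show "x \<in> X0 \<Longrightarrow> a' \<le> \<pi> x \<Longrightarrow> x \<in> L'" using m1 KL(2) X2(6) by (metis IntI subsetD)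
    show "x \<in> X \<Longrightarrow> \<pi> x \<le> a \<Longrightarrow> x \<in> X0" using KL(3) X0(5) by (metis subsetD)
    show "x \<in> X \<Longrightarrow> b \<le> \<pi> x \<Longrightarrow> x \<in> X2" using KL(4) X2(5) by (metis subsetD)
  qed
  \<comment> \<open>The points outside \<open>X0\<close> need not form a closed set. The condition
    \<open>b' \<le> \<pi> x \<or> x \<in> K'\<close> is closed and differs from
    \<open>x \<notin> X0\<close> only where \<open>\<pi> x = b'\<close>; the second condition treats
    \<open>X2\<close> in the same way at \<open>a'\<close>.\<close>
  define X1 where "X1 = {x\<in>X. (b' \<le> \<pi> x \<or> x \<in> K') \<and> (\<pi> x \<le> a' \<or> x \<in> L')}"
  have X1: "x \<in> X1 \<longleftrightarrow> x \<in> X \<and> (b' \<le> \<pi> x \<or> x \<in> K') \<and> (\<pi> x \<le> a' \<or> x \<in> L')" for x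
    by (simp add: X1_def)
  have "X1 = ({x\<in>X. b' \<le> \<pi> x} \<union> K') \<inter> ({x\<in>X. \<pi> x \<le> a'} \<union> L')"
    by (rule set_eqI) (use mem X1 in \<open>simp; metis\<close>)
  then have c1: "closed X1" using cl(1,2) X0(2) X2(2) by (metis closed_Int closed_Un)
  have "x \<in> X \<longleftrightarrow> x \<in> X0 \<or> x \<in> X1 \<or> x \<in> X2" for x
    using mem[of x] X1[of x] ab by argo
  then have c2: "X = X0 \<union> X1 \<union> X2" by blast
  have c3: "X0 \<inter> X2 = {}" using mem by blast
  have "a \<le> \<pi> x \<and> \<pi> x \<le> b" if "x \<in> X1" for x
    using mem[of x] X1[of x] ab that by argo
  then have c4: "X1 \<subseteq> {x. a \<le> \<pi> x \<and> \<pi> x \<le> b}" by blast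
  have "\<pi> x = b'" if "x \<in> X0" "x \<in> X1" for x
    using mem[of x] X1[of x] ab that by argo
  then have c5: "X0 \<inter> X1 \<subseteq> {x. \<pi> x = b'}" by blast
  have "\<pi> x = a'" if "x \<in> X1" "x \<in> X2" for x
    using mem[of x] X1[of x] ab that by argo
  then have c6: "X1 \<inter> X2 \<subseteq> {x. \<pi> x = a'}" by blast
  have c7: "{x\<in>X. \<pi> x \<le> a} \<subseteq> X0" "X0 \<subseteq> {x. \<pi> x \<le> b'}" "{x\<in>X. b \<le> \<pi> x} \<subseteq> X2" "X2 \<subseteq> {x. a' \<le> \<pi> x}"
    using mem(1,3,6,7) by (simp_all add: subset_iff) metis+
  show thesis
    by (rule that[OF X0(1) c1 X2(1) c2 c3 c7 c4 c5 c6])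
qed

section \<open>Approximate lifting of maps onto intervals\<close>

text \<open>The target is spanned by the values of \<open>\<rho>\<close> at the endpoints: in all
  uses \<open>\<rho>\<close> has its minimum at \<open>a\<close> and its maximum at
  \<open>b\<close>. Requiring \<open>h\<close> to be onto is what makes lifts composable.\<close>

definition lifts :: "'b::metric_space set \<Rightarrow> (real \<Rightarrow> real) \<Rightarrow> real \<Rightarrow> real \<Rightarrow> bool" where
  "lifts X \<rho> a b \<longleftrightarrow>
     (\<forall>\<pi> \<epsilon>. continuous_on X \<pi> \<and> \<pi> ` X = {\<rho> a..\<rho> b} \<and> 0 < \<epsilon> \<longrightarrow>
        (\<exists>h. continuous_on X h \<and> h ` X = {a..b} \<and> (\<forall>x\<in>X. \<bar>\<rho> (h x) - \<pi> x\<bar> \<le> \<epsilon>)))"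

lemma real_image_onto_interval:
  fixes h :: "'b::metric_space \<Rightarrow> real"
  assumes "connected X" "continuous_on X h" "h ` X \<subseteq> {a..b}" "a \<in> h ` X" "b \<in> h ` X"
  shows "h ` X = {a..b}"
proof -
  have "connected (h ` X)" using assms connected_continuous_image by blast
  then have "{a..b} \<subseteq> h ` X" using assms(4,5) connected_contains_Icc by metis
  with assms(3) show ?thesis by blast
qed

text \<open>The domain is a \<open>closed_segment\<close> because the middle branch of a fold is
  decreasing.\<close>

lemma continuous_inverse_branch:
  fixes \<rho> :: "real \<Rightarrow> real"
  assumes pq: "p \<le> q" and \<rho>: "continuous_on {p..q} \<rho>" "inj_on \<rho> {p..q}"
  obtains \<psi> where "continuous_on (closed_segment (\<rho> p) (\<rho> q)) \<psi>"
    "\<And>y. y \<in> closed_segment (\<rho> p) (\<rho> q) \<Longrightarrow> \<psi> y \<in> {p..q} \<and> \<rho> (\<psi> y) = y"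
    "\<psi> (\<rho> p) = p" "\<psi> (\<rho> q) = q"
proof -
  let ?\<psi> = "the_inv_into {p..q} \<rho>"
  have "connected (\<rho> ` {p..q})" using \<rho>(1) by (intro connected_continuous_image) auto
  then have "convex (\<rho> ` {p..q})" using is_interval_connected_1 is_interval_convex by blast
  then have sub: "closed_segment (\<rho> p) (\<rho> q) \<subseteq> \<rho> ` {p..q}"
    using pq by (intro closed_segment_subset) auto
  have "continuous_on (\<rho> ` {p..q}) ?\<psi>"
    using \<rho> by (intro continuous_on_inv_into) auto
  then have "continuous_on (closed_segment (\<rho> p) (\<rho> q)) ?\<psi>"
    using sub continuous_on_subset by blast
  moreover have "?\<psi> y \<in> {p..q} \<and> \<rho> (?\<psi> y) = y" if "y \<in> closed_segment (\<rho> p) (\<rho> q)" for y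
    using the_inv_into_into[OF \<rho>(2), of y "{p..q}"] f_the_inv_into_f[OF \<rho>(2), of y] sub that by blast
  moreover have "?\<psi> (\<rho> p) = p" "?\<psi> (\<rho> q) = q"
    using the_inv_into_f_f[OF \<rho>(2)] pq by auto
  ultimately show thesis using that by blast
qed

lemma lifts_injective:
  assumes "connected X" and ab: "a \<le> b" "\<rho> a \<le> \<rho> b" and \<rho>: "continuous_on {a..b} \<rho>" "inj_on \<rho> {a..b}"
  shows "lifts X \<rho> a b"
  unfolding lifts_def
proof (intro allI impI, elim conjE)
  fix \<pi> and \<epsilon> :: real
  assume \<pi>: "continuous_on X \<pi>" "\<pi> ` X = {\<rho> a..\<rho> b}" "0 < \<epsilon>"
  obtain \<psi> where \<psi>: "continuous_on (closed_segment (\<rho> a) (\<rho> b)) \<psi>"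
    "\<And>y. y \<in> closed_segment (\<rho> a) (\<rho> b) \<Longrightarrow> \<psi> y \<in> {a..b} \<and> \<rho> (\<psi> y) = y"
    "\<psi> (\<rho> a) = a" "\<psi> (\<rho> b) = b"
    by (rule continuous_inverse_branch[OF ab(1) \<rho>]) blast
  have seg: "closed_segment (\<rho> a) (\<rho> b) = {\<rho> a..\<rho> b}" using ab by (simp add: closed_segment_eq_real_ivl)
  have h: "continuous_on X (\<psi> \<circ> \<pi>)" using \<psi>(1) \<pi> seg by (intro continuous_on_compose) auto
  have \<pi>x: "\<pi> x \<in> {\<rho> a..\<rho> b}" if "x \<in> X" for x using that \<pi>(2) by blast
  have im: "(\<psi> \<circ> \<pi>) ` X = {a..b}"
  proof (rule real_image_onto_interval[OF assms(1) h])
    have "\<rho> a \<in> \<pi> ` X" "\<rho> b \<in> \<pi> ` X" using \<pi> ab by auto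
    then show "a \<in> (\<psi> \<circ> \<pi>) ` X" "b \<in> (\<psi> \<circ> \<pi>) ` X"
      using \<psi>(3,4) by (force simp: image_comp[symmetric] intro!: rev_image_eqI)+
    show "(\<psi> \<circ> \<pi>) ` X \<subseteq> {a..b}" using \<psi>(2) seg \<pi>x by auto
  qed
  have "\<forall>x\<in>X. \<bar>\<rho> ((\<psi> \<circ> \<pi>) x) - \<pi> x\<bar> \<le> \<epsilon>" using \<psi>(2) \<pi>x \<pi>(3) seg by auto
  with h im show "\<exists>h. continuous_on X h \<and> h ` X = {a..b} \<and> (\<forall>x\<in>X. \<bar>\<rho> (h x) - \<pi> x\<bar> \<le> \<epsilon>)"
    by blast
qed

text \<open>The lift through the outer map comes first; its result is then lifted through the inner
  map, with an accuracy dictated by the modulus of continuity of the outer one.\<close>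

lemma lifts_compose:
  assumes l2: "lifts X \<rho>2 a b" and l1: "lifts X \<rho>1 (\<rho>2 a) (\<rho>2 b)"
    and c: "continuous_on {\<rho>2 a..\<rho>2 b} \<rho>1" and im: "\<rho>2 ` {a..b} \<subseteq> {\<rho>2 a..\<rho>2 b}"
  shows "lifts X (\<rho>1 \<circ> \<rho>2) a b"
  unfolding lifts_def
proof (intro allI impI, elim conjE)
  fix \<pi> and \<epsilon> :: real
  assume \<pi>: "continuous_on X \<pi>" "\<pi> ` X = {(\<rho>1 \<circ> \<rho>2) a..(\<rho>1 \<circ> \<rho>2) b}" "0 < \<epsilon>"
  then have "0 < \<epsilon> / 2" by simp
  with l1 \<pi> obtain h1 where h1: "continuous_on X h1" "h1 ` X = {\<rho>2 a..\<rho>2 b}"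
      "\<forall>x\<in>X. \<bar>\<rho>1 (h1 x) - \<pi> x\<bar> \<le> \<epsilon> / 2"
    unfolding lifts_def comp_def by blast
  have "uniformly_continuous_on {\<rho>2 a..\<rho>2 b} \<rho>1"
    using c by (intro compact_uniformly_continuous) auto
  then obtain \<delta> where \<delta>: "0 < \<delta>"
      "\<And>s t. s \<in> {\<rho>2 a..\<rho>2 b} \<Longrightarrow> t \<in> {\<rho>2 a..\<rho>2 b} \<Longrightarrow> dist t s < \<delta> \<Longrightarrow> dist (\<rho>1 t) (\<rho>1 s) < \<epsilon> / 2"
    unfolding uniformly_continuous_on_def using \<open>0 < \<epsilon> / 2\<close> by metis
  obtain h where h: "continuous_on X h" "h ` X = {a..b}" "\<forall>x\<in>X. \<bar>\<rho>2 (h x) - h1 x\<bar> \<le> \<delta> / 2"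
    using l2 h1 \<delta>(1) unfolding lifts_def by (metis half_gt_zero)
  have "\<bar>(\<rho>1 \<circ> \<rho>2) (h x) - \<pi> x\<bar> \<le> \<epsilon>" if x: "x \<in> X" for x
  proof -
    have "\<rho>2 (h x) \<in> {\<rho>2 a..\<rho>2 b}" "h1 x \<in> {\<rho>2 a..\<rho>2 b}" using im h(2) h1(2) x by blast+
    moreover have "dist (\<rho>2 (h x)) (h1 x) < \<delta>" using h(3) x \<delta>(1) by (fastforce simp: dist_real_def)
    ultimately have "dist (\<rho>1 (\<rho>2 (h x))) (\<rho>1 (h1 x)) < \<epsilon> / 2" using \<delta>(2) by blast
    moreover have "\<bar>\<rho>1 (h1 x) - \<pi> x\<bar> \<le> \<epsilon> / 2" using h1(3) x by blast
    ultimately show ?thesis unfolding dist_real_def comp_def by linarith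
  qed
  with h show "\<exists>h. continuous_on X h \<and> h ` X = {a..b} \<and> (\<forall>x\<in>X. \<bar>(\<rho>1 \<circ> \<rho>2) (h x) - \<pi> x\<bar> \<le> \<epsilon>)"
    by blast
qed

text \<open>Each piece of the decomposition is lifted by the inverse of one branch of
  \<open>\<rho>\<close>. \<open>X0\<close> and \<open>X1\<close> meet only over
  \<open>\<rho> s\<close>, where the first two inverses both give \<open>s\<close>;
  \<open>X1\<close> and \<open>X2\<close> meet only over \<open>\<rho> t\<close>, where the last two
  both give \<open>t\<close>. So the three lifts fit together continuously.\<close>

lemma lifts_fold:
  assumes X: "compact X" "connected X" "hered_indec X"
    and st: "a < s" "s < t" "t < b" and \<rho>: "continuous_on {a..b} \<rho>"
    and inj: "inj_on \<rho> {a..s}" "inj_on \<rho> {s..t}" "inj_on \<rho> {t..b}"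
    and ord: "\<rho> a < \<rho> t" "\<rho> t < \<rho> s" "\<rho> s < \<rho> b"
  shows "lifts X \<rho> a b"
  unfolding lifts_def
proof (intro allI impI, elim conjE)
  fix \<pi> and \<epsilon> :: real
  assume \<pi>: "continuous_on X \<pi>" "\<pi> ` X = {\<rho> a..\<rho> b}" "0 < \<epsilon>"
  have cs: "continuous_on {a..s} \<rho>" "continuous_on {s..t} \<rho>" "continuous_on {t..b} \<rho>"
    using \<rho> st by (auto intro: continuous_on_subset)
  have seg: "closed_segment (\<rho> a) (\<rho> s) = {\<rho> a..\<rho> s}" "closed_segment (\<rho> s) (\<rho> t) = {\<rho> t..\<rho> s}"
    "closed_segment (\<rho> t) (\<rho> b) = {\<rho> t..\<rho> b}"
    using ord by (simp_all add: closed_segment_eq_real_ivl)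
  obtain i0 where i0: "continuous_on {\<rho> a..\<rho> s} i0"
    "\<And>y. y \<in> {\<rho> a..\<rho> s} \<Longrightarrow> i0 y \<in> {a..s} \<and> \<rho> (i0 y) = y" "i0 (\<rho> a) = a" "i0 (\<rho> s) = s"
    using continuous_inverse_branch[OF less_imp_le[OF st(1)] cs(1) inj(1)] unfolding seg by metis
  obtain i1 where i1: "continuous_on {\<rho> t..\<rho> s} i1"
    "\<And>y. y \<in> {\<rho> t..\<rho> s} \<Longrightarrow> i1 y \<in> {s..t} \<and> \<rho> (i1 y) = y" "i1 (\<rho> s) = s" "i1 (\<rho> t) = t"
    using continuous_inverse_branch[OF less_imp_le[OF st(2)] cs(2) inj(2)] unfolding seg by metis
  obtain i2 where i2: "continuous_on {\<rho> t..\<rho> b} i2"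
    "\<And>y. y \<in> {\<rho> t..\<rho> b} \<Longrightarrow> i2 y \<in> {t..b} \<and> \<rho> (i2 y) = y" "i2 (\<rho> t) = t" "i2 (\<rho> b) = b"
    using continuous_inverse_branch[OF less_imp_le[OF st(3)] cs(3) inj(3)] unfolding seg by metis
  \<comment> \<open>The decomposition needs strict gaps below \<open>\<rho> t\<close> and above
    \<open>\<rho> s\<close>. They are at most \<open>\<epsilon>\<close> wide and stay within the
    range of \<open>\<pi>\<close>, so that points over \<open>\<rho> a\<close> lie in
    \<open>X0\<close> and points over \<open>\<rho> b\<close> in \<open>X2\<close>.\<close>
  define \<alpha> where "\<alpha> = max (\<rho> a) (\<rho> t - \<epsilon>)"
  define \<beta> where "\<beta> = min (\<rho> b) (\<rho> s + \<epsilon>)"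
  have \<alpha>\<beta>: "\<alpha> < \<rho> t" "\<rho> s < \<beta>" using ord \<pi>(3) by (auto simp: \<alpha>_def \<beta>_def)
  obtain X0 X1 X2 where cl: "closed X0" "closed X1" "closed X2" and un: "X = X0 \<union> X1 \<union> X2" and dis: "X0 \<inter> X2 = {}"
    and X0: "{x\<in>X. \<pi> x \<le> \<alpha>} \<subseteq> X0" "X0 \<subseteq> {x. \<pi> x \<le> \<rho> s}"
    and X2: "{x\<in>X. \<beta> \<le> \<pi> x} \<subseteq> X2" "X2 \<subseteq> {x. \<rho> t \<le> \<pi> x}"
    and X1: "X1 \<subseteq> {x. \<alpha> \<le> \<pi> x \<and> \<pi> x \<le> \<beta>}"
    and X01: "X0 \<inter> X1 \<subseteq> {x. \<pi> x = \<rho> s}" and X12: "X1 \<inter> X2 \<subseteq> {x. \<pi> x = \<rho> t}"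
    by (rule hered_indec_fold_decomposition[OF X(1,3) \<pi>(1) \<alpha>\<beta>(1) ord(2) \<alpha>\<beta>(2)]) 
  \<comment> \<open>On \<open>X1\<close> the values of \<open>\<pi>\<close> may leave the range of
    the middle branch by up to \<open>\<epsilon>\<close>. Clamping them is the only source of error
    in the lift.\<close>
  define cmp where "cmp y = max (\<rho> t) (min (\<rho> s) y)" for y
  define h where "h x = (if x \<in> X0 then i0 (\<pi> x) else if x \<in> X2 then i2 (\<pi> x) else i1 (cmp (\<pi> x)))" for x
  have bd: "\<rho> a \<le> \<pi> x" "\<pi> x \<le> \<rho> b" if "x \<in> X" for x using \<pi>(2) that by auto
  have c0: "continuous_on X0 (\<lambda>x. i0 (\<pi> x))"
    by (rule continuous_on_compose2[OF i0(1)])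
       (use X0 un bd in \<open>auto intro: continuous_on_subset[OF \<pi>(1)]\<close>)
  have c2: "continuous_on X2 (\<lambda>x. i2 (\<pi> x))"
    by (rule continuous_on_compose2[OF i2(1)])
       (use X2 un bd in \<open>auto intro: continuous_on_subset[OF \<pi>(1)]\<close>)
  have cmp: "cmp y \<in> {\<rho> t..\<rho> s}" for y unfolding cmp_def using ord by auto
  have "continuous_on X1 (\<lambda>x. cmp (\<pi> x))" unfolding cmp_def
    by (intro continuous_intros continuous_on_subset[OF \<pi>(1)]) (use un in auto)
  then have c1: "continuous_on X1 (\<lambda>x. i1 (cmp (\<pi> x)))"
    by (rule continuous_on_compose2[OF i1(1)]) (use cmp in auto)
  have c21: "continuous_on (X2 \<union> X1) (\<lambda>x. if x \<in> X2 then i2 (\<pi> x) else i1 (cmp (\<pi> x)))"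
  proof (rule continuous_on_cases_local[OF _ _ c2 c1])
    fix x assume "x \<in> X2 \<and> x \<notin> X2 \<or> x \<in> X1 \<and> x \<in> X2"
    then have "\<pi> x = \<rho> t" using X12 by auto
    then show "i2 (\<pi> x) = i1 (cmp (\<pi> x))" using i2(3) i1(4) ord by (simp add: cmp_def)
  qed (use cl in \<open>auto intro: closed_subset\<close>)
  have "continuous_on (X0 \<union> (X2 \<union> X1)) h" unfolding h_def
  proof (rule continuous_on_cases_local[OF _ _ c0 c21])
    fix x assume "x \<in> X0 \<and> x \<notin> X0 \<or> x \<in> X2 \<union> X1 \<and> x \<in> X0"
    then have "x \<notin> X2" "\<pi> x = \<rho> s" using X01 dis by auto
    then show "i0 (\<pi> x) = (if x \<in> X2 then i2 (\<pi> x) else i1 (cmp (\<pi> x)))" 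
      using i0(4) i1(3) ord by (simp add: cmp_def)
  qed (use cl in \<open>auto intro: closed_subset\<close>)
  moreover have "X0 \<union> (X2 \<union> X1) = X" using un by auto
  ultimately have h: "continuous_on X h" by simp
  have mem: "h x \<in> {a..b} \<and> \<bar>\<rho> (h x) - \<pi> x\<bar> \<le> \<epsilon>" if x: "x \<in> X" for x
  proof -
    consider "x \<in> X0" | "x \<notin> X0" "x \<in> X2" | "x \<notin> X0" "x \<notin> X2" "x \<in> X1" using x un by blast
    then show ?thesis
    proof cases
      case 1
      then have "i0 (\<pi> x) \<in> {a..s} \<and> \<rho> (i0 (\<pi> x)) = \<pi> x" using i0(2) bd(1)[OF x] X0 by auto
      with 1 show ?thesis using st \<pi>(3) by (auto simp: h_def)
    next
      case 2
      then have "i2 (\<pi> x) \<in> {t..b} \<and> \<rho> (i2 (\<pi> x)) = \<pi> x" using i2(2) bd(2)[OF x] X2 by auto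
      with 2 show ?thesis using st \<pi>(3) by (auto simp: h_def)
    next
      case 3
      then have "i1 (cmp (\<pi> x)) \<in> {s..t} \<and> \<rho> (i1 (cmp (\<pi> x))) = cmp (\<pi> x)" using i1(2) cmp by auto
      moreover have "\<rho> t - \<epsilon> \<le> \<pi> x" "\<pi> x \<le> \<rho> s + \<epsilon>" using 3 X1 by (auto simp: \<alpha>_def \<beta>_def)
      then have "\<bar>cmp (\<pi> x) - \<pi> x\<bar> \<le> \<epsilon>" using \<pi>(3) ord by (auto simp: cmp_def)
      ultimately show ?thesis using 3 st by (auto simp: h_def)
    qed
  qed
  have "h ` X = {a..b}"
  proof (rule real_image_onto_interval[OF X(2) h])
    show "h ` X \<subseteq> {a..b}" using mem by blast
    have "\<rho> a \<in> \<pi> ` X" "\<rho> b \<in> \<pi> ` X" using \<pi>(2) ord by auto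
    then obtain x y where xy: "x \<in> X" "\<pi> x = \<rho> a" "y \<in> X" "\<pi> y = \<rho> b" by (metis imageE)
    have "x \<in> X0" using xy X0(1) by (auto simp: \<alpha>_def)
    then have "h x = a" using xy i0(3) by (simp add: h_def)
    moreover have "y \<in> X2" using xy X2(1) by (auto simp: \<beta>_def)
    then have "h y = b" using xy i2(4) dis by (auto simp: h_def)
    ultimately show "a \<in> h ` X" "b \<in> h ` X" using xy by (metis imageI)+
  qed
  with h mem show "\<exists>h. continuous_on X h \<and> h ` X = {a..b} \<and> (\<forall>x\<in>X. \<bar>\<rho> (h x) - \<pi> x\<bar> \<le> \<epsilon>)"
    by blast
qed

section \<open>Piecewise linear functions with vertices at the integers\<close>

definition lin :: "(nat \<Rightarrow> real) \<Rightarrow> real \<Rightarrow> real" where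
  "lin v t = v (nat \<lfloor>t\<rfloor>) + frac t * (v (Suc (nat \<lfloor>t\<rfloor>)) - v (nat \<lfloor>t\<rfloor>))"

lemma lin_nat [simp]: "lin v (real i) = v i"
  by (simp add: lin_def)

lemma lin_segment:
  assumes "real i \<le> t" "t \<le> real (Suc i)"
  shows "lin v t = v i + (t - i) * (v (Suc i) - v i)"
proof (cases "t = real (Suc i)")
  case True
  then show ?thesis using lin_nat[of v "Suc i"] by simp
next
  case False
  then have "\<lfloor>t\<rfloor> = int i" using assms by (simp add: floor_eq_iff)
  then show ?thesis by (simp add: lin_def frac_def)
qed

lemma obtain_segment:
  assumes "0 \<le> t" "t \<le> real k" "0 < k"
  obtains i where "i < k" "real i \<le> t" "t \<le> real (Suc i)"
proof (cases "t = k")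
  case True
  then show thesis using that[of "k - 1"] assms by auto
next
  case False
  then have "nat \<lfloor>t\<rfloor> < k" using assms by linarith
  moreover have "real (nat \<lfloor>t\<rfloor>) \<le> t" "t \<le> real (Suc (nat \<lfloor>t\<rfloor>))" using assms by linarith+
  ultimately show thesis using that by blast
qed

lemma continuous_on_lin: "continuous_on {0..real k} (lin v)"
proof (induction k)
  case (Suc k)
  have "continuous_on {real k..real (Suc k)} (\<lambda>t. v k + (t - k) * (v (Suc k) - v k))"
    by (intro continuous_intros)
  then have "continuous_on {real k..real (Suc k)} (lin v)"
    by (rule continuous_on_eq) (simp add: lin_segment[of k])
  then have "continuous_on ({0..real k} \<union> {real k..real (Suc k)}) (lin v)"
    by (intro continuous_on_closed_Un Suc.IH) auto
  moreover have "{0..real k} \<union> {real k..real (Suc k)} = {0..real (Suc k)}" by auto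
  ultimately show ?case by simp
qed simp

lemma convex_combination_bounds:
  fixes x y u :: real
  assumes "c \<le> x" "x \<le> d" "c \<le> y" "y \<le> d" "0 \<le> u" "u \<le> 1"
  shows "c \<le> x + u * (y - x)" "x + u * (y - x) \<le> d"
proof -
  have "(1 - u) *\<^sub>R x + u *\<^sub>R y \<in> {c..d}"
    using assms by (intro convexD[of "{c..d}"]) auto
  then show "c \<le> x + u * (y - x)" "x + u * (y - x) \<le> d" by (auto simp: algebra_simps)
qed

lemma lin_bounds:
  assumes "0 \<le> t" "t \<le> real k" "0 < k" and v: "\<And>i. i \<le> k \<Longrightarrow> c \<le> v i \<and> v i \<le> d"
  shows "c \<le> lin v t \<and> lin v t \<le> d"
proof -
  obtain i where i: "i < k" "real i \<le> t" "t \<le> real (Suc i)" using obtain_segment assms by blast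
  then show ?thesis
    using convex_combination_bounds[of c "v i" d "v (Suc i)" "t - i"] v[of i] v[of "Suc i"]
    by (simp add: lin_segment)
qed

lemma lin_strict_mono:
  assumes "\<And>i. p \<le> i \<Longrightarrow> i < q \<Longrightarrow> v i < v (Suc i)"
  shows "strict_mono_on {real p..real q} (lin v)"
  using assms
proof (induction q)
  case 0
  then show ?case by (auto simp: strict_mono_on_def)
next
  case (Suc q)
  show ?case
  proof (cases "p \<le> q")
    case False
    then have "real (Suc q) \<le> real p" by simp
    then show ?thesis by (auto simp: strict_mono_on_def)
  next
    case True
    have IH: "strict_mono_on {real p..real q} (lin v)" using Suc by auto
    have seg: "lin v s < lin v t" if "real q \<le> s" "s < t" "t \<le> real (Suc q)" for s t
      using that Suc.prems[of q] True by (simp add: lin_segment[of q])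
    show ?thesis
    proof (rule strict_mono_onI)
      fix s t assume st: "s \<in> {real p..real (Suc q)}" "t \<in> {real p..real (Suc q)}" "s < t"
      consider "t \<le> real q" | "real q \<le> s" | "s < real q" "real q < t" by linarith
      then show "lin v s < lin v t"
      proof cases
        case 1
        then show ?thesis using IH st by (simp add: strict_mono_on_def)
      next
        case 2
        then show ?thesis using seg st by auto
      next
        case 3
        have "lin v s < lin v (real q)" 
          using IH st True 3 by (simp add: strict_mono_on_def del: lin_nat)
        also have "lin v (real q) < lin v t" using seg[of "real q" t] 3 st by simp
        finally show ?thesis .
      qed
    qed
  qed
qed

text \<open>By the condition on \<open>w\<close>, \<open>lin w\<close> maps each unit segment
  affinely into a unit segment, on which \<open>lin v'\<close> is affine. The composite is therefore
  affine between integers and determined by its values there.\<close>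

lemma lin_compose:
  assumes w: "\<And>i. i < k \<Longrightarrow> \<exists>m. {w i, w (Suc i)} \<subseteq> {real m..real (Suc m)}"
    and v: "\<And>i. i \<le> k \<Longrightarrow> v i = lin v' (w i)" and t: "0 \<le> t" "t \<le> real k" "0 < k"
  shows "lin v t = lin v' (lin w t)"
proof -
  obtain i where i: "i < k" "real i \<le> t" "t \<le> real (Suc i)" using obtain_segment t by blast
  obtain m where m: "{w i, w (Suc i)} \<subseteq> {real m..real (Suc m)}" using w i by blast
  have "real m \<le> lin w t" "lin w t \<le> real (Suc m)"
    using convex_combination_bounds[of m "w i" "Suc m" "w (Suc i)" "t - i"] i m
    by (simp_all add: lin_segment)
  then have "lin v' (lin w t) = v' m + (lin w t - m) * (v' (Suc m) - v' m)" by (rule lin_segment)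
  moreover have "v i = v' m + (w i - m) * (v' (Suc m) - v' m)"
    "v (Suc i) = v' m + (w (Suc i) - m) * (v' (Suc m) - v' m)"
    using v[of i] v[of "Suc i"] i m lin_segment[of m "w i" v'] lin_segment[of m "w (Suc i)" v'] by auto
  ultimately show ?thesis using i by (simp add: lin_segment) (simp add: algebra_simps)
qed

lemma lifts_cong:
  assumes "\<And>t. t \<in> {a..b} \<Longrightarrow> \<rho> t = \<rho>' t" "a \<le> b"
  shows "lifts X \<rho> a b = lifts X \<rho>' a b"
proof -
  have "(h ` X = {a..b} \<and> (\<forall>x\<in>X. \<bar>\<rho> (h x) - \<pi> x\<bar> \<le> \<epsilon>)) = (h ` X = {a..b} \<and> (\<forall>x\<in>X. \<bar>\<rho>' (h x) - \<pi> x\<bar> \<le> \<epsilon>))"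
    for h \<pi> \<epsilon> using assms(1) by (metis imageI)
  then show ?thesis using assms unfolding lifts_def by simp
qed

lemma lifts_lin_compose:
  assumes k: "0 < k" "0 < k'" and w: "\<And>i. i < k \<Longrightarrow> \<exists>m. {w i, w (Suc i)} \<subseteq> {real m..real (Suc m)}"
    and v: "\<And>i. i \<le> k \<Longrightarrow> v i = lin v' (w i)"
    and w0: "w 0 = 0" "w k = real k'" "\<And>i. i \<le> k \<Longrightarrow> 0 \<le> w i \<and> w i \<le> real k'"
    and l: "lifts X (lin w) 0 k" "lifts X (lin v') 0 k'"
  shows "lifts X (lin v) 0 k"
proof -
  have [simp]: "lin w 0 = 0" "lin w (real k) = real k'" using lin_nat[of w 0] w0 by simp_all
  have "lifts X (lin v' \<circ> lin w) 0 k"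
  proof (rule lifts_compose)
    show "lin w ` {0..real k} \<subseteq> {lin w 0..lin w (real k)}"
      using lin_bounds[OF _ _ k(1), of _ 0 w "real k'"] w0(3) by (auto simp del: lin_nat)
  qed (use l continuous_on_lin[of k' v'] w0(2) in simp_all)
  then show ?thesis
    using lifts_cong[of 0 "real k" "lin v" "lin v' \<circ> lin w" X] lin_compose[of k w v v'] w v k(1) by simp
qed

text \<open>Induction on the number of vertices. A vertex that is no turning point is removed by a monotone
  reparametrisation. If all inner vertices are turning points, the shortest edge is an inner one,
  since the walk starts at its strict minimum and ends at its strict maximum; it is the middle edge of
  a zigzag, which is removed by \<open>lifts_fold\<close>. Injectivity of \<open>v\<close> excludes ties and survives the
  removal of vertices.\<close>

lemma lifts_lin:
  assumes X: "compact X" "connected X" "hered_indec X"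
    and "0 < k" "inj_on v {..k}" "\<And>i. i \<le> k \<Longrightarrow> v 0 \<le> v i \<and> v i \<le> v k"
  shows "lifts X (lin v) 0 (real k)"
  using assms(4-)
proof (induction k arbitrary: v rule: less_induct)
  case (less k)
  have ne: "v i \<noteq> v j" if "i \<le> k" "j \<le> k" "i \<noteq> j" for i j
    using less.prems(2) that by (auto dest: inj_onD)
  have ends: "v 0 < v i" if "0 < i" "i \<le> k" for i using less.prems(3)[of i] ne[of 0 i] that by fastforce
  have ende: "v i < v k" if "i < k" for i using less.prems(3)[of i] ne[of i k] that by fastforce
  consider (mono) "\<forall>i<k. v i < v (Suc i)"
    | (pass) p where "Suc (Suc p) \<le> k" "v p < v (Suc p) \<and> v (Suc p) < v (Suc (Suc p)) \<or> v (Suc (Suc p)) < v (Suc p) \<and> v (Suc p) < v p"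
       "\<not> (\<forall>i<k. v i < v (Suc i))"
    | (alt) "\<not> (\<forall>i<k. v i < v (Suc i))" 
        "\<And>p. Suc (Suc p) \<le> k \<Longrightarrow> (v p < v (Suc p)) = (v (Suc (Suc p)) < v (Suc p))"
  proof -
    have "\<exists>p. Suc (Suc p) \<le> k \<and> (v p < v (Suc p) \<and> v (Suc p) < v (Suc (Suc p)) \<or> v (Suc (Suc p)) < v (Suc p) \<and> v (Suc p) < v p)"
      if "Suc (Suc p) \<le> k" "(v p < v (Suc p)) \<noteq> (v (Suc (Suc p)) < v (Suc p))" for p
      using that ne[of p "Suc p"] ne[of "Suc p" "Suc (Suc p)"] by (intro exI[of _ p]) auto
    then show thesis using mono pass alt by blast
  qed
  then show ?case
  proof cases
    case mono
    then have "strict_mono_on {real 0..real k} (lin v)" by (intro lin_strict_mono) auto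
    then have "inj_on (lin v) {0..real k}" by (simp add: strict_mono_on_imp_inj_on)
    moreover have "lin v 0 \<le> lin v (real k)" using less.prems(3)[of k] lin_nat[of v 0] by simp
    ultimately show ?thesis by (intro lifts_injective X continuous_on_lin) auto
  next
    case (pass p)
    define k' where "k' = k - 1"
    define D where "D = v (Suc (Suc p)) - v p"
    define u where "u = (v (Suc p) - v p) / D"
    have D: "D \<noteq> 0" using pass by (auto simp: D_def)
    have u: "0 < u" "u < 1" using pass by (auto simp: u_def D_def divide_simps)
    have uD: "u * D = v (Suc p) - v p" using D by (simp add: u_def)
    \<comment> \<open>\<open>v'\<close> omits the vertex \<open>Suc p\<close>. The increasing map
      \<open>lin w\<close> sends that vertex to the point \<open>p + u\<close> of the merged edge at
      which \<open>lin v'\<close> takes the value \<open>v (Suc p)\<close>.\<close>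
    define w where "w j = (if j \<le> p then real j else if j = Suc p then p + u else real (j - 1))" for j
    define v' where "v' j = (if j \<le> p then v j else v (Suc j))" for j
    have k: "k = Suc k'" "Suc p \<le> k'" using pass(1) by (auto simp: k'_def)
    have mono: "strict_mono_on {real 0..real k} (lin w)"
      by (rule lin_strict_mono) (use u in \<open>auto simp: w_def\<close>)
    then have "inj_on (lin w) {0..real k}" by (simp add: strict_mono_on_imp_inj_on)
    moreover have w0: "w 0 = 0" "w k = real k'" using k by (auto simp: w_def)
    moreover have "lin w 0 = 0" using w0 lin_nat[of w 0] by simp
    ultimately have l1: "lifts X (lin w) 0 k" 
      by (intro lifts_injective X continuous_on_lin) auto
    have l2: "lifts X (lin v') 0 k'"
    proof (rule less.IH)
      show "inj_on v' {..k'}"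
      proof (rule inj_onI)
        fix i j assume "i \<in> {..k'}" "j \<in> {..k'}" "v' i = v' j"
        then show "i = j" using ne[of i j] ne[of "Suc i" j] ne[of i "Suc j"] ne[of "Suc i" "Suc j"] k
          by (auto simp: v'_def split: if_splits)
      qed
    qed (use k less.prems(3) in \<open>auto simp: v'_def\<close>)
    show ?thesis
    proof (rule lifts_lin_compose[OF _ _ _ _ w0 _ l1 l2])
      fix i assume "i < k"
      have "{w i, w (Suc i)} \<subseteq> {real (if i \<le> p then i else i - 1)..real (Suc (if i \<le> p then i else i - 1))}"
        using u by (auto simp: w_def)
      then show "\<exists>m. {w i, w (Suc i)} \<subseteq> {real m..real (Suc m)}" by blast
    next
      fix i assume "i \<le> k"
      have "lin v' (real p + u) = v (Suc p)"
        using u uD by (subst lin_segment[of p]) (auto simp: v'_def D_def)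
      moreover have "v i = lin v' (w i)" if i: "i = Suc j" "p < j" for j
        using i lin_nat[of v' j] by (auto simp: w_def v'_def)
      moreover have "v i = lin v' (w i)" if "i \<le> p" using that by (simp add: w_def v'_def)
      moreover have "i \<le> p \<or> i = Suc p \<or> (\<exists>j. i = Suc j \<and> p < j)" by presburger
      ultimately show "v i = lin v' (w i)" by (auto simp: w_def)
    next
      fix i assume "i \<le> k"
      then show "0 \<le> w i \<and> w i \<le> real k'" using u k by (auto simp: w_def)
    qed (use k in auto)
  next
    case alt
    obtain i where i: "i < k" "\<And>j. j < k \<Longrightarrow> \<bar>v (Suc i) - v i\<bar> \<le> \<bar>v (Suc j) - v j\<bar>"
    proof -
      define i where "i = arg_min_on (\<lambda>j. \<bar>v (Suc j) - v j\<bar>) {..<k}"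
      have "finite {..<k}" "{..<k} \<noteq> {}" using less.prems(1) by auto
      from arg_min_if_finite[OF this, of "\<lambda>j. \<bar>v (Suc j) - v j\<bar>"] that[of i] show thesis
        unfolding i_def by force
    qed
    have "k \<noteq> 1" using alt(1) ends[of 1] by auto
    then have k2: "2 \<le> k" using less.prems(1) by auto
    \<comment> \<open>The first edge rises from the minimum, so by alternation
      \<open>v 0 < v 2 < v 1\<close>, and the second edge is shorter than the first. The same
      argument at the maximum excludes the last edge below.\<close>
    have "i \<noteq> 0"
    proof
      assume "i = 0"
      then show False
        using i(2)[of 1] ends[of 1] ends[of 2] alt(2)[of 0] k2 by (simp add: numeral_2_eq_2)
    qed
    then obtain p where p: "i = Suc p" using not0_implies_Suc by blast
    have "Suc i \<noteq> k"
    proof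
      assume "Suc i = k"
      then show False
        using i(2)[of p] alt(2)[of p] ende[of i] ende[of p] ne[of p i] p by auto
    qed
    then have pk: "Suc (Suc (Suc p)) \<le> k" using i p by simp
    define D where "D = v (Suc (Suc (Suc p))) - v p"
    define u where "u = (v (Suc p) - v p) / D"
    define u' where "u' = (v (Suc (Suc p)) - v p) / D"
    \<comment> \<open>Both neighbours of the shortest edge run in the opposite direction and are
      strictly longer, since equality would make two values of \<open>v\<close> coincide. So the
      values at its ends lie strictly between the outer two.\<close>
    have ord: "v p < v (Suc (Suc p)) \<and> v (Suc (Suc p)) < v (Suc p) \<and> v (Suc p) < v (Suc (Suc (Suc p))) \<or>
      v p > v (Suc (Suc p)) \<and> v (Suc (Suc p)) > v (Suc p) \<and> v (Suc p) > v (Suc (Suc (Suc p)))"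
      using alt(2)[of p] alt(2)[of "Suc p"] pk i(2)[of p] i(2)[of "Suc (Suc p)"] p
        ne[of p "Suc p"] ne[of "Suc p" "Suc (Suc p)"] ne[of "Suc (Suc p)" "Suc (Suc (Suc p))"]
        ne[of p "Suc (Suc p)"] ne[of "Suc p" "Suc (Suc (Suc p))"] by auto
    have D: "D \<noteq> 0" using ord by (auto simp: D_def)
    have u: "0 < u'" "u' < u" "u < 1" using ord by (auto simp: u_def u'_def D_def divide_simps)
    have uD: "u * D = v (Suc p) - v p" "u' * D = v (Suc (Suc p)) - v p" using D by (simp_all add: u_def u'_def)
    define k' where "k' = k - 2"
    have k: "k = Suc (Suc k')" "Suc p \<le> k'" using pk by (auto simp: k'_def)
    \<comment> \<open>\<open>v'\<close> replaces the zigzag by a single edge, and the fold moves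
      into \<open>w\<close>: forward to \<open>p + u\<close>, back to \<open>p + u'\<close>, forward
      to \<open>Suc p\<close>.\<close>
    define w where "w j = (if j \<le> p then real j else if j = Suc p then p + u 
       else if j = Suc (Suc p) then p + u' else real (j - 2))" for j
    define v' where "v' j = (if j \<le> p then v j else v (Suc (Suc j)))" for j
    have w0: "w 0 = 0" "w k = real k'" using k by (auto simp: w_def)
    have l1: "lifts X (lin w) 0 k" 
    proof (rule lifts_fold[OF X _ _ _ continuous_on_lin, where s="real (Suc p)" and t="real (Suc (Suc p))"])
      have "strict_mono_on {real 0..real (Suc p)} (lin w)"
        by (rule lin_strict_mono) (use u in \<open>auto simp: w_def\<close>)
      then show "inj_on (lin w) {0..real (Suc p)}" by (simp add: strict_mono_on_imp_inj_on)
      have "strict_mono_on {real (Suc (Suc p))..real k} (lin w)"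
        by (rule lin_strict_mono) (use u in \<open>auto simp: w_def\<close>)
      then show "inj_on (lin w) {real (Suc (Suc p))..real k}" by (simp add: strict_mono_on_imp_inj_on)
      show "inj_on (lin w) {real (Suc p)..real (Suc (Suc p))}"
        by (rule inj_onI) (use u in \<open>auto simp: lin_segment[of "Suc p"] w_def\<close>)
      have "lin w 0 = 0" using w0 lin_nat[of w 0] by simp
      then show "lin w 0 < lin w (real (Suc (Suc p)))" "lin w (real (Suc (Suc p))) < lin w (real (Suc p))"
        "lin w (real (Suc p)) < lin w (real k)"
        unfolding lin_nat using w0 u k by (auto simp: w_def)
    qed (use pk in auto)
    have l2: "lifts X (lin v') 0 k'"
    proof (rule less.IH)
      show "inj_on v' {..k'}"
      proof (rule inj_onI)
        fix i j assume "i \<in> {..k'}" "j \<in> {..k'}" "v' i = v' j"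
        then show "i = j" using ne[of i j] ne[of "Suc (Suc i)" j] ne[of i "Suc (Suc j)"] ne[of "Suc (Suc i)" "Suc (Suc j)"] k
          by (auto simp: v'_def split: if_splits)
      qed
    qed (use k less.prems(3) in \<open>auto simp: v'_def\<close>)
    show ?thesis
    proof (rule lifts_lin_compose[OF _ _ _ _ w0 _ l1 l2])
      fix i assume "i < k"
      define m where "m = (if i \<le> p then i else if i = Suc p \<or> i = Suc (Suc p) then p else i - 2)"
      have "{w i, w (Suc i)} \<subseteq> {real m..real (Suc m)}"
        using u by (auto simp: w_def m_def)
      then show "\<exists>m. {w i, w (Suc i)} \<subseteq> {real m..real (Suc m)}" by blast
    next
      fix i assume "i \<le> k"
      have "lin v' (real p + u) = v (Suc p)"
        using u uD by (subst lin_segment[of p]) (auto simp: v'_def D_def)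
      moreover have "lin v' (real p + u') = v (Suc (Suc p))"
        using u uD by (subst lin_segment[of p]) (auto simp: v'_def D_def)
      moreover have "v i = lin v' (w i)" if i: "i = Suc (Suc j)" "p < j" for j
        using i lin_nat[of v' j] by (auto simp: w_def v'_def)
      moreover have "v i = lin v' (w i)" if "i \<le> p" using that by (simp add: w_def v'_def)
      moreover have "i \<le> p \<or> i = Suc p \<or> i = Suc (Suc p) \<or> (\<exists>j. i = Suc (Suc j) \<and> p < j)" by presburger
      ultimately show "v i = lin v' (w i)" by (auto simp: w_def)
    next
      fix i assume "i \<le> k"
      then show "0 \<le> w i \<and> w i \<le> real k'" using u k by (auto simp: w_def)
    qed (use k in auto)
  qed
qed

text \<open>Provides the injectivity that \<open>lifts_lin\<close> asks for. Values strictly inside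
  the unit interval leave 0 and 1 free for the two end vertices.\<close>

lemma distinct_approximation:
  fixes y :: "nat \<Rightarrow> real"
  assumes y: "\<And>i. y i \<in> {0..1}" and \<epsilon>: "0 < \<epsilon>"
  shows "\<exists>v. inj_on v {..<n} \<and> (\<forall>i<n. v i \<in> {0<..<1} \<and> \<bar>v i - y i\<bar> \<le> \<epsilon>)"
proof (induction n)
  case (Suc n)
  then obtain v where v: "inj_on v {..<n}" "\<forall>i<n. v i \<in> {0<..<1} \<and> \<bar>v i - y i\<bar> \<le> \<epsilon>" by blast
  have "max 0 (y n - \<epsilon>) < min 1 (y n + \<epsilon>)" using y[of n] \<epsilon> by auto
  then have "infinite ({max 0 (y n - \<epsilon>)<..<min 1 (y n + \<epsilon>)} - v ` {..<n})"
    by (simp add: infinite_Ioo)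
  then obtain z where z: "z \<in> {max 0 (y n - \<epsilon>)<..<min 1 (y n + \<epsilon>)}" "z \<notin> v ` {..<n}"
    by (metis Diff_iff ex_in_conv finite.emptyI)
  have "inj_on (v(n := z)) {..<Suc n}"
    using v(1) z(2) by (auto simp: lessThan_Suc inj_on_def)
  moreover have "\<forall>i<Suc n. (v(n := z)) i \<in> {0<..<1} \<and> \<bar>(v(n := z)) i - y i\<bar> \<le> \<epsilon>"
    using v(2) z(1) by (auto simp: less_Suc_eq)
  ultimately show ?case by blast
qed simp

abbreviation interval_surj :: "(real \<Rightarrow> real) \<Rightarrow> bool" where
  "interval_surj g \<equiv> continuous_on {0..1} g \<and> g ` {0..1} = {0..1}"

lemma lift_interval_surj:
  assumes X: "compact X" "connected X" "hered_indec X"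
    and \<pi>: "continuous_on X \<pi>" "\<pi> ` X = {0..1}" and g: "interval_surj g" and \<epsilon>: "0 < \<epsilon>"
  shows "\<exists>h. continuous_on X h \<and> h ` X = {0..1} \<and> (\<forall>x\<in>X. \<bar>g (h x) - \<pi> x\<bar> \<le> \<epsilon>)"
proof -
  have "0 \<in> g ` {0..1}" "1 \<in> g ` {0..1}" using g by auto
  then obtain t0 t1 where t01: "t0 \<in> {0..1}" "t1 \<in> {0..1}" "g t0 = 0" "g t1 = 1" by (metis imageE)
  \<comment> \<open>\<open>c\<close> makes the composite \<open>G\<close> start at a minimum and end at a maximum, as \<open>lifts_lin\<close> requires.\<close>
  define c where "c = lin (\<lambda>i. if i = 0 then t0 else if i = 1 then 0 else if i = 2 then 1 else t1)"
  have c0: "c 0 = t0" "c 1 = 0" "c 2 = 1" "c 3 = t1"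
    using lin_nat[of _ 0] lin_nat[of _ 1] lin_nat[of _ 2] lin_nat[of _ 3] by (simp_all add: c_def)
  have cc: "continuous_on {0..3} c" using continuous_on_lin[of 3] by (simp add: c_def)
  have cb: "c t \<in> {0..1}" if "t \<in> {0..3}" for t
    using lin_bounds[of t 3 0 _ 1] that t01 by (auto simp: c_def)
  have cim: "c ` {0..3} = {0..1}"
    by (rule real_image_onto_interval)
       (use cc cb c0 in \<open>auto intro: rev_image_eqI[of 1] rev_image_eqI[of 2]\<close>)
  define G where "G = (\<lambda>t. g (c t))"
  have Gb: "G t \<in> {0..1}" if "t \<in> {0..3}" for t using cb[OF that] g by (auto simp: G_def)
  have "continuous_on {0..3} G" unfolding G_def
    by (rule continuous_on_compose2[of "{0..1}" g]) (use g cc cb in auto)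
  then have "uniformly_continuous_on {0..3} G" by (intro compact_uniformly_continuous) auto
  then obtain \<delta> where \<delta>: "0 < \<delta>"
    "\<And>s t. s \<in> {0..3} \<Longrightarrow> t \<in> {0..3} \<Longrightarrow> dist t s < \<delta> \<Longrightarrow> dist (G t) (G s) < \<epsilon> / 4"
    unfolding uniformly_continuous_on_def using \<epsilon> by (metis divide_pos_pos zero_less_numeral)
  obtain K :: nat where K: "3 / \<delta> < K" using reals_Archimedean2 by blast
  then have K0: "0 < K" using \<delta>(1) by (metis divide_pos_pos less_trans of_nat_0_less_iff zero_less_numeral)
  have K\<delta>: "3 / K < \<delta>" using K \<delta>(1) K0 by (simp add: field_simps)
  define q where "q s = 3 * s / K" for s :: real
  have qb: "q s \<in> {0..3}" if "s \<in> {0..real K}" for s using that K0 by (auto simp: q_def field_simps)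
  \<comment> \<open>The error budget is \<open>\<epsilon> / 4\<close> for perturbing the vertices,
    \<open>\<epsilon> / 4\<close> for the oscillation of \<open>G\<close> along an edge and
    \<open>\<epsilon> / 4\<close> for the lift. The value 0 beyond \<open>K\<close> keeps the whole
    sequence in the unit interval.\<close>
  define y where "y i = (if i \<le> K then G (q i) else 0)" for i
  have "y i \<in> {0..1}" for i using Gb qb[of "real i"] by (auto simp: y_def)
  then obtain v0 where v0: "inj_on v0 {..<Suc K}" "\<forall>i<Suc K. v0 i \<in> {0<..<1} \<and> \<bar>v0 i - y i\<bar> \<le> \<epsilon> / 4"
    using distinct_approximation[of y "\<epsilon> / 4"] \<epsilon> by (metis divide_pos_pos zero_less_numeral)
  define v where "v i = (if i = 0 then 0 else if i = K then 1 else v0 i)" for i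
  have injv: "inj_on v {..K}"
  proof (rule inj_onI)
    fix i j assume ij: "i \<in> {..K}" "j \<in> {..K}" "v i = v j"
    then have "v0 i \<in> {0<..<1}" "v0 j \<in> {0<..<1}" "v0 i = v0 j \<longrightarrow> i = j"
      using v0 by (auto dest: inj_onD)
    then show "i = j" using ij K0 by (auto simp: v_def split: if_splits)
  qed
  have vb: "0 \<le> v i \<and> v i \<le> 1" if "i \<le> K" for i
    using v0(2) that by (auto simp: v_def less_imp_le)
  have vG: "\<bar>v i - G (q i)\<bar> \<le> \<epsilon> / 4" if "i \<le> K" for i
  proof -
    have "G (q 0) = 0" "G (q K) = 1" using t01 c0 K0 by (simp_all add: G_def q_def)
    moreover have "\<bar>v0 i - G (q i)\<bar> \<le> \<epsilon> / 4" using v0(2) that by (auto simp: y_def)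
    ultimately show ?thesis using \<epsilon> by (auto simp: v_def)
  qed
  have near: "\<bar>lin v s - G (q s)\<bar> \<le> \<epsilon> / 2" if s: "s \<in> {0..real K}" for s
  proof -
    obtain i where i: "i < K" "real i \<le> s" "s \<le> real (Suc i)" using obtain_segment[of s K] s K0 by auto
    have "\<bar>q s - q i\<bar> \<le> 3 / K" "\<bar>q s - q (Suc i)\<bar> \<le> 3 / K"
      using i K0 by (auto simp: q_def diff_divide_distrib[symmetric] divide_right_mono)
    then have "dist (G (q i)) (G (q s)) < \<epsilon> / 4" "dist (G (q (Suc i))) (G (q s)) < \<epsilon> / 4"
      by (intro \<delta>(2) qb; use K\<delta> i s in \<open>auto simp: dist_real_def\<close>)+
    then have "\<bar>v i - G (q s)\<bar> \<le> \<epsilon> / 2" "\<bar>v (Suc i) - G (q s)\<bar> \<le> \<epsilon> / 2"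
      using vG[OF less_imp_le[OF i(1)]] vG[OF Suc_leI[OF i(1)]] unfolding dist_real_def by linarith+
    then have "G (q s) - \<epsilon> / 2 \<le> v i" "v i \<le> G (q s) + \<epsilon> / 2"
      "G (q s) - \<epsilon> / 2 \<le> v (Suc i)" "v (Suc i) \<le> G (q s) + \<epsilon> / 2" by linarith+
    from convex_combination_bounds[OF this, of "s - i"] 
    have "G (q s) - \<epsilon> / 2 \<le> lin v s" "lin v s \<le> G (q s) + \<epsilon> / 2"
      using i lin_segment[OF i(2,3), of v] by simp_all
    then show ?thesis by linarith
  qed
  have v01: "v 0 = 0" "v K = 1" "lin v 0 = 0" using K0 lin_nat[of v 0] by (auto simp: v_def)
  have "lifts X (lin v) 0 K"
    by (rule lifts_lin[OF X K0 injv]) (use vb v01 in auto)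
  then obtain h where h: "continuous_on X h" "h ` X = {0..real K}" "\<forall>x\<in>X. \<bar>lin v (h x) - \<pi> x\<bar> \<le> \<epsilon> / 4"
    unfolding lifts_def using \<pi> \<epsilon> v01 by (metis lin_nat divide_pos_pos zero_less_numeral)
  have qim: "q ` {0..real K} = {0..3}"
  proof -
    have "s \<in> q ` {0..real K}" if "s \<in> {0..3}" for s
      using that K0 by (intro rev_image_eqI[of "s * K / 3"]) (auto simp: q_def field_simps)
    then show ?thesis using qb by blast
  qed
  have hb: "h x \<in> {0..real K}" if "x \<in> X" for x using h(2) that by blast
  have "continuous_on X (\<lambda>x. c (q (h x)))"
    by (rule continuous_on_compose2[OF cc])
       (use h(1) hb qb K0 in \<open>auto simp: q_def intro!: continuous_intros\<close>)
  moreover have "(\<lambda>x. c (q (h x))) ` X = {0..1}"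
  proof -
    have "(\<lambda>x. c (q (h x))) ` X = c ` (q ` (h ` X))" by (simp add: image_image)
    then show ?thesis by (simp add: h(2) qim cim)
  qed
  moreover have "\<bar>g (c (q (h x))) - \<pi> x\<bar> \<le> \<epsilon>" if "x \<in> X" for x
  proof -
    have "\<bar>lin v (h x) - \<pi> x\<bar> \<le> \<epsilon> / 4" using h(3) that by blast
    then show ?thesis using near[OF hb[OF that]] \<epsilon> unfolding G_def by linarith
  qed
  ultimately show ?thesis by blast
qed

section \<open>Inverse sequences of intervals\<close>

text \<open>\<open>bond f i n\<close> leads from level \<open>n\<close> down to level
  \<open>i\<close>. The default \<open>id\<close> for \<open>n < i\<close> lets
  \<open>interval_surj_bond\<close> hold for all indices.\<close>

primrec bond :: "(nat \<Rightarrow> 'a \<Rightarrow> 'a) \<Rightarrow> nat \<Rightarrow> nat \<Rightarrow> 'a \<Rightarrow> 'a" where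
  "bond f i 0 = id"
| "bond f i (Suc n) = (if i \<le> n then bond f i n \<circ> f n else id)"

lemma bond_refl [simp]: "bond f i i = id"
  by (cases i) auto

lemma bond_trans: "i \<le> j \<Longrightarrow> j \<le> k \<Longrightarrow> bond f i j (bond f j k t) = bond f i k t"
  by (induction k arbitrary: t) (auto simp: le_Suc_eq)

lemma bond_Suc_left: "i < n \<Longrightarrow> f i (bond f (Suc i) n t) = bond f i n t"
  using bond_trans[of i "Suc i" n f t] by simp

lemma bond_thread: "i \<le> n \<Longrightarrow> (\<And>k. f k (x (Suc k)) = x k) \<Longrightarrow> bond f i n (x n) = x i"
  by (induction n) (auto simp: le_Suc_eq)

lemma interval_surj_compose: "interval_surj g \<Longrightarrow> interval_surj h \<Longrightarrow> interval_surj (g \<circ> h)"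
  by (metis continuous_on_compose image_comp)

lemma interval_surj_bond: "(\<And>k. interval_surj (f k)) \<Longrightarrow> interval_surj (bond f i n)"
proof (induction n)
  case (Suc n)
  then show ?case using interval_surj_compose[of "bond f i n" "f n"] by simp
qed (simp add: id_def)

text \<open>Above level \<open>n\<close> preimages are chosen one after another; below it the thread
  is forced by the bonding maps, which is the induction on \<open>n\<close>.\<close>

lemma thread_through_point:
  assumes "\<And>k. f k ` A (Suc k) = A k" "a \<in> A n"
  shows "\<exists>x. (\<forall>k. x k \<in> A k \<and> f k (x (Suc k)) = x k) \<and> x n = a"
  using assms
proof (induction n arbitrary: f A)
  case 0
  have "\<exists>x. \<forall>k. (x k \<in> A k \<and> (k = 0 \<longrightarrow> x k = a)) \<and> f k (x (Suc k)) = x k"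
  proof (rule dependent_nat_choice)
    show "\<exists>y. (y \<in> A (Suc k) \<and> (Suc k = 0 \<longrightarrow> y = a)) \<and> f k y = x" if "x \<in> A k \<and> (k = 0 \<longrightarrow> x = a)" for x k
      using 0(1)[of k] that by (metis imageE nat.distinct(1))
  qed (use 0 in auto)
  then show ?case by blast
next
  case (Suc n)
  obtain x where x: "\<forall>k. x k \<in> A (Suc k) \<and> f (Suc k) (x (Suc k)) = x k" "x n = a"
    using Suc.IH[of "\<lambda>k. f (Suc k)" "\<lambda>k. A (Suc k)"] Suc.prems by blast
  define z where "z = case_nat (f 0 (x 0)) x"
  have "z k \<in> A k \<and> f k (z (Suc k)) = z k" for k
    using x(1) Suc.prems(1)[of 0] by (cases k) (auto simp: z_def)
  moreover have "z (Suc n) = a" using x(2) by (simp add: z_def)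
  ultimately show ?case by (intro exI[of _ z]) simp
qed

definition threads :: "(nat \<Rightarrow> real \<Rightarrow> real) \<Rightarrow> (nat \<Rightarrow> real) set" where
  "threads f = {x. \<forall>n. x n \<in> {0..1} \<and> f n (x (Suc n)) = x n}"

text \<open>Turns the abstract limit into a subset of the metric space of real sequences, where the
  lifting results of the previous section apply.\<close>

lemma inverse_limit_interval: "inverse_limit (\<lambda>n. top_of_set {0..1}) f = top_of_set (threads f)"
proof -
  have "product_topology (\<lambda>n::nat. top_of_set {0..1::real}) UNIV = top_of_set (PiE UNIV (\<lambda>n. {0..1}))"
    using subtopology_product_topology[of "\<lambda>n::nat. euclidean::real topology" UNIV "\<lambda>n. {0..1}"]
    unfolding euclidean_product_topology by (rule sym)
  moreover have "PiE UNIV (\<lambda>n. {0..1}) \<inter> {x. \<forall>n. f n (x (Suc n)) = x n} = threads f"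
    by (auto simp: threads_def PiE_UNIV_domain Pi_iff)
  ultimately show ?thesis
    by (simp add: inverse_limit_def subtopology_subtopology)
qed

lemma compact_threads:
  assumes "\<And>k. interval_surj (f k)"
  shows "compact (threads f)"
proof -
  let ?C = "PiE UNIV (\<lambda>n. {0..1}) :: (nat \<Rightarrow> real) set"
  have C: "compact ?C"
    using compactin_PiE[of "\<lambda>n. euclidean" UNIV "\<lambda>n. {0..1::real}"] by (simp add: euclidean_product_topology)
  have "closed {x \<in> ?C. f n (x (Suc n)) - x n = 0}" for n
  proof (rule continuous_closed_preimage_constant)
    have "continuous_on ?C (\<lambda>x. f n (x (Suc n)))"
      by (rule continuous_on_compose2[of "{0..1}" "f n"])
         (use assms[of n] in \<open>auto intro: continuous_on_product_coordinates continuous_on_subset\<close>)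
    then show "continuous_on ?C (\<lambda>x. f n (x (Suc n)) - x n)"
      by (intro continuous_on_diff) (auto intro: continuous_on_product_coordinates continuous_on_subset)
  qed (use C compact_imp_closed in blast)
  then have "closed (\<Inter>n. {x \<in> ?C. f n (x (Suc n)) - x n = 0})" by blast
  moreover have "(\<Inter>n. {x \<in> ?C. f n (x (Suc n)) - x n = 0}) = ?C \<inter> threads f" "threads f \<subseteq> ?C"
    unfolding threads_def by (auto simp: PiE_UNIV_domain Pi_iff)
  ultimately show ?thesis using compact_Int_closed[OF C] by (metis inf.absorb2 inf_left_idem)
qed

lemma threads_onto:
  assumes "\<And>k. interval_surj (f k)" shows "(\<lambda>x. x n) ` threads f = {0..1}"
proof -
  have "a \<in> (\<lambda>x. x n) ` threads f" if "a \<in> {0..1}" for a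
    using thread_through_point[of f "\<lambda>n. {0..1}" a n] assms that unfolding threads_def by fastforce
  then show ?thesis unfolding threads_def by auto
qed

lemma continuous_on_coordinate: "continuous_on S (\<lambda>x::nat \<Rightarrow> real. x n)"
  by (rule continuous_on_subset[OF continuous_on_product_coordinates]) auto

text \<open>By Stone-Weierstrass. Functions of a single coordinate form an algebra because a
  function of coordinate \<open>m\<close> is also one of any later coordinate, by composition with a
  bond; the coordinates themselves separate threads.\<close>

lemma threads_function_approximation:
  fixes h :: "(nat \<Rightarrow> real) \<Rightarrow> real"
  assumes f: "\<And>k. interval_surj (f k)" and h: "continuous_on (threads f) h" and \<epsilon>: "0 < \<epsilon>"
  shows "\<exists>m\<ge>N. \<exists>u. continuous_on {0..1} u \<and> (\<forall>x\<in>threads f. \<bar>h x - u (x m)\<bar> < \<epsilon>)"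
proof -
  let ?X = "threads f"
  define R where "R = {\<phi>. \<exists>m (u :: real \<Rightarrow> real). continuous_on {0..1} u \<and> (\<forall>x\<in>?X. \<phi> x = u (x m))}"
  have raise: "\<exists>u. continuous_on {0..1} u \<and> (\<forall>x\<in>?X. \<phi> x = u (x m'))"
    if "continuous_on {0..1} u" "\<forall>x\<in>?X. \<phi> x = u (x m)" "m \<le> m'" for \<phi> u m m'
  proof (intro exI conjI ballI)
    show "continuous_on {0..1} (u \<circ> bond f m m')"
      using interval_surj_bond[of f m m'] f that by (intro continuous_on_compose) auto
    show "\<phi> x = (u \<circ> bond f m m') (x m')" if "x \<in> ?X" for x
      using bond_thread[of m m' f x] \<open>m \<le> m'\<close> \<open>\<forall>x\<in>?X. \<phi> x = u (x m)\<close> that by (simp add: threads_def)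
  qed
  have pair: "\<exists>m u u'. continuous_on {0..1} u \<and> continuous_on {0..1} u' \<and> (\<forall>x\<in>?X. \<phi> x = u (x m) \<and> \<phi>' x = u' (x m))"
    if "\<phi> \<in> R" "\<phi>' \<in> R" for \<phi> \<phi>'
  proof -
    from that obtain m u m' u' where "continuous_on {0..1} u" "\<forall>x\<in>?X. \<phi> x = u (x m)"
      "continuous_on {0..1} u'" "\<forall>x\<in>?X. \<phi>' x = u' (x m')" unfolding R_def by blast
    then show ?thesis using raise[of u \<phi> m "max m m'"] raise[of u' \<phi>' m' "max m m'"] by (metis max.cobounded1 max.cobounded2)
  qed
  interpret function_ring_on R ?X
  proof
    show "compact ?X" by (rule compact_threads[OF f])
  next
    fix \<phi> assume "\<phi> \<in> R"
    then obtain m u where u: "continuous_on {0..1} u" "\<forall>x\<in>?X. \<phi> x = u (x m)" unfolding R_def by blast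
    have "continuous_on ?X (\<lambda>x. u (x m))"
      by (rule continuous_on_compose2[OF u(1) continuous_on_coordinate]) (auto simp: threads_def)
    then show "continuous_on ?X \<phi>" using u(2) by (simp cong: continuous_on_cong)
  next
    fix \<phi> \<phi>' assume "\<phi> \<in> R" "\<phi>' \<in> R"
    from pair[OF this] obtain m u u' where u: "continuous_on {0..1} u" "continuous_on {0..1} u'"
      "\<forall>x\<in>?X. \<phi> x = u (x m) \<and> \<phi>' x = u' (x m)" by blast
    then have "continuous_on {0..1} (\<lambda>t. u t + u' t)" "continuous_on {0..1} (\<lambda>t. u t * u' t)"
      by (auto intro: continuous_intros)
    then show "(\<lambda>x. \<phi> x + \<phi>' x) \<in> R" "(\<lambda>x. \<phi> x * \<phi>' x) \<in> R"
      unfolding R_def using u(3) by (auto intro!: exI[of _ m])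
  next
    show "(\<lambda>_. c) \<in> R" for c unfolding R_def by (auto intro!: exI[of _ "\<lambda>_. c"])
  next
    fix x y assume "x \<in> ?X" "y \<in> ?X" "x \<noteq> y"
    then obtain n where "x n \<noteq> y n" by blast
    moreover have "(\<lambda>x. x n) \<in> R" unfolding R_def by (auto intro!: exI[of _ n] exI[of _ "\<lambda>t. t"])
    ultimately show "\<exists>\<phi>\<in>R. \<phi> x \<noteq> \<phi> y" by (intro bexI[of _ "\<lambda>x. x n"])
  qed
  obtain \<phi> where \<phi>: "\<phi> \<in> R" "\<forall>x\<in>?X. \<bar>h x - \<phi> x\<bar> < \<epsilon>"
    using Stone_Weierstrass_basic[OF h \<epsilon>] by blast
  then obtain m u where "continuous_on {0..1} u" "\<forall>x\<in>?X. \<phi> x = u (x m)" unfolding R_def by blast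
  then obtain u' where "continuous_on {0..1} u'" "\<forall>x\<in>?X. \<phi> x = u' (x (max m N))"
    using raise[of u \<phi> m "max m N"] by auto
  then show ?thesis using \<phi>(2) by (intro exI[of _ "max m N"]) auto
qed

text \<open>The lift of coordinate \<open>n\<close> exists on the limit and is replaced by a
  function of coordinate \<open>m\<close>. As every \<open>t\<close> is the coordinate
  \<open>m\<close> of some thread, the estimate on threads becomes one on the interval.\<close>

theorem bond_factors_through_surj:
  assumes f: "\<And>k. interval_surj (f k)" and X: "connected (threads f)" "hered_indec (threads f)"
    and g: "interval_surj g" and \<epsilon>: "0 < \<epsilon>"
  shows "\<exists>m\<ge>N. \<exists>h. interval_surj h \<and> (\<forall>t\<in>{0..1}. \<bar>g (h t) - bond f n m t\<bar> \<le> \<epsilon>)"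
proof -
  let ?X = "threads f"
  have cX: "compact ?X" by (rule compact_threads[OF f])
  have "0 < \<epsilon> / 2" using \<epsilon> by simp
  then obtain h where h: "continuous_on ?X h" "h ` ?X = {0..1}" "\<forall>x\<in>?X. \<bar>g (h x) - x n\<bar> \<le> \<epsilon> / 2"
    using lift_interval_surj[OF cX X continuous_on_coordinate threads_onto[OF f] g] by blast
  have "uniformly_continuous_on {0..1} g" using g by (intro compact_uniformly_continuous) auto
  then obtain \<delta> where \<delta>: "0 < \<delta>"
    "\<And>s t. s \<in> {0..1} \<Longrightarrow> t \<in> {0..1} \<Longrightarrow> dist t s < \<delta> \<Longrightarrow> dist (g t) (g s) < \<epsilon> / 2"
    unfolding uniformly_continuous_on_def using \<open>0 < \<epsilon> / 2\<close> by metis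
  \<comment> \<open>Approximation costs \<open>\<eta>\<close> and stretching
    \<open>3 * \<eta>\<close>, hence \<open>4 * \<eta> < \<delta>\<close>. The bound 1/4 makes
    \<open>1 - 2 * \<eta>\<close> positive and gives the two products in \<open>snear\<close> the
    right sign.\<close>
  define \<eta> where "\<eta> = min (1/4) (\<delta> / 8)"
  have \<eta>: "0 < \<eta>" "\<eta> \<le> 1/4" "4 * \<eta> < \<delta>" using \<delta>(1) by (auto simp: \<eta>_def)
  obtain m u where m: "N + n \<le> m" and u: "continuous_on {0..1} u" "\<forall>x\<in>?X. \<bar>h x - u (x m)\<bar> < \<eta>"
    using threads_function_approximation[OF f h(1) \<eta>(1)] by blast
  \<comment> \<open>Stretching about the midpoint and clamping restores surjectivity.\<close>
  define s where "s t = max 0 (min 1 ((t - \<eta>) / (1 - 2 * \<eta>)))" for t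
  have sb: "s t \<in> {0..1}" for t by (auto simp: s_def)
  have s01: "s t = 0" if "t \<le> \<eta>" for t using that \<eta> by (auto simp: s_def divide_nonpos_pos)
  have s11: "s t = 1" if "1 - \<eta> \<le> t" for t using that \<eta> by (auto simp: s_def field_simps)
  have snear: "\<bar>s t - r\<bar> \<le> 4 * \<eta>" if "r \<in> {0..1}" "\<bar>r - t\<bar> < \<eta>" for r t
  proof -
    have "(t - \<eta>) / (1 - 2 * \<eta>) \<le> t + 3 * \<eta>"
    proof -
      have "0 \<le> \<eta> * (4 - 2 * t - 6 * \<eta>)" using that \<eta> by (intro mult_nonneg_nonneg) auto
      then show ?thesis using \<eta> by (simp add: field_simps)
    qed
    moreover have "t - 3 * \<eta> \<le> (t - \<eta>) / (1 - 2 * \<eta>)"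
    proof -
      have "0 \<le> \<eta> * (2 + 2 * t - 6 * \<eta>)" using that \<eta> by (intro mult_nonneg_nonneg) auto
      then show ?thesis using \<eta> by (simp add: field_simps)
    qed
    ultimately show ?thesis using that by (auto simp: s_def)
  qed
  have "continuous_on {0..1} (\<lambda>t. s (u t))" unfolding s_def
    using u(1) \<eta> by (intro continuous_intros) auto
  moreover have "(\<lambda>t. s (u t)) ` {0..1} = {0..1}"
  proof (rule real_image_onto_interval)
    have "0 \<in> h ` ?X" "1 \<in> h ` ?X" using h(2) by auto
    then obtain x y where xy: "x \<in> ?X" "h x = 0" "y \<in> ?X" "h y = 1" by (metis imageE)
    then have "s (u (x m)) = 0" "s (u (y m)) = 1"
      using u(2) s01[of "u (x m)"] s11[of "u (y m)"] by force+
    moreover have "x m \<in> {0..1}" "y m \<in> {0..1}" using xy by (auto simp: threads_def)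
    ultimately show "0 \<in> (\<lambda>t. s (u t)) ` {0..1}" "1 \<in> (\<lambda>t. s (u t)) ` {0..1}" by (metis imageI)+
  qed (use calculation sb in auto)
  moreover have "\<bar>g (s (u t)) - bond f n m t\<bar> \<le> \<epsilon>" if t: "t \<in> {0..1}" for t
  proof -
    obtain x where x: "x \<in> ?X" "x m = t" using threads_onto[of f m] f t by (metis imageE)
    have hx: "h x \<in> {0..1}" using h(2) x by blast
    have "\<bar>s (u t) - h x\<bar> < \<delta>" using snear[OF hx, of "u t"] u(2) x \<eta>(3) by fastforce
    then have "\<bar>g (s (u t)) - g (h x)\<bar> < \<epsilon> / 2"
      using \<delta>(2)[OF hx sb] by (simp add: dist_real_def)
    moreover have "bond f n m t = x n" using bond_thread[of n m f x] m x by (auto simp: threads_def)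
    moreover have "\<bar>g (h x) - x n\<bar> \<le> \<epsilon> / 2" using h(3) x by blast
    ultimately show ?thesis by linarith
  qed
  ultimately show ?thesis using m by (intro exI[of _ m]) auto
qed

section \<open>Comparison of two inverse sequences\<close>

text \<open>The coordinates of the homeomorphism are the uniform limits of \<open>bond f i (n k) (y k s)\<close> as \<open>k\<close> grows;
  \<open>modulus\<close> makes the limit map injective.\<close>

lemma homeomorphic_threads:
  fixes T :: "'c topology" and y :: "nat \<Rightarrow> 'c \<Rightarrow> real"
  assumes f: "\<And>k. interval_surj (f k)" and T: "compact_space T"
    and y: "\<And>k. continuous_map T euclideanreal (y k)" "\<And>k. y k ` topspace T = {0..1}"
    and inj: "\<And>s t. s \<in> topspace T \<Longrightarrow> t \<in> topspace T \<Longrightarrow> (\<And>k. y k s = y k t) \<Longrightarrow> s = t"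
    and n: "strict_mono n" and \<theta>: "\<And>k. 0 < \<theta> k" "\<And>k. \<theta> (Suc k) \<le> \<theta> k / 2"
    and est: "\<And>i k s. i \<le> n k \<Longrightarrow> s \<in> topspace T \<Longrightarrow>
       \<bar>bond f i (n (Suc k)) (y (Suc k) s) - bond f i (n k) (y k s)\<bar> \<le> \<theta> k"
    and modulus: "\<And>i j s t. s \<in> topspace T \<Longrightarrow> t \<in> topspace T \<Longrightarrow> i \<le> Suc j \<Longrightarrow>
       \<bar>y (Suc j) s - y (Suc j) t\<bar> \<le> 4 * \<theta> (Suc j) \<Longrightarrow> \<bar>y i s - y i t\<bar> \<le> \<theta> j"
  shows "T homeomorphic_space top_of_set (threads f)"
proof -
  define w where "w i k s = bond f i (n k) (y k s)" for i k s
  have \<theta>0: "\<theta> \<longlonglongrightarrow> 0"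
  proof (rule real_tendsto_sandwich[OF _ _ tendsto_const])
    have "\<theta> k \<le> \<theta> 0 * (1/2) ^ k" for k
    proof (induction k)
      case (Suc k)
      then show ?case using \<theta>(2)[of k] by simp
    qed simp
    then show "\<forall>\<^sub>F k in sequentially. \<theta> k \<le> \<theta> 0 * (1/2) ^ k" by simp
    show "(\<lambda>k. \<theta> 0 * (1/2) ^ k) \<longlonglongrightarrow> 0"
      by (intro tendsto_mult_right_zero LIMSEQ_realpow_zero) auto
    show "\<forall>\<^sub>F k in sequentially. 0 \<le> \<theta> k" by (intro always_eventually allI less_imp_le \<theta>(1))
  qed
  have nk: "k \<le> n k" for k using n by (rule strict_mono_imp_increasing)
  have nmono: "n k \<le> n k'" if "k \<le> k'" for k k' using n that by (simp add: strict_mono_less_eq)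
  \<comment> \<open>The subtracted term carries the induction: since \<open>\<theta>\<close> at
    least halves, its decrease pays for the next error \<open>\<theta> (k + d)\<close>.\<close>
  have tail: "\<bar>w i (k + d) s - w i k s\<bar> \<le> 2 * \<theta> k - 2 * \<theta> (k + d)"
    if "i \<le> n k" "s \<in> topspace T" for i k d s
  proof (induction d)
    case (Suc d)
    have "i \<le> n (k + d)" using that(1) nmono[of k "k + d"] by simp
    then have "\<bar>w i (Suc (k + d)) s - w i (k + d) s\<bar> \<le> \<theta> (k + d)" unfolding w_def using est that(2) by blast
    then show ?case using Suc \<theta>(2)[of "k + d"] by simp
  qed simp
  have tail2: "\<bar>w i k' s - w i k s\<bar> \<le> 2 * \<theta> k" if "i \<le> n k" "s \<in> topspace T" "k \<le> k'" for i k k' s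
  proof -
    have "\<bar>w i (k + (k' - k)) s - w i k s\<bar> \<le> 2 * \<theta> k - 2 * \<theta> (k + (k' - k))" by (rule tail[OF that(1,2)])
    then show ?thesis using that(3) \<theta>(1)[of k'] by simp
  qed
  define z where "z i s = lim (\<lambda>k. w i k s)" for i s
  have lim: "(\<lambda>k. w i k s) \<longlonglongrightarrow> z i s" if s: "s \<in> topspace T" for i s
  proof -
    have "Cauchy (\<lambda>k. w i k s)"
    proof (rule CauchyI)
      fix e :: real assume e: "0 < e"
      then have "\<forall>\<^sub>F k in sequentially. \<theta> k < e / 4" using order_tendstoD(2)[OF \<theta>0, of "e / 4"] by simp
      then obtain K where K: "\<And>k. K \<le> k \<Longrightarrow> \<theta> k < e / 4" by (auto simp: eventually_sequentially)
      define M where "M = max K i"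
      have M: "i \<le> n M" "\<theta> M < e / 4" using nk[of M] K[of M] by (auto simp: M_def)
      have "norm (w i a s - w i b s) < e" if "M \<le> a" "M \<le> b" for a b
        using tail2[OF M(1) s that(1)] tail2[OF M(1) s that(2)] M(2) unfolding real_norm_def by linarith
      then show "\<exists>M. \<forall>a\<ge>M. \<forall>b\<ge>M. norm (w i a s - w i b s) < e" by blast
    qed
    then show ?thesis unfolding z_def by (simp add: Cauchy_convergent_iff convergent_LIMSEQ_iff)
  qed
  have zw: "\<bar>z i s - w i k s\<bar> \<le> 2 * \<theta> k" if "i \<le> n k" "s \<in> topspace T" for i k s
  proof (rule tendsto_upperbound)
    show "(\<lambda>k'. \<bar>w i k' s - w i k s\<bar>) \<longlonglongrightarrow> \<bar>z i s - w i k s\<bar>"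
      by (intro tendsto_intros lim that)
    show "\<forall>\<^sub>F k' in sequentially. \<bar>w i k' s - w i k s\<bar> \<le> 2 * \<theta> k"
      using tail2[OF that] by (auto simp: eventually_sequentially)
  qed simp
  have yb: "y k s \<in> {0..1}" if "s \<in> topspace T" for k s using y(2)[of k] that by blast
  have bondI: "bond f i m t \<in> {0..1}" if "t \<in> {0..1}" for i m t
    using interval_surj_bond[of f i m] f that by blast
  have wb: "w i k s \<in> {0..1}" if "s \<in> topspace T" for i k s
    unfolding w_def by (intro bondI yb that)
  have zb: "z i s \<in> {0..1}" if "s \<in> topspace T" for i s
    by (rule closed_sequentially[OF closed_atLeastAtMost _ lim[OF that]]) (rule wb[OF that])
  have zf: "f i (z (Suc i) s) = z i s" if s: "s \<in> topspace T" for i s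
  proof (rule LIMSEQ_unique)
    show "(\<lambda>k. f i (w (Suc i) k s)) \<longlonglongrightarrow> f i (z (Suc i) s)"
      by (rule continuous_on_tendsto_compose[of "{0..1}" "f i"])
         (use f lim[OF s] zb[OF s] wb[OF s] in auto)
    have "w i k s = f i (w (Suc i) k s)" if "Suc i \<le> k" for k
      unfolding w_def using bond_Suc_left[of i "n k" f "y k s"] nk[of k] that by simp
    then have "\<forall>\<^sub>F k in sequentially. w i k s = f i (w (Suc i) k s)"
      unfolding eventually_sequentially by blast
    then show "(\<lambda>k. f i (w (Suc i) k s)) \<longlonglongrightarrow> z i s"
      by (rule Lim_transform_eventually[OF lim[OF s]])
  qed
  have wc: "continuous_map T euclideanreal (w i k)" for i k
  proof -
    have "continuous_map T (top_of_set {0..1}) (y k)"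
      using y yb by (auto simp: continuous_map_in_subtopology)
    moreover have "continuous_map (top_of_set {0..1}) euclideanreal (bond f i (n k))"
      using interval_surj_bond[of f i "n k"] f by simp
    ultimately have "continuous_map T euclideanreal (bond f i (n k) \<circ> y k)" by (rule continuous_map_compose)
    moreover have "bond f i (n k) \<circ> y k = w i k" by (simp add: fun_eq_iff w_def)
    ultimately show ?thesis by simp
  qed
  have zc: "continuous_map T euclideanreal (z i)" for i
  proof -
    have "continuous_map T Met_TC.mtopology (z i)"
    proof (rule Met_TC.continuous_map_uniform_limit)
      show "\<forall>\<^sub>F k in sequentially. continuous_map T Met_TC.mtopology (w i k)" using wc by simp
      fix e :: real assume "0 < e"
      then have "\<forall>\<^sub>F k in sequentially. \<theta> k < e / 2" using order_tendstoD(2)[OF \<theta>0, of "e / 2"] by simp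
      moreover have "\<forall>\<^sub>F k in sequentially. i \<le> k" by (rule eventually_ge_at_top)
      ultimately show "\<forall>\<^sub>F k in sequentially. \<forall>s\<in>topspace T. z i s \<in> UNIV \<and> dist (w i k s) (z i s) < e"
      proof eventually_elim
        case (elim k)
        then have "i \<le> n k" using nk[of k] by linarith
        then have "\<bar>z i s - w i k s\<bar> < e" if "s \<in> topspace T" for s using zw[of i k s] that elim by linarith
        then show ?case by (simp add: dist_real_def abs_minus_commute)
      qed
    qed simp
    then show ?thesis by simp
  qed
  define \<Phi> where "\<Phi> s = (\<lambda>i. z i s)" for s
  have "continuous_map T euclidean \<Phi>"
    unfolding \<Phi>_def euclidean_product_topology[symmetric] continuous_map_componentwise_UNIV
    using zc by simp
  moreover have mem: "\<Phi> s \<in> threads f" if "s \<in> topspace T" for s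
    using zb zf that by (simp add: threads_def \<Phi>_def)
  ultimately have c\<Phi>: "continuous_map T (top_of_set (threads f)) \<Phi>"
    by (auto simp: continuous_map_in_subtopology)
  have inj\<Phi>: "inj_on \<Phi> (topspace T)"
  proof (rule inj_onI)
    fix s t assume st: "s \<in> topspace T" "t \<in> topspace T" "\<Phi> s = \<Phi> t"
    \<comment> \<open>Coordinate \<open>n k\<close> of the image lies within
      \<open>2 * \<theta> k\<close> of \<open>y k\<close>, once for \<open>s\<close> and once for
      \<open>t\<close>. This is the constant 4 in \<open>modulus\<close>.\<close>
    have close: "\<bar>y k s - y k t\<bar> \<le> 4 * \<theta> k" for k
    proof -
      have "\<bar>z (n k) s - y k s\<bar> \<le> 2 * \<theta> k" "\<bar>z (n k) t - y k t\<bar> \<le> 2 * \<theta> k"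
        using zw[of "n k" k s] zw[of "n k" k t] st by (simp_all add: w_def)
      moreover have "z (n k) s = z (n k) t" using st(3) by (metis \<Phi>_def)
      ultimately show ?thesis by linarith
    qed
    show "s = t"
    proof (rule inj[OF st(1,2)])
      fix i
      have "\<bar>y i s - y i t\<bar> \<le> 0"
      proof (rule tendsto_lowerbound[OF \<theta>0])
        show "\<forall>\<^sub>F j in sequentially. \<bar>y i s - y i t\<bar> \<le> \<theta> j"
          using modulus[OF st(1,2) _ close] unfolding eventually_sequentially by (meson le_SucI)
      qed simp
      then show "y i s = y i t" by simp
    qed
  qed
  have "x \<in> \<Phi> ` topspace T" if x: "x \<in> threads f" for x
  proof -
    \<comment> \<open>Surjectivity by compactness: since \<open>y j\<close> is onto, some point
      matches \<open>x\<close> exactly at stage \<open>j\<close> on all coordinates up to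
      \<open>n j\<close>, and passing to the limit costs \<open>2 * \<theta> j\<close>.\<close>
    define C where "C j = {s \<in> topspace T. \<forall>i\<le>n j. \<bar>z i s - x i\<bar> \<le> 2 * \<theta> j}" for j
    have "closedin T (C j)" for j
    proof -
      have "closedin T {s \<in> topspace T. z i s \<in> cball (x i) (2 * \<theta> j)}" for i
        by (rule closedin_continuous_map_preimage[OF zc]) simp
      then have "closedin T (\<Inter>i\<in>{..n j}. {s \<in> topspace T. z i s \<in> cball (x i) (2 * \<theta> j)})"
        by (intro closedin_INT) auto
      moreover have "(\<Inter>i\<in>{..n j}. {s \<in> topspace T. z i s \<in> cball (x i) (2 * \<theta> j)}) = C j"
        by (auto simp: C_def dist_real_def abs_minus_commute)
      ultimately show ?thesis by simp
    qed
    moreover have "C j \<noteq> {}" for j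
    proof -
      have "x (n j) \<in> y j ` topspace T" using x y(2) by (simp add: threads_def)
      then obtain s where s: "s \<in> topspace T" "y j s = x (n j)" by (metis imageE)
      have "w i j s = x i" if "i \<le> n j" for i
        unfolding w_def s(2) using x that by (intro bond_thread) (auto simp: threads_def)
      then have "s \<in> C j" using zw[of _ j s] s(1) by (auto simp: C_def)
      then show ?thesis by blast
    qed
    moreover have "decseq C"
    proof (rule decseq_SucI)
      fix j
      have "n j \<le> n (Suc j)" "\<theta> (Suc j) \<le> \<theta> j" using nmono[of j "Suc j"] \<theta>(1,2)[of j] by auto
      then have "\<bar>z i s - x i\<bar> \<le> 2 * \<theta> j" if "s \<in> C (Suc j)" "i \<le> n j" for s i
        using that order_trans[of "\<bar>z i s - x i\<bar>" "2 * \<theta> (Suc j)" "2 * \<theta> j"] by (simp add: C_def)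
      then show "C (Suc j) \<subseteq> C j" by (auto simp: C_def)
    qed
    ultimately have "(\<Inter>j. C j) \<noteq> {}" using compact_space_imp_nest[OF T] by blast
    then obtain s where s: "\<And>j. s \<in> C j" by blast
    have "\<bar>z i s - x i\<bar> \<le> 2 * 0" for i
    proof (rule tendsto_lowerbound)
      show "(\<lambda>j. 2 * \<theta> j) \<longlonglongrightarrow> 2 * 0" by (intro tendsto_intros \<theta>0)
      show "\<forall>\<^sub>F j in sequentially. \<bar>z i s - x i\<bar> \<le> 2 * \<theta> j"
        unfolding eventually_sequentially using s nk le_trans unfolding C_def by blast
    qed simp
    then have "\<Phi> s = x" by (auto simp: \<Phi>_def)
    then show ?thesis using s[of 0] by (auto simp: C_def)
  qed
  then have "\<Phi> ` topspace T = topspace (top_of_set (threads f))" using mem by auto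
  then have "homeomorphic_map T (top_of_set (threads f)) \<Phi>"
    by (intro continuous_imp_homeomorphic_map c\<Phi> T inj\<Phi> Hausdorff_space_subtopology Hausdorff_space_euclidean)
  then show ?thesis by (rule homeomorphic_map_imp_homeomorphic_space)
qed

section \<open>The game\<close>

lemma position_snoc:
  assumes "h \<noteq> []"
  shows "position K (h @ [a]) \<longleftrightarrow> position K h \<and> a \<in> Arr K \<and> Cod a = Dom (last h)"
proof -
  obtain g b where h: "h = g @ [b]" using assms by (metis rev_exhaust)
  have "(\<forall>i. Suc i < length (h @ [a]) \<longrightarrow> Cod ((h @ [a]) ! Suc i) = Dom ((h @ [a]) ! i)) \<longleftrightarrow>
     (\<forall>i. Suc i < length h \<longrightarrow> Cod (h ! Suc i) = Dom (h ! i)) \<and> Cod a = Dom b"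
    (is "?L \<longleftrightarrow> ?R")
  proof
    assume L: ?L
    have "Cod (h ! Suc i) = Dom (h ! i)" if "Suc i < length h" for i
      using L[rule_format, of i] that by (simp add: nth_append)
    moreover have "Cod a = Dom b" using L[rule_format, of "length g"] by (simp add: h nth_append)
    ultimately show ?R by blast
  next
    assume R: ?R
    show ?L
    proof (intro allI impI)
      fix i assume "Suc i < length (h @ [a])"
      then consider "Suc i < length h" | "i = length g" by (auto simp: h less_Suc_eq)
      then show "Cod ((h @ [a]) ! Suc i) = Dom ((h @ [a]) ! i)"
        using R by cases (auto simp: nth_append h)
    qed
  qed
  then show ?thesis by (auto simp: position_def h)
qed

text \<open>A strategy sees only the history, whereas Odd needs a state. The state is recomputed
  from Eve's moves in the history by fixed choices, so in a run that follows the strategy it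
  develops consistently.\<close>

lemma Odd_strategy_from_states:
  fixes K :: "'a top_cat" and move :: "'s \<Rightarrow> 'a arrow"
  assumes K: "subcategory K C"
    and start: "\<And>e. e \<in> Arr K \<Longrightarrow> \<exists>s. Inv s \<and> move s \<in> Arr K \<and> Cod (move s) = Dom e"
    and step: "\<And>s e. Inv s \<Longrightarrow> e \<in> Arr K \<Longrightarrow> Cod e = Dom (move s) \<Longrightarrow>
       \<exists>s'. Inv s' \<and> move s' \<in> Arr K \<and> Cod (move s') = Dom e \<and> R s e s'"
  shows "\<exists>\<sigma>. Odd_strategy K \<sigma> \<and> (\<forall>f. run K f \<and> follows \<sigma> f \<longrightarrow>
    (\<exists>S. \<forall>k. Inv (S k) \<and> f (2 * k + 1) = move (S k) \<and> R (S k) (f (2 * k + 2)) (S (Suc k))))"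
proof -
  define ok where "ok e s \<longleftrightarrow> Inv s \<and> move s \<in> Arr K \<and> Cod (move s) = Dom e" for e :: "'a arrow" and s
  define st :: "(nat \<Rightarrow> 'a arrow) \<Rightarrow> nat \<Rightarrow> 's" where "st g = rec_nat (SOME s. ok (g 0) s) 
    (\<lambda>k s. SOME s'. ok (g (2 * k + 2)) s' \<and> R s (g (2 * k + 2)) s')" for g
  have st0: "st g 0 = (SOME s. ok (g 0) s)"
    and stSuc: "st g (Suc k) = (SOME s'. ok (g (2 * k + 2)) s' \<and> R (st g k) (g (2 * k + 2)) s')" for g k
    by (simp_all add: st_def)
  \<comment> \<open>\<open>st g k\<close> reads \<open>g\<close> only up to index
    \<open>2 * k\<close>, so a history of length \<open>2 * k + 1\<close> determines it.\<close>
  have st_cong: "st g k = st g' k" if "\<And>i::nat. i \<le> 2 * k \<Longrightarrow> g i = g' i" for g g' k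
    using that by (induction k) (simp_all add: st0 stSuc)
  \<comment> \<open>In histories where Odd deviated from \<open>\<sigma>\<close> the recomputed move
    may be illegal; an identity arrow is then a legal answer.\<close>
  define \<sigma> where "\<sigma> h = (let a = move (st (nth h) (length h div 2)) in
    if position K (h @ [a]) then a else id_arrow (Dom (last h)))" for h
  have idK: "id_arrow (Dom a) \<in> Arr K" if "a \<in> Arr K" for a
    using K that unfolding subcategory_def by blast
  have "Odd_strategy K \<sigma>"
    unfolding Odd_strategy_def
  proof (intro allI impI)
    fix h assume h: "position K h \<and> odd (length h)"
    then have "h \<noteq> []" by auto
    moreover from this have "last h \<in> Arr K" using h last_in_set by (auto simp: position_def)
    ultimately have "position K (h @ [id_arrow (Dom (last h))])"
      using h idK by (simp add: position_snoc) (simp add: id_arrow_def)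
    then show "position K (h @ [\<sigma> h])" by (simp add: \<sigma>_def Let_def)
  qed
  moreover have "\<exists>S. \<forall>k. Inv (S k) \<and> f (2 * k + 1) = move (S k) \<and> R (S k) (f (2 * k + 2)) (S (Suc k))"
    if f: "run K f" "follows \<sigma> f" for f
  proof -
    have fK: "f n \<in> Arr K" "Cod (f (Suc n)) = Dom (f n)" for n using f(1) by (simp_all add: run_def)
    have pos: "position K (map f [0..<n])" for n
      using fK by (auto simp: position_def)
    have reply: "f (2 * k + 1) = move (st f k)" if "ok (f (2 * k)) (st f k)" for k
    proof -
      let ?h = "map f [0..<2 * k + 1]"
      have "st (nth ?h) k = st f k" by (rule st_cong) (simp del: upt_Suc)
      moreover have "length ?h div 2 = k" by simp
      moreover have "position K (?h @ [move (st f k)])"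
        using that pos[of "2 * k + 1"] by (subst position_snoc) (auto simp: ok_def)
      ultimately have "\<sigma> ?h = move (st f k)" by (simp add: \<sigma>_def Let_def del: upt_Suc)
      then show ?thesis using f(2) unfolding follows_def by (metis odd_two_times_div_two_succ even_mult_iff odd_add odd_one even_numeral)
    qed
    have next_ok: "ok (f (2 * k + 2)) (st f (Suc k)) \<and> R (st f k) (f (2 * k + 2)) (st f (Suc k))"
      if "ok (f (2 * k)) (st f k)" for k
      unfolding stSuc
    proof (rule someI_ex)
      have "Cod (f (2 * k + 2)) = Dom (move (st f k))" using fK(2)[of "2 * k + 1"] reply[OF that] by simp
      then show "\<exists>s'. ok (f (2 * k + 2)) s' \<and> R (st f k) (f (2 * k + 2)) s'"
        using step[of "st f k" "f (2 * k + 2)"] that fK(1) unfolding ok_def by blast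
    qed
    have all_ok: "ok (f (2 * k)) (st f k)" for k
    proof (induction k)
      case 0
      have "ok (f 0) (st f 0)" unfolding st0
        by (rule someI_ex) (use start[OF fK(1)[of 0]] in \<open>auto simp: ok_def\<close>)
      then show ?case by simp
    next
      case (Suc k)
      then show ?case using next_ok by simp
    qed
    then show ?thesis
      using next_ok reply by (intro exI[of _ "st f"]) (auto simp: ok_def)
  qed
  ultimately show ?thesis by blast
qed

section \<open>Factoring moves through the interval\<close>

lemma Peano_continuum_homeomorphic:
  assumes "X homeomorphic_space Y" shows "Peano_continuum X \<longleftrightarrow> Peano_continuum Y"
proof -
  have "topspace X = {} \<longleftrightarrow> topspace Y = {}"
    using homeomorphic_empty_space[OF assms] by simp
  then show ?thesis
    unfolding Peano_continuum_def continuum_space_def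
    by (simp only: homeomorphic_compact_space[OF assms] homeomorphic_connected_space[OF assms]
        homeomorphic_Hausdorff_space[OF assms] homeomorphic_metrizable_space[OF assms]
        homeomorphic_locally_connected_space[OF assms])
qed

lemma Peano_continuum_interval: "Peano_continuum (top_of_set {0..1::real})"
  unfolding Peano_continuum_def continuum_space_def
  by (auto simp: compact_space_subtopology locally_connected_real_interval
      intro!: Hausdorff_space_subtopology metrizable_space_subtopology metrizable_space_euclidean)

text \<open>All spaces of \<open>Peano_s\<close> are carried by the type \<open>'a\<close>, so the
  interval has to be transported there along \<open>e\<close>.\<close>

lemma interval_copy:
  fixes e :: "real \<Rightarrow> 'a"
  assumes "inj e"
  obtains J :: "'a topology" and j :: "'a \<Rightarrow> real" where "Peano_continuum J"
    "continuous_map J (top_of_set {0..1}) j" "j ` topspace J = {0..1}"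
proof -
  define J where "J = pullback_topology (e ` {0..1}) (inv e) (top_of_set {0..1})"
  have tJ: "topspace J = e ` {0..1}" using assms by (auto simp: J_def topspace_pullback_topology)
  have c1: "continuous_map J (top_of_set {0..1}) (inv e)"
    using continuous_map_pullback[OF continuous_map_id, of "e ` {0..1}" "inv e" "top_of_set {0..1}"]
    by (simp add: J_def)
  have c2: "continuous_map (top_of_set {0..1}) J e"
    unfolding J_def by (rule continuous_map_pullback') (use assms in auto)
  have "homeomorphic_maps J (top_of_set {0..1}) (inv e) e"
    using c1 c2 assms by (auto simp: homeomorphic_maps_def tJ)
  then have "J homeomorphic_space top_of_set {0..1::real}"
    unfolding homeomorphic_space_def by blast
  then have "Peano_continuum J" using Peano_continuum_homeomorphic Peano_continuum_interval by blast
  moreover have "inv e ` topspace J = {0..1}" using assms by (simp add: tJ image_image)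
  ultimately show thesis using that c1 by blast
qed

lemma Peano_s_arrowI:
  assumes "Peano_continuum X" "Peano_continuum Y" "continuous_map X Y h" "h ` topspace X = topspace Y"
  shows "\<lparr>Dom = X, Cod = Y, Fun = restrict h (topspace X)\<rparr> \<in> Arr Peano_s"
  using assms continuous_map_eq[of X Y h "restrict h (topspace X)"] by (simp add: Peano_s_def)

text \<open>The map from the copy \<open>J\<close> of the interval onto \<open>X\<close> may lie
  outside \<open>K\<close>. Absorption precomposes it with some \<open>g\<close> so that the
  composite is in \<open>K\<close>, and the factorisation through the interval survives.\<close>

lemma dominating_arrow_through_interval:
  fixes e \<beta> :: "real \<Rightarrow> 'a" and K :: "'a top_cat"
  assumes e: "inj e" and K: "dominating K Peano_s" and X: "X \<in> Obj K"
    and \<beta>: "continuous_map (top_of_set {0..1}) X \<beta>" "\<beta> ` {0..1} = topspace X"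
  shows "\<exists>m \<alpha>. m \<in> Arr K \<and> Cod m = X \<and> continuous_map (Dom m) (top_of_set {0..1}) \<alpha> \<and>
    \<alpha> ` topspace (Dom m) = {0..1} \<and> (\<forall>x\<in>topspace (Dom m). Fun m x = \<beta> (\<alpha> x))"
proof -
  obtain J :: "'a topology" and j :: "'a \<Rightarrow> real" where J: "Peano_continuum J"
    "continuous_map J (top_of_set {0..1}) j" "j ` topspace J = {0..1}"
    by (rule interval_copy[OF e])
  have "Obj K \<subseteq> Obj Peano_s" using K by (auto simp: dominating_def subcategory_def)
  then have PX: "Peano_continuum X" using X by (auto simp: Peano_s_def)
  define u where "u = \<lparr>Dom = J, Cod = X, Fun = restrict (\<beta> \<circ> j) (topspace J)\<rparr>"
  have "u \<in> Arr Peano_s"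
    unfolding u_def
    by (rule Peano_s_arrowI[OF J(1) PX continuous_map_compose[OF J(2) \<beta>(1)]])
       (simp only: image_comp[symmetric] J(3) \<beta>(2))
  moreover have "Cod u \<in> Obj K" using X by (simp add: u_def)
  ultimately obtain g where g: "g \<in> Arr Peano_s" "Cod g = J" "comp_arrow u g \<in> Arr K"
    using K unfolding dominating_def absorbing_def by (auto simp: u_def)
  have gc: "continuous_map (Dom g) J (Fun g)" "Fun g ` topspace (Dom g) = topspace J"
    using g(1,2) by (auto simp: Peano_s_def)
  show ?thesis
  proof (intro exI[of _ "comp_arrow u g"] exI[of _ "j \<circ> Fun g"] conjI ballI)
    show "continuous_map (Dom (comp_arrow u g)) (top_of_set {0..1}) (j \<circ> Fun g)"
      using continuous_map_compose[OF gc(1) J(2)] by (simp add: comp_arrow_def)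
    show "(j \<circ> Fun g) ` topspace (Dom (comp_arrow u g)) = {0..1}"
      unfolding image_comp[symmetric] using gc(2) J(3) by (simp add: comp_arrow_def)
    show "Fun (comp_arrow u g) x = \<beta> ((j \<circ> Fun g) x)" if "x \<in> topspace (Dom (comp_arrow u g))" for x
      using that gc(2) by (auto simp: comp_arrow_def compose_def u_def)
    show "comp_arrow u g \<in> Arr K" by (rule g(3))
    show "Cod (comp_arrow u g) = X" by (simp add: comp_arrow_def u_def)
  qed
qed

lemma common_modulus:
  fixes F :: "(real \<Rightarrow> real) set"
  assumes "finite F" "\<And>q. q \<in> F \<Longrightarrow> continuous_on {0..1} q" "0 < \<eta>"
  shows "\<exists>\<delta>>0. \<forall>q\<in>F. \<forall>s\<in>{0..1}. \<forall>t\<in>{0..1}. \<bar>s - t\<bar> \<le> \<delta> \<longrightarrow> \<bar>q s - q t\<bar> \<le> \<eta>"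
  using assms(1,2)
proof (induction F rule: finite_induct)
  case (insert q F)
  then obtain \<delta> where \<delta>: "0 < \<delta>" "\<forall>q\<in>F. \<forall>s\<in>{0..1}. \<forall>t\<in>{0..1}. \<bar>s - t\<bar> \<le> \<delta> \<longrightarrow> \<bar>q s - q t\<bar> \<le> \<eta>"
    by (metis insertCI)
  have "uniformly_continuous_on {0..1} q" using insert.prems by (intro compact_uniformly_continuous) auto
  then obtain \<delta>' where \<delta>': "0 < \<delta>'" "\<And>s t. s \<in> {0..1} \<Longrightarrow> t \<in> {0..1} \<Longrightarrow> dist t s < \<delta>' \<Longrightarrow> dist (q t) (q s) < \<eta>"
    unfolding uniformly_continuous_on_def using assms(3) by metis
  have "\<bar>q s - q t\<bar> \<le> \<eta>" if "s \<in> {0..1}" "t \<in> {0..1}" "\<bar>s - t\<bar> \<le> min \<delta> (\<delta>' / 2)" for s t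
    using \<delta>'(2)[OF that(2,1)] that(3) \<delta>'(1) unfolding dist_real_def by linarith
  then show ?case using \<delta> \<delta>'(1) by (intro exI[of _ "min \<delta> (\<delta>' / 2)"]) auto
qed (auto intro: exI[of _ 1])

lemma inverse_limit_topspace:
  "topspace (inverse_limit X f) = {x. \<forall>n. x n \<in> topspace (X n) \<and> f n (x (Suc n)) = x n}"
  by (auto simp: inverse_limit_def PiE_UNIV_domain Pi_iff)

lemma inverse_limit_projection: "continuous_map (inverse_limit X f) (X n) (\<lambda>x. x n)"
  unfolding inverse_limit_def
  by (rule continuous_map_from_subtopology) (rule continuous_map_product_projection, simp)

lemma compact_inverse_limit:
  assumes "\<And>n. compact_space (X n)" "\<And>n. Hausdorff_space (X n)" "\<And>n. continuous_map (X (Suc n)) (X n) (f n)"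
  shows "compact_space (inverse_limit X f)"
proof -
  let ?P = "product_topology X UNIV"
  have pr: "continuous_map ?P (X n) (\<lambda>x. x n)" for n by (rule continuous_map_product_projection) simp
  have "closedin ?P {x \<in> topspace ?P. f n (x (Suc n)) = x n}" for n
    using closedin_continuous_maps_eq[OF assms(2) continuous_map_compose[OF pr assms(3)] pr] by simp
  then have "closedin ?P (\<Inter>n. {x \<in> topspace ?P. f n (x (Suc n)) = x n})" by (intro closedin_INT) auto
  moreover have "(\<Inter>n. {x \<in> topspace ?P. f n (x (Suc n)) = x n}) = topspace ?P \<inter> {x. \<forall>n. f n (x (Suc n)) = x n}"
    by auto
  ultimately have cl: "closedin ?P (topspace ?P \<inter> {x. \<forall>n. f n (x (Suc n)) = x n})" by simp
  have "compact_space ?P" using assms(1) by (simp add: compact_space_product_topology)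
  then have "compactin ?P (topspace ?P \<inter> {x. \<forall>n. f n (x (Suc n)) = x n})"
    using cl by (rule closedin_compact_space)
  then have "compact_space (subtopology ?P (topspace ?P \<inter> {x. \<forall>n. f n (x (Suc n)) = x n}))"
    by (rule compact_space_subtopology)
  then show ?thesis
    unfolding inverse_limit_def by (simp only: subtopology_restrict)
qed

section \<open>Odd's strategy and the limit of a run\<close>

text \<open>What Odd remembers: his last move, factored through the interval as \<open>out\<close> after \<open>inn\<close>; the
  level of that interval in the inverse sequence of the pseudo-arc; the maps from that interval to
  those of all his moves so far; and the tolerances for later moves.\<close>

record 'a stage =
  move :: "'a arrow"
  inn :: "'a \<Rightarrow> real"
  out :: "real \<Rightarrow> 'a"
  level :: nat
  comparisons :: "(real \<Rightarrow> real) list"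
  tol :: real
  err :: real

text \<open>The last clause ties \<open>err\<close> to \<open>tol\<close>: a deviation of
  \<open>err\<close> at the current level shows as at most \<open>tol\<close> at all lower levels.
  It yields the hypothesis \<open>est\<close> of \<open>homeomorphic_threads\<close>.\<close>

definition valid_stage :: "(nat \<Rightarrow> real \<Rightarrow> real) \<Rightarrow> 'a stage \<Rightarrow> bool" where
  "valid_stage f s \<longleftrightarrow>
     continuous_map (Dom (move s)) (top_of_set {0..1}) (inn s) \<and>
     inn s ` topspace (Dom (move s)) = {0..1} \<and>
     continuous_map (top_of_set {0..1}) (Cod (move s)) (out s) \<and>
     (\<forall>x\<in>topspace (Dom (move s)). Fun (move s) x = out s (inn s x)) \<and>
     (\<forall>q\<in>set (comparisons s). continuous_on {0..1} q) \<and> id \<in> set (comparisons s) \<and>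
     0 < tol s \<and> 0 < err s \<and>
     (\<forall>i\<le>level s. \<forall>u\<in>{0..1}. \<forall>t\<in>{0..1}. \<bar>u - t\<bar> \<le> err s \<longrightarrow>
        \<bar>bond f i (level s) u - bond f i (level s) t\<bar> \<le> tol s)"

text \<open>The bonding map between the intervals of two consecutive moves of Odd: out of the new
  interval, through Eve's arrow, into the old interval.\<close>

definition link :: "'a stage \<Rightarrow> 'a arrow \<Rightarrow> 'a stage \<Rightarrow> real \<Rightarrow> real" where
  "link s e s' t = inn s (Fun e (out s' t))"

text \<open>The last clause yields the hypothesis \<open>modulus\<close> of
  \<open>homeomorphic_threads\<close>; the new \<open>comparisons\<close> are the composed links
  down to all earlier intervals.\<close>

definition next_stage :: "(nat \<Rightarrow> real \<Rightarrow> real) \<Rightarrow> 'a stage \<Rightarrow> 'a arrow \<Rightarrow> 'a stage \<Rightarrow> bool" where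
  "next_stage f s e s' \<longleftrightarrow>
     level s < level s' \<and>
     (\<forall>t\<in>{0..1}. \<bar>link s e s' t - bond f (level s) (level s') t\<bar> \<le> err s) \<and>
     comparisons s' = id # map (\<lambda>q. q \<circ> link s e s') (comparisons s) \<and>
     tol s' \<le> tol s / 2 \<and>
     (\<forall>q\<in>set (comparisons s'). \<forall>u\<in>{0..1}. \<forall>t\<in>{0..1}. \<bar>u - t\<bar> \<le> 4 * tol s' \<longrightarrow> \<bar>q u - q t\<bar> \<le> tol s)"

lemma bond_modulus:
  assumes "\<And>k. interval_surj (f k)" "0 < \<theta>"
  shows "\<exists>\<epsilon>>0. \<forall>i\<le>n. \<forall>u\<in>{0..1}. \<forall>t\<in>{0..1}. \<bar>u - t\<bar> \<le> \<epsilon> \<longrightarrow> \<bar>bond f i n u - bond f i n t\<bar> \<le> \<theta>"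
proof -
  have "continuous_on {0..1} q" if "q \<in> (\<lambda>i. bond f i n) ` {..n}" for q
    using interval_surj_bond[of f _ n] assms(1) that by auto
  then obtain \<epsilon> where "0 < \<epsilon>" "\<forall>q\<in>(\<lambda>i. bond f i n) ` {..n}. \<forall>u\<in>{0..1}. \<forall>t\<in>{0..1}. \<bar>u - t\<bar> \<le> \<epsilon> \<longrightarrow> \<bar>q u - q t\<bar> \<le> \<theta>"
    using common_modulus[of "(\<lambda>i. bond f i n) ` {..n}" \<theta>] assms(2) by auto
  then show ?thesis by (intro exI[of _ \<epsilon>]) auto
qed

lemma first_stage_exists:
  fixes e :: "real \<Rightarrow> 'a" and K :: "'a top_cat"
  assumes f: "\<And>k. interval_surj (f k)" and e: "inj e" and K: "dominating K Peano_s" and a: "a \<in> Arr K"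
  shows "\<exists>s. valid_stage f s \<and> move s \<in> Arr K \<and> Cod (move s) = Dom a"
proof -
  have sub: "Dom a \<in> Obj K" "Peano_continuum (Dom a)"
  proof -
    have "a \<in> Arr Peano_s" "Dom a \<in> Obj K" using K a by (auto simp: dominating_def subcategory_def)
    then show "Dom a \<in> Obj K" "Peano_continuum (Dom a)" by (auto simp: Peano_s_def)
  qed
  obtain c :: "real \<Rightarrow> 'a" where c: "continuous_map (top_of_set {0..1}) (Dom a) c" "c ` {0..1} = topspace (Dom a)"
    using Hahn_Mazurkiewicz[OF sub(2)] by blast
  obtain m and \<alpha> :: "'a \<Rightarrow> real" where m: "m \<in> Arr K" "Cod m = Dom a" "continuous_map (Dom m) (top_of_set {0..1}) \<alpha>"
    "\<alpha> ` topspace (Dom m) = {0..1}" "\<forall>x\<in>topspace (Dom m). Fun m x = c (\<alpha> x)"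
    using dominating_arrow_through_interval[OF e K sub(1) c] by blast
  obtain \<epsilon> where \<epsilon>: "0 < \<epsilon>" "\<forall>i\<le>0. \<forall>u\<in>{0..1}. \<forall>t\<in>{0..1}. \<bar>u - t\<bar> \<le> \<epsilon> \<longrightarrow> \<bar>bond f i 0 u - bond f i 0 t\<bar> \<le> 1"
    using bond_modulus[where f = f, OF f, of 1 0] by auto
  show ?thesis
    by (rule exI[of _ "\<lparr>move = m, inn = \<alpha>, out = c, level = 0, comparisons = [id], tol = 1, err = \<epsilon>\<rparr>"])
       (use m c \<epsilon> in \<open>simp add: valid_stage_def id_def\<close>)
qed

text \<open>The order of choices matters: \<open>err s\<close> is given and determines
  \<open>h\<close> and the new level; these fix the link and thus the comparison maps
  \<open>Q\<close>; their modulus fixes the new \<open>tol\<close>, and the bonds down from the new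
  level then fix the new \<open>err\<close>.\<close>

lemma next_stage_exists:
  fixes e :: "real \<Rightarrow> 'a" and K :: "'a top_cat"
  assumes f: "\<And>k. interval_surj (f k)" and X: "connected (threads f)" "hered_indec (threads f)"
    and e: "inj e" and K: "dominating K Peano_s"
    and s: "valid_stage f s" and a: "a \<in> Arr K" "Cod a = Dom (move s)"
  shows "\<exists>s'. valid_stage f s' \<and> move s' \<in> Arr K \<and> Cod (move s') = Dom a \<and> next_stage f s a s'"
proof -
  have sub: "Dom a \<in> Obj K" "Peano_continuum (Dom a)" 
    and ac: "continuous_map (Dom a) (Cod a) (Fun a)" "Fun a ` topspace (Dom a) = topspace (Cod a)"
  proof -
    have "a \<in> Arr Peano_s" "Dom a \<in> Obj K" using K a(1) by (auto simp: dominating_def subcategory_def)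
    then show "Dom a \<in> Obj K" "Peano_continuum (Dom a)" "continuous_map (Dom a) (Cod a) (Fun a)"
      "Fun a ` topspace (Dom a) = topspace (Cod a)" by (auto simp: Peano_s_def)
  qed
  have s: "continuous_map (Cod a) (top_of_set {0..1}) (inn s)" "inn s ` topspace (Cod a) = {0..1}"
     "\<forall>q\<in>set (comparisons s). continuous_on {0..1} q" "0 < tol s" "0 < err s"
    using s a(2) by (auto simp: valid_stage_def)
  obtain c :: "real \<Rightarrow> 'a" where c: "continuous_map (top_of_set {0..1}) (Dom a) c" "c ` {0..1} = topspace (Dom a)"
    using Hahn_Mazurkiewicz[OF sub(2)] by blast
  have "continuous_map (top_of_set {0..1}) (top_of_set {0..1}) (inn s \<circ> (Fun a \<circ> c))"
    by (intro continuous_map_compose[OF _ s(1)] continuous_map_compose[OF c(1) ac(1)])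
  moreover have "(inn s \<circ> (Fun a \<circ> c)) ` {0..1} = {0..1}"
    by (simp only: image_comp[symmetric] c(2) ac(2) s(2))
  ultimately have "interval_surj (inn s \<circ> (Fun a \<circ> c))" by (simp add: continuous_map_in_subtopology)
  from bond_factors_through_surj[where f = f, OF f X this s(5), of "Suc (level s)" "level s"]
  obtain n h where n: "Suc (level s) \<le> n" and h: "interval_surj h"
    "\<forall>t\<in>{0..1}. \<bar>(inn s \<circ> (Fun a \<circ> c)) (h t) - bond f (level s) n t\<bar> \<le> err s" by blast
  have hc: "continuous_map (top_of_set {0..1}) (top_of_set {0..1}) h"
    using h(1) by (simp add: continuous_map_in_subtopology image_subset_iff_funcset[symmetric])
  have chc: "continuous_map (top_of_set {0..1}) (Dom a) (c \<circ> h)" by (rule continuous_map_compose[OF hc c(1)])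
  have chi: "(c \<circ> h) ` {0..1} = topspace (Dom a)"
    unfolding image_comp[symmetric] using h(1) c(2) by simp
  obtain m and \<alpha> :: "'a \<Rightarrow> real" where m: "m \<in> Arr K" "Cod m = Dom a" "continuous_map (Dom m) (top_of_set {0..1}) \<alpha>"
    "\<alpha> ` topspace (Dom m) = {0..1}" "\<forall>x\<in>topspace (Dom m). Fun m x = (c \<circ> h) (\<alpha> x)"
    using dominating_arrow_through_interval[OF e K sub(1) chc chi] by blast
  define l where "l = (\<lambda>t. inn s (Fun a ((c \<circ> h) t)))"
  have "continuous_map (top_of_set {0..1}) (top_of_set {0..1}) (inn s \<circ> (Fun a \<circ> (c \<circ> h)))"
    by (intro continuous_map_compose[OF _ s(1)] continuous_map_compose[OF chc ac(1)])
  then have l: "continuous_on {0..1} l" "l ` {0..1} \<subseteq> {0..1}"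
    by (auto simp: continuous_map_in_subtopology l_def comp_def)
  define Q where "Q = id # map (\<lambda>q. q \<circ> l) (comparisons s)"
  have Q: "continuous_on {0..1} q" if "q \<in> set Q" for q
  proof -
    consider "q = id" | q' where "q' \<in> set (comparisons s)" "q = q' \<circ> l" using \<open>q \<in> set Q\<close> by (auto simp: Q_def)
    then show ?thesis
    proof cases
      case 2
      then have "continuous_on (l ` {0..1}) q'" using l(2) s(3) continuous_on_subset by blast
      then show ?thesis unfolding 2(2) by (rule continuous_on_compose[OF l(1)])
    qed (simp add: id_def)
  qed
  obtain \<delta> where \<delta>: "0 < \<delta>" "\<forall>q\<in>set Q. \<forall>u\<in>{0..1}. \<forall>t\<in>{0..1}. \<bar>u - t\<bar> \<le> \<delta> \<longrightarrow> \<bar>q u - q t\<bar> \<le> tol s"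
    using common_modulus[OF finite_set Q s(4)] by blast
  define \<theta> where "\<theta> = min (tol s / 2) (\<delta> / 4)"
  have \<theta>: "0 < \<theta>" "\<theta> \<le> tol s / 2" "4 * \<theta> \<le> \<delta>" using \<delta>(1) s(4) by (auto simp: \<theta>_def)
  obtain \<epsilon> where \<epsilon>: "0 < \<epsilon>" "\<forall>i\<le>n. \<forall>u\<in>{0..1}. \<forall>t\<in>{0..1}. \<bar>u - t\<bar> \<le> \<epsilon> \<longrightarrow> \<bar>bond f i n u - bond f i n t\<bar> \<le> \<theta>"
    using bond_modulus[where f = f, OF f \<theta>(1), of n] by blast
  define s' where "s' = \<lparr>move = m, inn = \<alpha>, out = c \<circ> h, level = n, comparisons = Q, tol = \<theta>, err = \<epsilon>\<rparr>"
  have link: "link s a s' = l" by (simp add: fun_eq_iff link_def l_def s'_def)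
  have s'_simps: "move s' = m" "inn s' = \<alpha>" "out s' = c \<circ> h" "level s' = n" "comparisons s' = Q" "tol s' = \<theta>" "err s' = \<epsilon>"
    by (simp_all add: s'_def)
  have "id \<in> set Q" by (simp add: Q_def)
  then have "valid_stage f s'" unfolding valid_stage_def s'_simps m(2)
    by (intro conjI ballI Q m(3,4) chc \<theta>(1) \<epsilon>) (use m(5) in blast)
  moreover have "next_stage f s a s'" unfolding next_stage_def link s'_simps
  proof (intro conjI)
    show "\<forall>t\<in>{0..1}. \<bar>l t - bond f (level s) n t\<bar> \<le> err s" using h(2) by (simp add: l_def)
    show "\<forall>q\<in>set Q. \<forall>u\<in>{0..1}. \<forall>t\<in>{0..1}. \<bar>u - t\<bar> \<le> 4 * \<theta> \<longrightarrow> \<bar>q u - q t\<bar> \<le> tol s"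
      using \<delta>(2) order_trans[OF _ \<theta>(3)] by blast
    show "level s < n" using n by simp
  qed (use \<theta>(2) in \<open>simp_all add: Q_def\<close>)
  ultimately show ?thesis using m(1,2) by (intro exI[of _ s']) (simp add: s'_def)
qed

text \<open>Odd's intervals act as coordinates on the limit of the run, so
  \<open>homeomorphic_threads\<close> is applied to that limit directly.\<close>

lemma run_limit_homeomorphic_threads:
  fixes F :: "nat \<Rightarrow> 'a arrow" and S :: "nat \<Rightarrow> 'a stage"
  assumes f: "\<And>k. interval_surj (f k)"
    and F: "\<And>n. F n \<in> Arr Peano_s" "\<And>n. Cod (F (Suc n)) = Dom (F n)"
    and S: "\<And>k. valid_stage f (S k)" "\<And>k. F (2 * k + 1) = move (S k)"
      "\<And>k. next_stage f (S k) (F (2 * k + 2)) (S (Suc k))"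
  shows "inverse_limit (\<lambda>n. Cod (F n)) (\<lambda>n. Fun (F n)) homeomorphic_space top_of_set (threads f)"
proof -
  let ?T = "inverse_limit (\<lambda>n. Cod (F n)) (\<lambda>n. Fun (F n))"
  have FP: "Peano_continuum (Cod (F n))" "continuous_map (Cod (F (Suc n))) (Cod (F n)) (Fun (F n))"
    "Fun (F n) ` topspace (Cod (F (Suc n))) = topspace (Cod (F n))" for n
    using F(1)[of n] F(2)[of n] by (auto simp: Peano_s_def)
  have D: "Dom (move (S k)) = Cod (F (2 * k + 2))" "Cod (move (S k)) = Cod (F (2 * k + 1))" for k
    using F(2)[of "2 * k + 1"] S(2)[of k] by simp_all
  have inn: "continuous_map (Cod (F (2 * k + 2))) (top_of_set {0..1}) (inn (S k))"
    "inn (S k) ` topspace (Cod (F (2 * k + 2))) = {0..1}"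
    "\<And>x. x \<in> topspace (Cod (F (2 * k + 2))) \<Longrightarrow> Fun (F (2 * k + 1)) x = out (S k) (inn (S k) x)" for k
    using S(1)[of k] S(2)[of k] unfolding valid_stage_def D by simp_all
  have st: "0 < tol (S k)" "id \<in> set (comparisons (S k))"
    "\<And>i u t. i \<le> level (S k) \<Longrightarrow> u \<in> {0..1} \<Longrightarrow> t \<in> {0..1} \<Longrightarrow> \<bar>u - t\<bar> \<le> err (S k) \<Longrightarrow>
        \<bar>bond f i (level (S k)) u - bond f i (level (S k)) t\<bar> \<le> tol (S k)" for k
    using S(1)[of k] unfolding valid_stage_def by blast+
  define l where "l k = link (S k) (F (2 * k + 2)) (S (Suc k))" for k
  have nx: "level (S k) < level (S (Suc k))"
    "\<And>t. t \<in> {0..1} \<Longrightarrow> \<bar>l k t - bond f (level (S k)) (level (S (Suc k))) t\<bar> \<le> err (S k)"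
    "comparisons (S (Suc k)) = id # map (\<lambda>q. q \<circ> l k) (comparisons (S k))"
    "tol (S (Suc k)) \<le> tol (S k) / 2"
    "\<And>q u t. q \<in> set (comparisons (S (Suc k))) \<Longrightarrow> u \<in> {0..1} \<Longrightarrow> t \<in> {0..1} \<Longrightarrow>
       \<bar>u - t\<bar> \<le> 4 * tol (S (Suc k)) \<Longrightarrow> \<bar>q u - q t\<bar> \<le> tol (S k)" for k
    using S(3)[of k] unfolding next_stage_def l_def by blast+
  \<comment> \<open>Odd's move number \<open>k\<close> is \<open>F (2 * k + 1)\<close>, whose domain
    is space number \<open>2 * k + 2\<close>. By its factorisation \<open>y k x\<close> determines
    coordinate \<open>2 * k + 1\<close> of \<open>x\<close>, and the even coordinates follow by the
    bonding maps.\<close>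
  define y where "y k x = inn (S k) (x (2 * k + 2))" for k x
  have xT: "x n \<in> topspace (Cod (F n))" "Fun (F n) (x (Suc n)) = x n" if "x \<in> topspace ?T" for x n
    using that unfolding inverse_limit_topspace by blast+
  have yI: "y k x \<in> {0..1}" if "x \<in> topspace ?T" for k x
    using inn(2)[of k] xT(1)[OF that, of "2 * k + 2"] unfolding y_def by blast
  have out: "x (2 * k + 1) = out (S k) (y k x)" if "x \<in> topspace ?T" for k x
    using xT(2)[OF that, of "2 * k + 1"] inn(3)[OF xT(1)[OF that], of k] by (simp add: y_def)
  have yl: "y k x = l k (y (Suc k) x)" if "x \<in> topspace ?T" for k x
    using xT(2)[OF that, of "2 * k + 2"] out[OF that, of "Suc k"] by (simp add: y_def l_def link_def)
  \<comment> \<open>An earlier coordinate is a stored comparison map applied to a later one, so the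
    moduli built into \<open>tol\<close> bound its variation.\<close>
  have cmp: "\<exists>q\<in>set (comparisons (S j)). \<forall>x\<in>topspace ?T. y i x = q (y j x)" if "i \<le> j" for i j
    using that
  proof (induction j)
    case 0
    then show ?case using st(2)[of 0] by (intro bexI[of _ id]) auto
  next
    case (Suc j)
    show ?case
    proof (cases "i = Suc j")
      case True
      then show ?thesis using st(2)[of "Suc j"] by (intro bexI[of _ id]) auto
    next
      case False
      then obtain q where q: "q \<in> set (comparisons (S j))" "\<forall>x\<in>topspace ?T. y i x = q (y j x)"
        using Suc by auto
      then have "q \<circ> l j \<in> set (comparisons (S (Suc j)))" unfolding nx(3) by simp
      moreover have "\<forall>x\<in>topspace ?T. y i x = (q \<circ> l j) (y (Suc j) x)" using q(2) by (simp add: yl[of _ j])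
      ultimately show ?thesis by blast
    qed
  qed
  show ?thesis
  proof (rule homeomorphic_threads[where f = f, OF f, where y = y and n = "\<lambda>k. level (S k)" and \<theta> = "\<lambda>k. tol (S k)"])
    show "compact_space ?T"
      using FP(1,2) by (intro compact_inverse_limit) (auto simp: Peano_continuum_def continuum_space_def)
    show "continuous_map ?T euclideanreal (y k)" for k
    proof -
      have "continuous_map ?T (top_of_set {0..1}) (inn (S k) \<circ> (\<lambda>x. x (2 * k + 2)))"
        using inverse_limit_projection[of "\<lambda>n. Cod (F n)" "\<lambda>n. Fun (F n)" "2 * k + 2"] inn(1)[of k]
        by (rule continuous_map_compose)
      moreover have "inn (S k) \<circ> (\<lambda>x. x (2 * k + 2)) = y k" by (simp add: fun_eq_iff y_def)
      ultimately show ?thesis by (simp add: continuous_map_in_subtopology)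
    qed
    show "y k ` topspace ?T = {0..1}" for k
    proof -
      have "t \<in> y k ` topspace ?T" if "t \<in> {0..1}" for t
      proof -
        have "t \<in> inn (S k) ` topspace (Cod (F (2 * k + 2)))" unfolding inn(2) by (rule that)
        then obtain a where a: "a \<in> topspace (Cod (F (2 * k + 2)))" "inn (S k) a = t" by blast
        have "\<exists>x. (\<forall>n. x n \<in> topspace (Cod (F n)) \<and> Fun (F n) (x (Suc n)) = x n) \<and> x (2 * k + 2) = a"
          by (rule thread_through_point) (fact FP(3), fact a(1))
        then obtain x where "\<forall>n. x n \<in> topspace (Cod (F n)) \<and> Fun (F n) (x (Suc n)) = x n" "x (2 * k + 2) = a"
          by (elim exE conjE) (rule that)
        then show ?thesis using a(2) by (intro image_eqI[of _ _ x]) (auto simp: inverse_limit_topspace y_def)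
      qed
      then show ?thesis using yI by blast
    qed
    show "x = x'" if x: "x \<in> topspace ?T" "x' \<in> topspace ?T" "\<And>k. y k x = y k x'" for x x'
    proof
      fix n
      have odd: "x (2 * k + 1) = x' (2 * k + 1)" for k
        using out[OF x(1), of k] out[OF x(2), of k] x(3)[of k] by simp
      show "x n = x' n"
      proof (cases "even n")
        case True
        then obtain k where "n = 2 * k" by blast
        then show ?thesis using xT(2)[OF x(1), of n] xT(2)[OF x(2), of n] odd[of k] by simp
      next
        case False
        then show ?thesis using odd by (metis oddE)
      qed
    qed
    show "strict_mono (\<lambda>k. level (S k))" using nx(1) by (simp add: strict_mono_Suc_iff)
    show "0 < tol (S k)" "tol (S (Suc k)) \<le> tol (S k) / 2" for k by (rule st(1), rule nx(4))
    show "\<bar>bond f i (level (S (Suc k))) (y (Suc k) x) - bond f i (level (S k)) (y k x)\<bar> \<le> tol (S k)"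
      if "i \<le> level (S k)" "x \<in> topspace ?T" for i k x
    proof -
      let ?t = "bond f (level (S k)) (level (S (Suc k))) (y (Suc k) x)"
      have "?t \<in> {0..1}"
        using interval_surj_bond[where f = f, OF f, of "level (S k)" "level (S (Suc k))"] yI[OF that(2), of "Suc k"] by blast
      moreover have "\<bar>?t - y k x\<bar> \<le> err (S k)"
        using nx(2)[OF yI[OF that(2)], of k] yl[OF that(2), of k] by (simp add: abs_minus_commute)
      ultimately have "\<bar>bond f i (level (S k)) ?t - bond f i (level (S k)) (y k x)\<bar> \<le> tol (S k)"
        using st(3)[OF that(1)] yI[OF that(2)] by blast
      then show ?thesis using bond_trans[OF that(1), of "level (S (Suc k))" f] nx(1)[of k] by simp
    qed
    show "\<bar>y i x - y i x'\<bar> \<le> tol (S j)"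
      if "x \<in> topspace ?T" "x' \<in> topspace ?T" "i \<le> Suc j" "\<bar>y (Suc j) x - y (Suc j) x'\<bar> \<le> 4 * tol (S (Suc j))" for i j x x'
      using cmp[OF that(3)] nx(5)[OF _ yI[OF that(1)] yI[OF that(2)] that(4)] that(1,2) by force
  qed
qed

section \<open>Transfer to the pseudo-arc and to full subcategories\<close>

lemma hered_indec_threads:
  assumes P: "hereditarily_indecomposable P" "Hausdorff_space P" and h: "P homeomorphic_space top_of_set X"
  shows "hered_indec X"
proof -
  obtain g h where gh: "homeomorphic_maps P (top_of_set X) g h" using h unfolding homeomorphic_space_def by blast
  then have h: "continuous_map (top_of_set X) P h" "inj_on h X"
    by (auto simp: homeomorphic_maps_def intro: inj_on_inverseI)
  have image: "h ` A \<subseteq> topspace P \<and> continuum_space (subtopology P (h ` A))" if "A \<subseteq> X" "compact A" "connected A" for A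
  proof -
    have "compactin P (h ` A)" by (rule image_compactin[OF _ h(1)]) (use that in \<open>simp add: compactin_subtopology\<close>)
    moreover have "connectedin P (h ` A)" by (rule connectedin_continuous_map_image[OF h(1)]) (use that in \<open>simp add: connectedin_subtopology\<close>)
    ultimately show ?thesis using P(2)
      by (simp add: continuum_space_def compactin_subspace connectedin_def Hausdorff_space_subtopology)
  qed
  show ?thesis
    unfolding hered_indec_def
  proof (intro allI impI, elim conjE)
    fix A B assume AB: "A \<subseteq> X" "compact A" "connected A" "B \<subseteq> X" "compact B" "connected B"
    have "h ` A \<inter> h ` B = {} \<or> h ` A \<subseteq> h ` B \<or> h ` B \<subseteq> h ` A"
      using P(1) image[OF AB(1-3)] image[OF AB(4-6)] unfolding hereditarily_indecomposable_def by blast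
    moreover have "h ` A \<subseteq> h ` B \<Longrightarrow> A \<subseteq> B" "h ` B \<subseteq> h ` A \<Longrightarrow> B \<subseteq> A"
      using inj_on_image_subset_iff[OF h(2)] AB by blast+
    ultimately show "A \<inter> B = {} \<or> A \<subseteq> B \<or> B \<subseteq> A" by blast
  qed
qed

text \<open>A Urysohn function separating two points maps the connected space \<open>X\<close> onto
  the interval, and a Peano curve continues it onto any Peano continuum. So \<open>X\<close> alone
  gives cofinality and, with fullness, absorption.\<close>

lemma full_subcategory_dominating:
  fixes K :: "'a top_cat"
  assumes K: "full_subcategory K Peano_s" and X: "X \<in> Obj K" "nondegenerate X"
  shows "dominating K Peano_s"
proof -
  have sub: "subcategory K Peano_s" and full: "\<And>f. f \<in> Arr Peano_s \<Longrightarrow> Dom f \<in> Obj K \<Longrightarrow> Cod f \<in> Obj K \<Longrightarrow> f \<in> Arr K"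
    using K by (auto simp: full_subcategory_def)
  have PX: "Peano_continuum X" using sub X(1) by (auto simp: subcategory_def Peano_s_def)
  then have hX: "compact_space X" "Hausdorff_space X" "connected_space X"
    by (auto simp: Peano_continuum_def continuum_space_def)
  obtain p q where pq: "p \<in> topspace X" "q \<in> topspace X" "p \<noteq> q"
    using X(2) by (auto simp: nondegenerate_def)
  have "closedin X {p}" "closedin X {q}" using pq hX(2) by (simp_all add: closedin_Hausdorff_singleton)
  moreover have "normal_space X" using hX by (simp add: compact_Hausdorff_or_regular_imp_normal_space)
  ultimately obtain \<phi> where \<phi>: "continuous_map X (top_of_set {0..1::real}) \<phi>" "\<phi> ` {p} \<subseteq> {0}" "\<phi> ` {q} \<subseteq> {1}"
    using Urysohn_lemma[of X "{p}" "{q}" 0 1] pq(3) by auto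
  have "connected (\<phi> ` topspace X)"
    using connectedin_continuous_map_image[OF \<phi>(1), of "topspace X"] hX(3)
    by (simp add: connectedin_topspace connectedin_subtopology)
  then have "{0..1} \<subseteq> \<phi> ` topspace X"
    using connected_contains_Icc[of "\<phi> ` topspace X" 0 1] \<phi>(2,3) pq by force
  then have \<phi>im: "\<phi> ` topspace X = {0..1}" using \<phi>(1) by (auto simp: continuous_map_in_subtopology)
  have onto: "\<exists>f\<in>Arr Peano_s. Dom f = X \<and> Cod f = Y" if Y: "Peano_continuum Y" for Y :: "'a topology"
  proof -
    obtain \<gamma> :: "real \<Rightarrow> 'a" where \<gamma>: "continuous_map (top_of_set {0..1}) Y \<gamma>" "\<gamma> ` {0..1} = topspace Y"
      using Hahn_Mazurkiewicz[OF Y] by blast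
    have "(\<gamma> \<circ> \<phi>) ` topspace X = topspace Y" by (simp only: image_comp[symmetric] \<phi>im \<gamma>(2))
    from Peano_s_arrowI[OF PX Y continuous_map_compose[OF \<phi>(1) \<gamma>(1)] this]
    show ?thesis by (metis arrow.select_convs(1,2))
  qed
  have "cofinal K Peano_s"
    unfolding cofinal_def using onto X(1) by (fastforce simp: Peano_s_def)
  moreover have "absorbing K Peano_s"
    unfolding absorbing_def
  proof (intro ballI impI)
    fix f :: "'a arrow" assume f: "f \<in> Arr Peano_s" "Cod f \<in> Obj K"
    then have "Peano_continuum (Dom f)" by (simp add: Peano_s_def)
    then obtain g where g: "g \<in> Arr Peano_s" "Dom g = X" "Cod g = Dom f" using onto by blast
    have "comp_arrow f g \<in> Arr Peano_s"
    proof -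
      have "continuous_map X (Cod f) (Fun f \<circ> Fun g)"
        using f g by (auto simp: Peano_s_def intro: continuous_map_compose)
      moreover have "(Fun f \<circ> Fun g) ` topspace X = topspace (Cod f)"
        using f g unfolding image_comp[symmetric] by (auto simp: Peano_s_def)
      moreover have "comp_arrow f g = \<lparr>Dom = X, Cod = Cod f, Fun = restrict (Fun f \<circ> Fun g) (topspace X)\<rparr>"
        using g by (simp add: comp_arrow_def compose_def comp_def)
      ultimately show ?thesis using Peano_s_arrowI[OF PX, of "Cod f" "Fun f \<circ> Fun g"] f(1) by (simp add: Peano_s_def)
    qed
    then have "comp_arrow f g \<in> Arr K" using full X(1) f(2) g(2) by (simp add: comp_arrow_def)
    with g show "\<exists>g\<in>Arr Peano_s. Cod g = Dom f \<and> comp_arrow f g \<in> Arr K" by blast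
  qed
  ultimately show ?thesis using sub by (simp add: dominating_def)
qed

lemma pseudo_arc_generic:
  fixes P :: "'p topology" and e :: "real \<Rightarrow> 'a" and K :: "'a top_cat"
  assumes e: "inj e" and P: "pseudo_arc P" and K: "dominating K Peano_s"
  shows "generic_over P K"
proof -
  obtain f :: "nat \<Rightarrow> real \<Rightarrow> real"
    where f: "\<And>n. continuous_map (top_of_set {0..1}) (top_of_set {0..1}) (f n) \<and> f n ` {0..1} = {0..1}"
      and Pf: "P homeomorphic_space inverse_limit (\<lambda>n. top_of_set {0..1}) f"
    using P unfolding pseudo_arc_def arc_like_def by blast
  have f: "interval_surj (f k)" for k using f[of k] by (simp add: continuous_map_in_subtopology)
  have Pt: "P homeomorphic_space top_of_set (threads f)" using Pf by (simp add: inverse_limit_interval)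
  have PH: "Hausdorff_space P" "connected_space P" "hereditarily_indecomposable P"
    using P by (auto simp: pseudo_arc_def continuum_space_def)
  have "connectedin euclidean (threads f)"
    using homeomorphic_connected_space[OF Pt] PH(2) by (simp add: connectedin_def)
  then have X: "connected (threads f)" "hered_indec (threads f)"
    using hered_indec_threads[OF PH(3,1) Pt] by simp_all
  have sub: "subcategory K Peano_s" using K by (simp add: dominating_def)
  note first = first_stage_exists[where f = f, OF f e K]
    and later = next_stage_exists[where f = f, OF f X e K]
  have "\<exists>\<sigma>. Odd_strategy K \<sigma> \<and> (\<forall>F. run K F \<and> follows \<sigma> F \<longrightarrow>
     (\<exists>S. \<forall>k. valid_stage f (S k) \<and> F (2 * k + 1) = move (S k) \<and> next_stage f (S k) (F (2 * k + 2)) (S (Suc k))))"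
    by (rule Odd_strategy_from_states[OF sub])
       (use first later in blast)+
  then obtain \<sigma> where \<sigma>: "Odd_strategy K \<sigma>" and play: "\<And>F. run K F \<Longrightarrow> follows \<sigma> F \<Longrightarrow>
     \<exists>S. \<forall>k. valid_stage f (S k) \<and> F (2 * k + 1) = move (S k) \<and> next_stage f (S k) (F (2 * k + 2)) (S (Suc k))"
    by blast
  have "inverse_limit (\<lambda>n. Cod (F n)) (\<lambda>n. Fun (F n)) homeomorphic_space P" if F: "run K F" "follows \<sigma> F" for F
  proof -
    obtain S where S: "\<forall>k. valid_stage f (S k) \<and> F (2 * k + 1) = move (S k) \<and> next_stage f (S k) (F (2 * k + 2)) (S (Suc k))"
      using play[OF F] by blast
    have FA: "F n \<in> Arr Peano_s" "Cod (F (Suc n)) = Dom (F n)" for n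
      using F(1) sub by (auto simp: run_def subcategory_def)
    have "inverse_limit (\<lambda>n. Cod (F n)) (\<lambda>n. Fun (F n)) homeomorphic_space top_of_set (threads f)"
      by (rule run_limit_homeomorphic_threads[where f = f and F = F and S = S, OF f FA]) (use S in simp_all)
    then show ?thesis using Pt homeomorphic_space_sym homeomorphic_space_trans by blast
  qed
  then show ?thesis using \<sigma> unfolding generic_over_def by blast
qed

(* The objects of Peano_s :: 'a top_cat are the Peano continua carried by subsets of the type 'a.
   The injection ensures that every Peano continuum has a homeomorphic copy among them;
   otherwise Peano_s could consist of one-point spaces only. *)

theorem theorem3p9:
  fixes P :: "'p topology" and e :: "real \<Rightarrow> 'a"
  assumes "inj e" and "pseudo_arc P"
  shows "(\<forall>K :: 'a top_cat. dominating K Peano_s \<longrightarrow> generic_over P K) \<and>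
         (\<forall>K :: 'a top_cat. full_subcategory K Peano_s \<and> (\<exists>X\<in>Obj K. nondegenerate X)
            \<longrightarrow> generic_over P K)"
  using pseudo_arc_generic[OF assms] full_subcategory_dominating by blast

end
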